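(* Let $\Bbbk$ be a countable totally ordered division ring and let $T$ be a forest in which every element has countable height. Let $\vec{L}=(L_s,\varphi_{s,t}\mid s\le t\text{ in }T)$ be a $T$-indexed commutative diagram in which every $L_s$ is a countable completely normal distributive $0$-lattice and every $\varphi_{s,t}\colon L_s\to L_t$ is a closed $0$-lattice homomorphism. Then there is a $T$-indexed commutative diagram $\vec{E}=(E_s,f_{s,t}\mid s\le t\text{ in }T)$ of $\Bbbk$-vector lattices and $\Bbbk$-vector lattice homomorphisms such that $\vec{L}$ is isomorphic to $\operatorname{Id_c}\vec{E}$; that is, there are lattice isomorphisms $\chi_t\colon\operatorname{Id_c}E_t\to L_t$ ($t\in T$) such that $\chi_t\circ\operatorname{Id_c}f_{s,t}=\varphi_{s,t}\circ\chi_s$ whenever $s\le t$ in $T$.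
   Context: "Countable" means "at most countable". A poset $T$ is a forest if every principal ideal $\{s\in T\mid s\le t\}$ of $T$ is well-ordered under the induced order; the height of $t$ is the order type of $\{s\in T\mid s<t\}$. A $T$-indexed commutative diagram is a functor from $T$ (viewed as a category), i.e. a family of objects $L_s$ and morphisms $\varphi_{s,t}\colon L_s\to L_t$ for $s\le t$, with $\varphi_{s,s}=\mathrm{id}$ and $\varphi_{s,u}=\varphi_{t,u}\circ\varphi_{s,t}$ for $s\le t\le u$. A $\Bbbk$-vector lattice, for a totally ordered division ring $\Bbbk$, is a left $\Bbbk$-vector space $E$ endowed with a translation-invariant lattice order such that $\Bbbk^+E^+\subseteq E^+$, where $G^+=\{x\in G\mid 0\le x\}$. A $\Bbbk$-vector lattice homomorphism is a map that is both $\Bbbk$-linear and a lattice homomorphism. Write $|x|=x\vee(-x)$. For $a\in E$, $\langle a\rangle_E=\{x\in E\mid (\exists\lambda\in\Bbbk^+)\ |x|\le\lambda|a|\}$ is the principal $\ell$-ideal generated by $a$. $\operatorname{Id_c}E=\{\langle a\rangle_E\mid a\in E^+\}$, ordered by inclusion, is a distributive lattice with least element $\{0\}$. For a $\Bbbk$-vector lattice homomorphism $f\colon E\to F$, $\operatorname{Id_c}f\colon\operatorname{Id_c}E\to\operatorname{Id_c}F$ is the map $\langle x\rangle_E\mapsto\langle f(x)\rangle_F$. This makes $\operatorname{Id_c}$ a functor. A distributive $0$-lattice is a distributive lattice with a least element $0$; a $0$-lattice homomorphism is a lattice homomorphism preserving $0$. A distributive $0$-lattice $L$ is completely normal if for all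 $a,b\in L$ there are $x,y\in L$ such that $a\vee b=a\vee y=x\vee b$ and $x\wedge y=0$. A lattice homomorphism $f\colon K\to L$ is closed if for all $a,b\in K$ and all $x\in L$ with $f(a)\le f(b)\vee x$ there exists $u\in K$ such that $a\le b\vee u$ and $f(u)\le x$. *)

theory Defs
  imports "HOL-Algebra.Algebra" "HOL-Library.Countable_Set"
begin

section \<open>Forests and diagrams\<close>

text \<open>A poset is a carrier \<open>T\<close> with a reflexive order relation \<open>r\<close>, where
  \<open>(s, t) \<in> r\<close> means \<open>s \<le> t\<close>.\<close>

definition forest :: "'t set \<Rightarrow> 't rel \<Rightarrow> bool" where
  "forest T r \<longleftrightarrow> partial_order_on T r
     \<and> (\<forall>t\<in>T. well_order_on (under r t) (Restr r (under r t)))"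

text \<open>As usual in HOL, an order type is represented by a well-order relation having
  that type; the order type is countable iff the field of the relation is.\<close>

definition height :: "'t rel \<Rightarrow> 't \<Rightarrow> 't rel" where
  "height r t = Restr r (underS r t)"

definition countable_height :: "'t rel \<Rightarrow> 't \<Rightarrow> bool" where
  "countable_height r t \<longleftrightarrow> countable (Field (height r t))"

text \<open>Functors from a poset to a concrete category with objects \<open>Ob\<close> and morphisms
  \<open>Mor\<close>. Maps are total HOL functions, of which only the values on the carriers matter.\<close>

definition commutative_diagram ::
  "'t set \<Rightarrow> 't rel \<Rightarrow> (('a, 'm) partial_object_scheme \<Rightarrow> bool)
    \<Rightarrow> (('a, 'm) partial_object_scheme \<Rightarrow> ('a, 'm) partial_object_scheme \<Rightarrow> ('a \<Rightarrow> 'a) \<Rightarrow> bool)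
    \<Rightarrow> ('t \<Rightarrow> ('a, 'm) partial_object_scheme) \<Rightarrow> ('t \<Rightarrow> 't \<Rightarrow> 'a \<Rightarrow> 'a) \<Rightarrow> bool" where
  "commutative_diagram T r Ob Mor A \<phi> \<longleftrightarrow>
     (\<forall>t\<in>T. Ob (A t))
   \<and> (\<forall>s t. (s, t) \<in> r \<longrightarrow> Mor (A s) (A t) (\<phi> s t))
   \<and> (\<forall>t\<in>T. \<forall>x\<in>carrier (A t). \<phi> t t x = x)
   \<and> (\<forall>s t u. (s, t) \<in> r \<longrightarrow> (t, u) \<in> r \<longrightarrow>
        (\<forall>x\<in>carrier (A s). \<phi> s u x = \<phi> t u (\<phi> s t x)))"

section \<open>Distributive lattices with zero\<close>

locale distributive_zero_lattice = lattice L + weak_partial_order_bottom L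
  for L (structure) +
  assumes distrib: "\<lbrakk>x \<in> carrier L; y \<in> carrier L; z \<in> carrier L\<rbrakk>
    \<Longrightarrow> x \<sqinter> (y \<squnion> z) = (x \<sqinter> y) \<squnion> (x \<sqinter> z)"

definition completely_normal :: "('a, 'm) gorder_scheme \<Rightarrow> bool" where
  "completely_normal L \<longleftrightarrow>
     (\<forall>a\<in>carrier L. \<forall>b\<in>carrier L. \<exists>x\<in>carrier L. \<exists>y\<in>carrier L.
        a \<squnion>\<^bsub>L\<^esub> b = a \<squnion>\<^bsub>L\<^esub> y \<and> a \<squnion>\<^bsub>L\<^esub> b = x \<squnion>\<^bsub>L\<^esub> b \<and> x \<sqinter>\<^bsub>L\<^esub> y = \<bottom>\<^bsub>L\<^esub>)"

definition lattice_hom ::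
  "('a, 'm) gorder_scheme \<Rightarrow> ('b, 'n) gorder_scheme \<Rightarrow> ('a \<Rightarrow> 'b) \<Rightarrow> bool" where
  "lattice_hom K L f \<longleftrightarrow> f \<in> carrier K \<rightarrow> carrier L \<and> join_pres K L f \<and> meet_pres K L f"

definition lattice_iso ::
  "('a, 'm) gorder_scheme \<Rightarrow> ('b, 'n) gorder_scheme \<Rightarrow> ('a \<Rightarrow> 'b) \<Rightarrow> bool" where
  "lattice_iso K L f \<longleftrightarrow> lattice_hom K L f \<and> bij_betw f (carrier K) (carrier L)"

definition zero_lattice_hom ::
  "('a, 'm) gorder_scheme \<Rightarrow> ('b, 'n) gorder_scheme \<Rightarrow> ('a \<Rightarrow> 'b) \<Rightarrow> bool" where
  "zero_lattice_hom K L f \<longleftrightarrow> lattice_hom K L f \<and> f \<bottom>\<^bsub>K\<^esub> = \<bottom>\<^bsub>L\<^esub>"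

definition closed_map ::
  "('a, 'm) gorder_scheme \<Rightarrow> ('b, 'n) gorder_scheme \<Rightarrow> ('a \<Rightarrow> 'b) \<Rightarrow> bool" where
  "closed_map K L f \<longleftrightarrow>
     (\<forall>a\<in>carrier K. \<forall>b\<in>carrier K. \<forall>x\<in>carrier L. f a \<sqsubseteq>\<^bsub>L\<^esub> f b \<squnion>\<^bsub>L\<^esub> x \<longrightarrow>
        (\<exists>u\<in>carrier K. a \<sqsubseteq>\<^bsub>K\<^esub> b \<squnion>\<^bsub>K\<^esub> u \<and> f u \<sqsubseteq>\<^bsub>L\<^esub> x))"

definition countable_cn_lattice :: "('a, 'm) gorder_scheme \<Rightarrow> bool" where
  "countable_cn_lattice L \<longleftrightarrow>
     distributive_zero_lattice L \<and> completely_normal L \<and> countable (carrier L)"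

definition closed_zero_lattice_hom ::
  "('a, 'm) gorder_scheme \<Rightarrow> ('b, 'n) gorder_scheme \<Rightarrow> ('a \<Rightarrow> 'b) \<Rightarrow> bool" where
  "closed_zero_lattice_hom K L f \<longleftrightarrow> zero_lattice_hom K L f \<and> closed_map K L f"

section \<open>Vector lattices\<close>

text \<open>The fields \<open>mult\<close> and \<open>one\<close> inherited from \<open>ring\<close> play no role, exactly as for
  the locale \<open>module\<close>. That locale is not used because it requires commutative scalars.\<close>

record ('k, 'e) ordered_module = "('k, 'e) module" +
  vle :: "'e \<Rightarrow> 'e \<Rightarrow> bool"

definition order_of :: "('k, 'e, 'm) ordered_module_scheme \<Rightarrow> 'e gorder" where
  "order_of E = \<lparr>carrier = carrier E, eq = (=), le = vle E\<rparr>"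

text \<open>The sort \<open>{division_ring, linordered_ring_strict}\<close> is that of totally ordered
  division rings; multiplication need not be commutative.\<close>

locale vector_lattice = abelian_group E
  for E :: "('k::{division_ring, linordered_ring_strict}, 'e, 'm) ordered_module_scheme"
    (structure) +
  assumes smult_closed: "x \<in> carrier E \<Longrightarrow> c \<odot> x \<in> carrier E"
    and smult_l_distr: "x \<in> carrier E \<Longrightarrow> (c + d) \<odot> x = c \<odot> x \<oplus> d \<odot> x"
    and smult_r_distr: "\<lbrakk>x \<in> carrier E; y \<in> carrier E\<rbrakk>
      \<Longrightarrow> c \<odot> (x \<oplus> y) = c \<odot> x \<oplus> c \<odot> y"
    and smult_assoc: "x \<in> carrier E \<Longrightarrow> (c * d) \<odot> x = c \<odot> (d \<odot> x)"
    and smult_one: "x \<in> carrier E \<Longrightarrow> 1 \<odot> x = x"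
    and lattice_order: "lattice (order_of E)"
    and translation_invariant:
      "\<lbrakk>x \<in> carrier E; y \<in> carrier E; z \<in> carrier E; vle E x y\<rbrakk>
        \<Longrightarrow> vle E (x \<oplus> z) (y \<oplus> z)"
    and smult_nonneg: "\<lbrakk>0 \<le> c; x \<in> carrier E; vle E \<zero> x\<rbrakk> \<Longrightarrow> vle E \<zero> (c \<odot> x)"

definition vector_lattice_hom ::
  "('k::{division_ring, linordered_ring_strict}, 'e, 'm) ordered_module_scheme
    \<Rightarrow> ('k, 'f, 'n) ordered_module_scheme \<Rightarrow> ('e \<Rightarrow> 'f) \<Rightarrow> bool" where
  "vector_lattice_hom E F f \<longleftrightarrow>
     (\<forall>x\<in>carrier E. \<forall>y\<in>carrier E. f (x \<oplus>\<^bsub>E\<^esub> y) = f x \<oplus>\<^bsub>F\<^esub> f y)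
   \<and> (\<forall>c. \<forall>x\<in>carrier E. f (c \<odot>\<^bsub>E\<^esub> x) = c \<odot>\<^bsub>F\<^esub> f x)
   \<and> lattice_hom (order_of E) (order_of F) f"

definition pos_cone :: "('k, 'e, 'm) ordered_module_scheme \<Rightarrow> 'e set" where
  "pos_cone E = {x \<in> carrier E. vle E \<zero>\<^bsub>E\<^esub> x}"

definition vabs :: "('k, 'e, 'm) ordered_module_scheme \<Rightarrow> 'e \<Rightarrow> 'e" where
  "vabs E x = x \<squnion>\<^bsub>order_of E\<^esub> (\<ominus>\<^bsub>E\<^esub> x)"

definition principal_ideal ::
  "('k::{division_ring, linordered_ring_strict}, 'e, 'm) ordered_module_scheme
    \<Rightarrow> 'e \<Rightarrow> 'e set" where
  "principal_ideal E a =
     {x \<in> carrier E. \<exists>c\<ge>0. vle E (vabs E x) (c \<odot>\<^bsub>E\<^esub> vabs E a)}"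

definition Idc ::
  "('k::{division_ring, linordered_ring_strict}, 'e, 'm) ordered_module_scheme
    \<Rightarrow> 'e set gorder" where
  "Idc E = \<lparr>carrier = principal_ideal E ` pos_cone E, eq = (=), le = (\<subseteq>)\<rparr>"

text \<open>The map sending the ideal generated by \<open>x\<close> to the ideal generated by \<open>f x\<close>; it is
  well defined by the lemma \<open>Idc_map_principal_ideal\<close> below.\<close>

definition Idc_map ::
  "('k::{division_ring, linordered_ring_strict}, 'e, 'm) ordered_module_scheme
    \<Rightarrow> ('k, 'f, 'n) ordered_module_scheme \<Rightarrow> ('e \<Rightarrow> 'f) \<Rightarrow> 'e set \<Rightarrow> 'f set" where
  "Idc_map E F f I =
     (THE J. \<exists>x\<in>pos_cone E. I = principal_ideal E x \<and> J = principal_ideal F (f x))"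

lemma carrier_order_of [simp]: "carrier (order_of E) = carrier E"
  by (simp add: order_of_def)

lemma le_order_of [simp]: "le (order_of E) = vle E"
  by (simp add: order_of_def)

context vector_lattice
begin

interpretation ord: lattice "order_of E"
  by (rule lattice_order)

lemma vabs_closed: "x \<in> carrier E \<Longrightarrow> vabs E x \<in> carrier E"
  using ord.join_closed[of x "\<ominus> x"] by (simp add: vabs_def)

lemma vle_trans:
  "\<lbrakk>vle E x y; vle E y z; x \<in> carrier E; y \<in> carrier E; z \<in> carrier E\<rbrakk> \<Longrightarrow> vle E x z"
  using ord.le_trans[of x y z] by simp

lemma smult_mono:
  assumes "0 \<le> c" "x \<in> carrier E" "y \<in> carrier E" "vle E x y"
  shows "vle E (c \<odot> x) (c \<odot> y)"
proof -
  have d: "y \<oplus> \<ominus> x \<in> carrier E" using assms by simp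
  have "vle E (x \<oplus> \<ominus> x) (y \<oplus> \<ominus> x)"
    using assms by (intro translation_invariant) auto
  then have "vle E \<zero> (c \<odot> (y \<oplus> \<ominus> x))"
    using assms d by (intro smult_nonneg) (auto simp: r_neg)
  then have "vle E (\<zero> \<oplus> c \<odot> x) (c \<odot> (y \<oplus> \<ominus> x) \<oplus> c \<odot> x)"
    using assms d by (intro translation_invariant) (auto simp: smult_closed)
  moreover have "c \<odot> (y \<oplus> \<ominus> x) \<oplus> c \<odot> x = c \<odot> ((y \<oplus> \<ominus> x) \<oplus> x)"
    using assms d by (simp add: smult_r_distr)
  moreover have "(y \<oplus> \<ominus> x) \<oplus> x = y"
    using assms by (simp add: a_assoc l_neg)
  ultimately show ?thesis using assms by (simp add: smult_closed)
qed

lemma principal_ideal_self: "x \<in> carrier E \<Longrightarrow> x \<in> principal_ideal E x"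
  using zero_le_square[of "1 :: 'k"] ord.le_refl[of "vabs E x"]
  by (auto simp: principal_ideal_def smult_one vabs_closed intro!: exI[of _ 1])

lemma principal_ideal_mono:
  assumes x: "x \<in> carrier E" and y: "y \<in> carrier E" and xy: "x \<in> principal_ideal E y"
  shows "principal_ideal E x \<subseteq> principal_ideal E y"
proof
  fix z assume z: "z \<in> principal_ideal E x"
  obtain c where c: "c \<ge> 0" "vle E (vabs E x) (c \<odot> vabs E y)"
    using xy by (auto simp: principal_ideal_def)
  obtain d where d: "d \<ge> 0" "vle E (vabs E z) (d \<odot> vabs E x)" and zE: "z \<in> carrier E"
    using z by (auto simp: principal_ideal_def)
  have "vle E (d \<odot> vabs E x) (d \<odot> (c \<odot> vabs E y))"
    using c d x y by (intro smult_mono) (auto simp: vabs_closed smult_closed)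
  then have "vle E (vabs E z) (d \<odot> (c \<odot> vabs E y))"
    by (rule vle_trans[OF d(2)]) (use x y zE in \<open>auto simp: vabs_closed smult_closed\<close>)
  moreover have "0 \<le> d * c" using c d by simp
  ultimately show "z \<in> principal_ideal E y"
    using zE y by (auto simp: principal_ideal_def smult_assoc vabs_closed intro!: exI[of _ "d * c"])
qed

end

lemma Idc_map_principal_ideal:
  assumes E: "vector_lattice E" and F: "vector_lattice F"
    and f: "vector_lattice_hom E F f" and x: "x \<in> pos_cone E"
  shows "Idc_map E F f (principal_ideal E x) = principal_ideal F (f x)"
proof -
  interpret E: vector_lattice E by (rule E)
  interpret F: vector_lattice F by (rule F)
  interpret h: abelian_group_hom E F f
    using f by (intro abelian_group_homI E.abelian_group_axioms F.abelian_group_axioms)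
      (auto simp: group_hom_def group_hom_axioms_def hom_def E.a_group F.a_group
        vector_lattice_hom_def lattice_hom_def)
  have fc: "f y \<in> carrier F" if "y \<in> carrier E" for y
    using that by simp
  have fabs: "f (vabs E y) = vabs F (f y)" if y: "y \<in> carrier E" for y
    using f y by (auto simp: vector_lattice_hom_def lattice_hom_def join_pres_def vabs_def)
  have fle: "vle F (f y) (f z)" if "vle E y z" "y \<in> carrier E" "z \<in> carrier E" for y z
  proof -
    have "f \<in> carrier (order_of E) \<rightarrow> carrier (order_of F)"
      and "join_pres (order_of E) (order_of F) f"
      using f by (auto simp: vector_lattice_hom_def lattice_hom_def)
    then have "isotone (order_of E) (order_of F) f" by (rule join_pres_isotone)
    with that show ?thesis by (auto simp: isotone_def)
  qed
  have le: "principal_ideal F (f y) \<subseteq> principal_ideal F (f z)"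
    if y: "y \<in> carrier E" and z: "z \<in> carrier E"
      and eq: "principal_ideal E y = principal_ideal E z" for y z
  proof -
    have "y \<in> principal_ideal E z" using E.principal_ideal_self[OF y] eq by simp
    then obtain c where c: "c \<ge> 0" "vle E (vabs E y) (c \<odot>\<^bsub>E\<^esub> vabs E z)"
      by (auto simp: principal_ideal_def)
    have "vle F (f (vabs E y)) (f (c \<odot>\<^bsub>E\<^esub> vabs E z))"
      using c y z by (intro fle) (auto simp: E.vabs_closed E.smult_closed)
    moreover have "f (c \<odot>\<^bsub>E\<^esub> vabs E z) = c \<odot>\<^bsub>F\<^esub> f (vabs E z)"
      using f z by (auto simp: vector_lattice_hom_def E.vabs_closed)
    ultimately have "f y \<in> principal_ideal F (f z)"
      using c y z fc by (auto simp: principal_ideal_def fabs)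
    then show ?thesis using y z fc by (intro F.principal_ideal_mono) auto
  qed
  show ?thesis
    unfolding Idc_map_def
  proof (rule the_equality)
    show "\<exists>z\<in>pos_cone E. principal_ideal E x = principal_ideal E z
            \<and> principal_ideal F (f x) = principal_ideal F (f z)"
      using x by blast
  next
    fix J
    assume "\<exists>z\<in>pos_cone E. principal_ideal E x = principal_ideal E z
              \<and> J = principal_ideal F (f z)"
    then obtain z where "z \<in> pos_cone E" "principal_ideal E x = principal_ideal E z"
      and J: "J = principal_ideal F (f z)" by blast
    then show "J = principal_ideal F (f x)"
      using x le[of x z] le[of z x] by (auto simp: pos_cone_def)
  qed
qed

text \<open>HOL cannot quantify existentially over types, so an existence claim for vector
  lattices must name a type containing the carriers. When the scalars, the lattices
  \<open>L\<^sub>t\<close> and the heights are countable, \<open>nat\<close> is enough: given a diagram \<open>E\<close> over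
  any type with \<open>Idc E\<close> isomorphic to \<open>L\<close>, choose for every \<open>s\<close> countably many
  generators of the members of \<open>Idc E\<^sub>s\<close>, and replace \<open>E\<^sub>t\<close> by the sub-vector-lattice
  generated by the images of the generators chosen for all \<open>s \<le> t\<close>. It is countable
  and has the same \<open>Idc\<close>, up to isomorphism natural in \<open>t\<close>.\<close>

end

theory Submission
  imports Defs "HOL-Library.Function_Algebras"
begin

text \<open>A vector lattice \<open>E\<close> with \<open>Id\<^sub>c E \<cong> L\<close> is encoded by the map \<open>p: E \<rightarrow> L\<close> sending \<open>v\<close> to
  the ideal generated by \<open>v\<^sup>+\<close>. Such maps are characterized by \<open>p (v + w) \<le> p v \<or> p w\<close>,
  \<open>p (c v) = p v\<close> for \<open>c > 0\<close>, and \<open>p v \<and> p (- v) = 0\<close>; they make sense on any vector space, and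
  if \<open>p\<close> is onto, has positive parts and is closed in the sense that \<open>p a \<le> p b \<or> x\<close> implies
  \<open>p a \<and> p (a - n b) \<le> x\<close> for some \<open>n > 0\<close>, then the quotient of the vector space by
  \<open>{v | p v = p (- v) = 0}\<close> is the required vector lattice.

  Extending \<open>p\<close> from \<open>V\<close> to \<open>V \<oplus> \<Bbbk> e\<close> amounts to choosing \<open>p (e - u)\<close> and \<open>p (u - e)\<close> for all
  \<open>u \<in> V\<close>, subject to triangle inequalities for the asymmetric \<open>L\<close>-valued distance \<open>p (u - v)\<close>.
  By complete normality, a choice for finitely many \<open>u\<close> extends to one more \<open>u\<close>, with enough freedom to
  keep \<open>p\<close> closed; countability then gives a total choice. Adding countably many
  dimensions \<open>e\<close> makes \<open>p\<close> onto and provides positive parts. Along the forest, \<open>E\<^sub>t\<close> is built over the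
  vector space with basis \<open>{s | s \<le> t} \<times> \<nat>\<close>, starting from the
  map induced by the \<open>E\<^sub>s\<close> with \<open>s < t\<close>, which is closed because the \<open>\<phi>\<^sub>s\<^sub>t\<close> are.\<close>

section \<open>Ring-of-sets valued vector spaces\<close>

text \<open>Vector lattices are not amalgamated along the forest. Maps \<open>p\<close> on free
  vector spaces are enlarged one basis vector at a time, and kernels are divided out only at the
  end. All these spaces lie in one function space, so the transition maps come from inclusions and
  functoriality is immediate. The obstacle is closedness: it asks for some \<open>n\<close> for each
  of infinitely many triples, and values of \<open>p\<close> chosen point by point could violate it
  forever. The way out is the identity \<open>a - n (e - u) = n (v - e)\<close> with
  \<open>v = u + a / n\<close>: a closedness requirement involving the new vector \<open>e\<close>
  concerns the value at just one further point \<open>v\<close>. If finitely many values are already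
  fixed, a large \<open>n\<close> leaves enough freedom at that point, because \<open>p\<close> is
  closed on the old space. So each requirement can be met at a finite stage and stays met. Listing
  the requirements is what needs countable scalars, heights and lattices. Values and positive parts
  come from the same extension step, started from a cut with one or two prescribed points.\<close>

lemma division_ring_zero_less_one: "(0::'k::{division_ring, linordered_ring_strict}) < 1"
  using zero_le_square[of "1::'k"] by (simp add: order_less_le)

lemma division_ring_inverse_pos:
  fixes c :: "'k::{division_ring, linordered_ring_strict}"
  assumes "0 < c" shows "0 < inverse c"
proof (rule ccontr)
  assume "\<not> 0 < inverse c"
  then have "c * inverse c \<le> 0"
    using assms by (intro mult_nonneg_nonpos) auto
  moreover have "c * inverse c = 1" using assms by simp
  ultimately have "(1::'k) \<le> 0" by (simp only:)
  then show False using division_ring_zero_less_one[where 'k='k] leD by blast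
qed

locale left_space =
  fixes scale :: "'k::{division_ring, linordered_ring_strict} \<Rightarrow> 'v::ab_group_add \<Rightarrow> 'v" (infixr \<open>*v\<close> 75)
  assumes scale_add: "c *v (x + y) = c *v x + c *v y"
    and add_scale: "(c + d) *v x = c *v x + d *v x"
    and scale_scale: "c *v d *v x = (c * d) *v x"
    and scale_one: "1 *v x = x"
begin

lemma scale_zero [simp]: "c *v 0 = 0"
  using scale_add[of c 0 0] by simp

lemma zero_scale [simp]: "0 *v x = 0"
  using add_scale[of 0 0 x] by simp

lemma scale_minus: "c *v (- x) = - (c *v x)"
  using scale_add[of c x "- x"] by (simp add: eq_neg_iff_add_eq_0 add.commute)

lemma minus_scale: "(- c) *v x = - (c *v x)"
  using add_scale[of c "- c" x] by (simp add: eq_neg_iff_add_eq_0 add.commute)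

lemma scale_diff: "c *v (x - y) = c *v x - c *v y"
  using scale_add[of c x "- y"] by (simp add: scale_minus)

lemma diff_scale: "(c - d) *v x = c *v x - d *v x"
  using add_scale[of c "- d" x] by (simp add: minus_scale)

lemma scale_inverse: "c \<noteq> 0 \<Longrightarrow> c *v inverse c *v x = x" "c \<noteq> 0 \<Longrightarrow> inverse c *v c *v x = x"
  by (simp_all add: scale_scale scale_one)

definition subspace :: "'v set \<Rightarrow> bool" where
  "subspace V \<longleftrightarrow> 0 \<in> V \<and> (\<forall>x\<in>V. \<forall>y\<in>V. x + y \<in> V) \<and> (\<forall>c. \<forall>x\<in>V. c *v x \<in> V)"

end

section \<open>Simultaneous separation in completely normal rings of sets\<close>

text \<open>By Stone duality, a completely normal distributive lattice with zero is a ring of sets.\<close>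

locale normal_set_ring =
  fixes LL :: "'x set set"
  assumes empty_mem [simp]: "{} \<in> LL"
    and Un_mem [simp]: "a \<in> LL \<Longrightarrow> b \<in> LL \<Longrightarrow> a \<union> b \<in> LL"
    and Int_mem [simp]: "a \<in> LL \<Longrightarrow> b \<in> LL \<Longrightarrow> a \<inter> b \<in> LL"
    and normal: "a \<in> LL \<Longrightarrow> b \<in> LL \<Longrightarrow> \<exists>x\<in>LL. \<exists>y\<in>LL. a \<subseteq> b \<union> x \<and> b \<subseteq> a \<union> y \<and> x \<inter> y = {}"
begin

text \<open>A point of \<open>g\<close> outside \<open>D\<close> lies in \<open>G\<close> or in
  \<open>N\<close>, and normality applied to \<open>G\<close> and \<open>D\<close> separates the two
  differences of these sets by \<open>u\<close> and \<open>z\<close>. Restricting the witnesses to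
  \<open>g\<close> and \<open>e\<close> removes the mixed terms, as \<open>g\<close> misses
  \<open>M\<close> and \<open>e\<close> misses \<open>N\<close>; what is left of their overlap lies
  in \<open>u \<inter> z\<close>.\<close>

lemma separation:
  assumes "g \<in> LL" "D \<in> LL" "e \<in> LL" "G \<in> LL" "M \<in> LL" "N \<in> LL"
    and "g \<subseteq> G \<union> D \<union> N" "e \<subseteq> G \<union> D \<union> M" "g \<inter> M = {}" "e \<inter> N = {}"
  shows "\<exists>s\<in>LL. \<exists>t\<in>LL. s \<inter> t = {} \<and> g \<subseteq> D \<union> s \<and> e \<subseteq> G \<union> t"
proof -
  obtain u z where uz: "u \<in> LL" "z \<in> LL" "G \<subseteq> D \<union> u" "D \<subseteq> G \<union> z" "u \<inter> z = {}"
    using normal[of G D] assms by blast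
  show ?thesis
    by (rule bexI[of _ "g \<inter> (u \<union> N)"], rule bexI[of _ "e \<inter> (z \<union> M)"])
      (use uz assms in \<open>auto\<close>)
qed

text \<open>Pairwise solutions with a common left side combine to \<open>s \<inter> s'\<close> and
  \<open>t \<union> t'\<close>, which are again disjoint. \<open>finite_separation\<close> then
  dualizes this: unions on the left, intersections on the right.\<close>

lemma finite_separation_left:
  assumes "finite J" "g \<in> LL" "\<forall>(e, G)\<in>J. \<exists>s\<in>LL. \<exists>t\<in>LL. s \<inter> t = {} \<and> g \<subseteq> D \<union> s \<and> e \<subseteq> G \<union> t"
  shows "\<exists>s\<in>LL. \<exists>t\<in>LL. s \<inter> t = {} \<and> g \<subseteq> D \<union> s \<and> (\<forall>(e, G)\<in>J. e \<subseteq> G \<union> t)"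
  using assms
proof (induction J)
  case empty
  then show ?case by (intro bexI[of _ g] bexI[of _ "{}"]) auto
next
  case (insert j J)
  obtain e G where j: "j = (e, G)" by force
  obtain s t where st: "s \<in> LL" "t \<in> LL" "s \<inter> t = {}" "g \<subseteq> D \<union> s" "\<forall>(e, G)\<in>J. e \<subseteq> G \<union> t"
    using insert by auto
  obtain s' t' where st': "s' \<in> LL" "t' \<in> LL" "s' \<inter> t' = {}" "g \<subseteq> D \<union> s'" "e \<subseteq> G \<union> t'"
    using insert.prems j by auto
  show ?case
    by (rule bexI[of _ "s \<inter> s'"], rule bexI[of _ "t \<union> t'"])
      (use st st' j in \<open>auto\<close>)
qed

lemma finite_separation:
  assumes "finite I" "finite J" "\<forall>(g, D)\<in>I. g \<in> LL" "\<forall>(e, G)\<in>J. e \<in> LL"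
    "\<forall>(g, D)\<in>I. \<forall>(e, G)\<in>J. \<exists>s\<in>LL. \<exists>t\<in>LL. s \<inter> t = {} \<and> g \<subseteq> D \<union> s \<and> e \<subseteq> G \<union> t"
  shows "\<exists>s\<in>LL. \<exists>t\<in>LL. s \<inter> t = {} \<and> (\<forall>(g, D)\<in>I. g \<subseteq> D \<union> s) \<and> (\<forall>(e, G)\<in>J. e \<subseteq> G \<union> t)"
  using assms
proof (induction I)
  case empty
  have "\<forall>(e, G)\<in>J. \<exists>s\<in>LL. \<exists>t\<in>LL. s \<inter> t = {} \<and> {} \<subseteq> {} \<union> s \<and> e \<subseteq> G \<union> t"
  proof (intro ballI, clarify)
    fix e G assume "(e, G) \<in> J"
    then have "e \<in> LL" using empty.prems by auto
    then show "\<exists>s\<in>LL. \<exists>t\<in>LL. s \<inter> t = {} \<and> {} \<subseteq> {} \<union> s \<and> e \<subseteq> G \<union> t"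
      by (intro bexI[of _ "{}"] bexI[of _ e]) auto
  qed
  from finite_separation_left[OF \<open>finite J\<close> empty_mem this]
  show ?case by auto
next
  case (insert i I)
  obtain g D where i: "i = (g, D)" by force
  obtain s t where st: "s \<in> LL" "t \<in> LL" "s \<inter> t = {}" "\<forall>(g, D)\<in>I. g \<subseteq> D \<union> s" "\<forall>(e, G)\<in>J. e \<subseteq> G \<union> t"
    using insert by auto
  obtain s' t' where st': "s' \<in> LL" "t' \<in> LL" "s' \<inter> t' = {}" "g \<subseteq> D \<union> s'" "\<forall>(e, G)\<in>J. e \<subseteq> G \<union> t'"
    using finite_separation_left[of J g D] insert.prems i by auto
  have "\<forall>(e, G)\<in>J. e \<subseteq> G \<union> (t \<inter> t')" using st(5) st'(5) by blast
  then show ?case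
    by (intro bexI[of _ "s \<union> s'"] bexI[of _ "t \<inter> t'"]) (use st st' i in \<open>auto\<close>)
qed

end

section \<open>Valued spaces and closedness\<close>

locale valued_space = left_space scale + normal_set_ring LL
  for scale :: "'k::{division_ring, linordered_ring_strict} \<Rightarrow> 'v::ab_group_add \<Rightarrow> 'v" (infixr \<open>*v\<close> 75)
    and LL :: "'x set set" +
  fixes V :: "'v set" and p :: "'v \<Rightarrow> 'x set"
  assumes subspace: "subspace V"
    and p_mem [simp]: "x \<in> V \<Longrightarrow> p x \<in> LL"
    and p_add: "x \<in> V \<Longrightarrow> y \<in> V \<Longrightarrow> p (x + y) \<subseteq> p x \<union> p y"
    and p_scale: "x \<in> V \<Longrightarrow> 0 < c \<Longrightarrow> p (c *v x) = p x"
    and p_disjoint: "x \<in> V \<Longrightarrow> p x \<inter> p (- x) = {}"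
begin

lemma V_closed [simp]: "0 \<in> V" "x \<in> V \<Longrightarrow> y \<in> V \<Longrightarrow> x + y \<in> V" "x \<in> V \<Longrightarrow> c *v x \<in> V"
  "x \<in> V \<Longrightarrow> - x \<in> V" "x \<in> V \<Longrightarrow> y \<in> V \<Longrightarrow> x - y \<in> V"
proof -
  show *: "0 \<in> V" "\<And>x y. x \<in> V \<Longrightarrow> y \<in> V \<Longrightarrow> x + y \<in> V" "\<And>x c. x \<in> V \<Longrightarrow> c *v x \<in> V"
    using subspace by (auto simp: subspace_def)
  show **: "- x \<in> V" if "x \<in> V" for x
    using *(3)[of x "- 1"] that by (simp add: minus_scale scale_one)
  show "x - y \<in> V" if "x \<in> V" "y \<in> V" for x y
    using *(2)[of x "- y"] ** that by simp
qed

lemma p_zero [simp]: "p 0 = {}"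
  using p_disjoint[of 0] by simp

text \<open>Write \<open>x = (x + y) + (- y)\<close>: a point of \<open>p x\<close> lies in
  \<open>p (x + y)\<close> or in \<open>p (- y)\<close>, and the latter misses
  \<open>p y\<close>.\<close>

lemma p_Int: "x \<in> V \<Longrightarrow> y \<in> V \<Longrightarrow> p x \<inter> p y \<subseteq> p (x + y)"
  using p_add[of "x + y" "- y"] p_disjoint[of y] by auto

lemma p_triangle: "u \<in> V \<Longrightarrow> v \<in> V \<Longrightarrow> w \<in> V \<Longrightarrow> p (u - w) \<subseteq> p (u - v) \<union> p (v - w)"
  using p_add[of "u - v" "v - w"] by simp

lemma p_diff_disjoint: "u \<in> V \<Longrightarrow> v \<in> V \<Longrightarrow> p (u - v) \<inter> p (v - u) = {}"
  using p_disjoint[of "u - v"] by simp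

text \<open>Order reversal. Through it, results about one sign of a new vector yield those about the
  other.\<close>

lemma opposite: "valued_space scale LL V (\<lambda>v. p (- v))"
proof
  show "subspace V" by (rule subspace)
  fix x y and c :: 'k assume x: "x \<in> V"
  show "p (- x) \<in> LL" using x by simp
  show "p (- x) \<inter> p (- (- x)) = {}" using p_disjoint[of "- x"] x by simp
  show "p (- (c *v x)) = p (- x)" if "0 < c" using p_scale[of "- x" c] that x by (simp add: scale_minus)
  show "p (- (x + y)) \<subseteq> p (- x) \<union> p (- y)" if "y \<in> V"
    using p_add[of "- x" "- y"] x that by (simp add: algebra_simps)
qed

text \<open>For \<open>x = {}\<close> and \<open>p (- b) = {}\<close> the conclusion means
  \<open>a \<le> n b\<close>, since then \<open>p (a - n *v b)\<close> is contained in
  \<open>p a\<close>. General \<open>x\<close> is kept for the passage along the forest, where even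
  an empty \<open>x\<close> may pull back to a nonempty set.\<close>

definition closed_val :: bool where
  "closed_val \<longleftrightarrow> (\<forall>a\<in>V. \<forall>b\<in>V. \<forall>x\<in>LL. p a \<subseteq> p b \<union> x \<longrightarrow> (\<exists>n>0. p a \<inter> p (a - n *v b) \<subseteq> x))"

text \<open>\<open>a - n *v b\<close> is the convex combination of \<open>a\<close> and
  \<open>a - m *v b\<close> with weights \<open>1 - r\<close> and \<open>r = n * inverse m\<close>.
  The order of the factors matters, since \<open>r * m = n\<close> is needed over noncommuting
  scalars.\<close>

lemma closed_mono:
  assumes "a \<in> V" "b \<in> V" "0 < n" "n \<le> m" "p a \<inter> p (a - n *v b) \<subseteq> x"
  shows "p a \<inter> p (a - m *v b) \<subseteq> x"
proof (cases "n = m")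
  case False
  have m: "0 < m" using assms by simp
  define r where "r = n * inverse m"
  have im: "0 < inverse m" using m by (rule division_ring_inverse_pos)
  have r: "0 < r" using assms im by (simp add: r_def)
  have "n * inverse m < m * inverse m"
    using assms False im by (intro mult_strict_right_mono) auto
  then have r1: "0 < 1 - r" using m by (simp add: r_def)
  have rm: "r * m = n" using m by (simp add: r_def mult.assoc)
  have "p a \<inter> p (a - m *v b) = p ((1 - r) *v a) \<inter> p (r *v (a - m *v b))"
    using p_scale[of a "1 - r"] p_scale[of "a - m *v b" r] r r1 assms by simp
  also have "\<dots> \<subseteq> p ((1 - r) *v a + r *v (a - m *v b))"
    using assms by (intro p_Int) auto
  also have "(1 - r) *v a + r *v (a - m *v b) = a - n *v b"
    by (simp add: diff_scale scale_diff scale_one scale_scale rm)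
  finally show ?thesis using assms by blast
qed (use assms in simp)

section \<open>Extending a finite cut by one point\<close>

text \<open>\<open>\<alpha> u\<close> and \<open>\<beta> u\<close> are the future values of \<open>p (e - u)\<close> and \<open>p (u - e)\<close> at a new vector \<open>e\<close>.\<close>

definition cut_fun :: "'v set \<Rightarrow> ('v \<Rightarrow> 'x set) \<Rightarrow> ('v \<Rightarrow> 'x set) \<Rightarrow> bool" where
  "cut_fun F \<alpha> \<beta> \<longleftrightarrow> F \<subseteq> V \<and> (\<forall>u\<in>F. \<alpha> u \<in> LL \<and> \<beta> u \<in> LL \<and> \<alpha> u \<inter> \<beta> u = {})
     \<and> (\<forall>u\<in>F. \<forall>v\<in>F. \<alpha> u \<subseteq> \<alpha> v \<union> p (v - u) \<and> \<beta> u \<subseteq> p (u - v) \<union> \<beta> v \<and> p (u - v) \<subseteq> \<beta> u \<union> \<alpha> v)"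

definition cut_point :: "'v set \<Rightarrow> ('v \<Rightarrow> 'x set) \<Rightarrow> ('v \<Rightarrow> 'x set) \<Rightarrow> 'v \<Rightarrow> 'x set \<Rightarrow> 'x set \<Rightarrow> bool" where
  "cut_point F \<alpha> \<beta> v a b \<longleftrightarrow> a \<in> LL \<and> b \<in> LL \<and> a \<inter> b = {} \<and>
     (\<forall>i\<in>F. a \<subseteq> \<alpha> i \<union> p (i - v) \<and> b \<subseteq> \<beta> i \<union> p (v - i)
       \<and> \<alpha> i \<subseteq> p (v - i) \<union> a \<and> p (i - v) \<subseteq> \<beta> i \<union> a
       \<and> \<beta> i \<subseteq> p (i - v) \<union> b \<and> p (v - i) \<subseteq> \<alpha> i \<union> b)"

lemma cut_funD:
  assumes "cut_fun F \<alpha> \<beta>"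
  shows "F \<subseteq> V" "u \<in> F \<Longrightarrow> \<alpha> u \<in> LL" "u \<in> F \<Longrightarrow> \<beta> u \<in> LL" "u \<in> F \<Longrightarrow> \<alpha> u \<inter> \<beta> u = {}"
    "u \<in> F \<Longrightarrow> v \<in> F \<Longrightarrow> \<alpha> u \<subseteq> \<alpha> v \<union> p (v - u)"
    "u \<in> F \<Longrightarrow> v \<in> F \<Longrightarrow> \<beta> u \<subseteq> p (u - v) \<union> \<beta> v"
    "u \<in> F \<Longrightarrow> v \<in> F \<Longrightarrow> p (u - v) \<subseteq> \<beta> u \<union> \<alpha> v"
  using assms by (auto simp: cut_fun_def)

text \<open>The distance \<open>p (v - v)\<close> is empty, which squeezes \<open>a\<close> and
  \<open>b\<close> onto the old values. Points can therefore be added without checking that they are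
  new.\<close>

lemma cut_point_same:
  "cut_point F \<alpha> \<beta> v a b \<Longrightarrow> v \<in> F \<Longrightarrow> a = \<alpha> v \<and> b = \<beta> v"
  by (force simp: cut_point_def)

lemma cut_fun_insert:
  assumes c: "cut_fun F \<alpha> \<beta>" and q: "cut_point F \<alpha> \<beta> v a b" and v: "v \<in> V"
  shows "cut_fun (insert v F) (\<alpha>(v := a)) (\<beta>(v := b))"
proof (cases "v \<in> F")
  case True
  then show ?thesis using cut_point_same[OF q] c by (simp add: insert_absorb fun_upd_idem)
next
  case False
  then have *: "i \<noteq> v" if "i \<in> F" for i using that by auto
  show ?thesis
    unfolding cut_fun_def
  proof (intro conjI)
    show "insert v F \<subseteq> V" using cut_funD(1)[OF c] v by simp
    show "\<forall>u\<in>insert v F. (\<alpha>(v := a)) u \<in> LL \<and> (\<beta>(v := b)) u \<in> LL \<and> (\<alpha>(v := a)) u \<inter> (\<beta>(v := b)) u = {}"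
      using c q by (auto simp: cut_fun_def cut_point_def)
    show "\<forall>u\<in>insert v F. \<forall>w\<in>insert v F. (\<alpha>(v := a)) u \<subseteq> (\<alpha>(v := a)) w \<union> p (w - u)
      \<and> (\<beta>(v := b)) u \<subseteq> p (u - w) \<union> (\<beta>(v := b)) w \<and> p (u - w) \<subseteq> (\<beta>(v := b)) u \<union> (\<alpha>(v := a)) w"
    proof (intro ballI)
      fix u w assume uw: "u \<in> insert v F" "w \<in> insert v F"
      show "(\<alpha>(v := a)) u \<subseteq> (\<alpha>(v := a)) w \<union> p (w - u)
      \<and> (\<beta>(v := b)) u \<subseteq> p (u - w) \<union> (\<beta>(v := b)) w \<and> p (u - w) \<subseteq> (\<beta>(v := b)) u \<union> (\<alpha>(v := a)) w"
        using cut_funD(5-7)[OF c, of u w] q uw *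
        by (cases "u = v"; cases "w = v") (auto simp: cut_point_def Un_commute)
    qed
  qed
qed

text \<open>Disjointness and the upper bounds survive when \<open>a\<close> gets smaller, so only
  its two lower bounds have to be checked. This is the freedom by which closedness is
  enforced.\<close>

lemma cut_point_shrink_left:
  assumes "cut_point F \<alpha> \<beta> v a b" "y \<in> LL" "\<And>i. i \<in> F \<Longrightarrow> \<alpha> i \<subseteq> p (v - i) \<union> y"
    "\<And>i. i \<in> F \<Longrightarrow> p (i - v) \<subseteq> \<beta> i \<union> y"
  shows "cut_point F \<alpha> \<beta> v (a \<inter> y) b"
  unfolding cut_point_def
proof (intro conjI ballI)
  note * = assms(1)[unfolded cut_point_def]
  show "a \<inter> y \<in> LL" "b \<in> LL" using * assms(2) by simp_all
  show "a \<inter> y \<inter> b = {}" using * by blast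
  fix i assume i: "i \<in> F"
  note * = bspec[OF conjunct2[OF conjunct2[OF conjunct2[OF *]]] i] and ** = assms(3,4)[OF i]
  show "a \<inter> y \<subseteq> \<alpha> i \<union> p (i - v)" "b \<subseteq> \<beta> i \<union> p (v - i)" "\<alpha> i \<subseteq> p (v - i) \<union> a \<inter> y"
    "p (i - v) \<subseteq> \<beta> i \<union> a \<inter> y" "\<beta> i \<subseteq> p (i - v) \<union> b" "p (v - i) \<subseteq> \<alpha> i \<union> b"
    using * ** by blast+
qed

lemma cut_point_shrink_right:
  assumes "cut_point F \<alpha> \<beta> v a b" "y \<in> LL" "\<And>i. i \<in> F \<Longrightarrow> \<beta> i \<subseteq> p (i - v) \<union> y"
    "\<And>i. i \<in> F \<Longrightarrow> p (v - i) \<subseteq> \<alpha> i \<union> y"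
  shows "cut_point F \<alpha> \<beta> v a (b \<inter> y)"
  unfolding cut_point_def
proof (intro conjI ballI)
  note * = assms(1)[unfolded cut_point_def]
  show "a \<in> LL" "b \<inter> y \<in> LL" using * assms(2) by simp_all
  show "a \<inter> (b \<inter> y) = {}" using * by blast
  fix i assume i: "i \<in> F"
  note * = bspec[OF conjunct2[OF conjunct2[OF conjunct2[OF *]]] i] and ** = assms(3,4)[OF i]
  show "a \<subseteq> \<alpha> i \<union> p (i - v)" "b \<inter> y \<subseteq> \<beta> i \<union> p (v - i)" "\<alpha> i \<subseteq> p (v - i) \<union> a"
    "p (i - v) \<subseteq> \<beta> i \<union> a" "\<beta> i \<subseteq> p (i - v) \<union> b \<inter> y" "p (v - i) \<subseteq> \<alpha> i \<union> b \<inter> y"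
    using * ** by blast+
qed

lemma finite_Int_mem:
  assumes "finite F" "F \<noteq> {}" "\<And>i. i \<in> F \<Longrightarrow> f i \<in> LL"
  shows "(\<Inter>i\<in>F. f i) \<in> LL"
  using assms by (induction F rule: finite_ne_induct) auto

lemma subset_Un_Int_INT:
  "A \<subseteq> B \<union> s \<Longrightarrow> (\<And>j. j \<in> F \<Longrightarrow> A \<subseteq> B \<union> f j) \<Longrightarrow> A \<subseteq> B \<union> (s \<inter> (\<Inter>j\<in>F. f j))"
  by blast

text \<open>The value \<open>a\<close> at the new cut must contain \<open>g - D\<close> and \<open>b\<close> must contain \<open>e - G\<close> for
  the pairs \<open>(g, D) \<in> I\<close> and \<open>(e, G) \<in> J\<close> below. Neither \<open>g - D\<close> nor \<open>e - G\<close> belongs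
  to the ring of sets; that they can be separated pairwise is where complete normality enters.\<close>

lemma cut_point_exists:
  assumes c: "cut_fun F \<alpha> \<beta>" and F: "finite F" and v: "v \<in> V"
  shows "\<exists>a b. cut_point F \<alpha> \<beta> v a b"
proof (cases "F = {}")
  case True
  then show ?thesis by (intro exI[of _ "{}"]) (simp add: cut_point_def)
next
  case False
  \<comment> \<open>Each pair is a lower bound read off from \<open>cut_point\<close>.
    \<open>F\<close> is nonempty from here on, which keeps the intersections over \<open>F\<close>
    inside the ring.\<close>
  define I where "I = (\<lambda>i. (\<alpha> i, p (v - i))) ` F \<union> (\<lambda>i. (p (i - v), \<beta> i)) ` F"
  define J where "J = (\<lambda>i. (\<beta> i, p (i - v))) ` F \<union> (\<lambda>i. (p (v - i), \<alpha> i)) ` F"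
  have FV: "i \<in> V" if "i \<in> F" for i using cut_funD(1)[OF c] that by auto
  note mem = cut_funD(2,3)[OF c] p_mem V_closed FV v
  have tri: "p (i - j) \<subseteq> p (i - v) \<union> p (v - j)" if "i \<in> F" "j \<in> F" for i j
    using p_triangle[of i v j] that FV v by blast
  have tri': "p (v - j) \<subseteq> p (v - i) \<union> p (i - j)" "p (i - v) \<subseteq> p (i - j) \<union> p (j - v)"
    if "i \<in> F" "j \<in> F" for i j
    using p_triangle[of v i j] p_triangle[of i j v] that FV v by blast+
  note cd = cut_funD(5-7)[OF c]
  have "\<exists>s\<in>LL. \<exists>t\<in>LL. s \<inter> t = {} \<and> (\<forall>(g, D)\<in>I. g \<subseteq> D \<union> s) \<and> (\<forall>(e, G)\<in>J. e \<subseteq> G \<union> t)"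
  proof (rule finite_separation)
    show "finite I" "finite J" using F by (auto simp: I_def J_def)
    show "\<forall>(g, D)\<in>I. g \<in> LL" "\<forall>(e, G)\<in>J. e \<in> LL" using mem by (auto simp: I_def J_def)
    \<comment> \<open>In all four cases \<open>M\<close> and \<open>N\<close> are the values
      opposite to \<open>g\<close> and \<open>e\<close>: \<open>\<beta> i\<close> is opposite to
      \<open>\<alpha> i\<close>, and \<open>p (v - i)\<close> to \<open>p (i - v)\<close>. The
      covering hypotheses follow from triangle inequalities and the inclusions of the given
      cut.\<close>
    have 1: "\<exists>s\<in>LL. \<exists>t\<in>LL. s \<inter> t = {} \<and> \<alpha> i \<subseteq> p (v - i) \<union> s \<and> \<beta> j \<subseteq> p (j - v) \<union> t"
      if i: "i \<in> F" and j: "j \<in> F" for i j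
    proof (rule separation[where M = "\<beta> i" and N = "\<alpha> j"])
      show "\<alpha> i \<in> LL" "p (v - i) \<in> LL" "\<beta> j \<in> LL" "p (j - v) \<in> LL" "\<beta> i \<in> LL" "\<alpha> j \<in> LL"
        using i j mem by simp_all
      show "\<alpha> i \<subseteq> p (j - v) \<union> p (v - i) \<union> \<alpha> j" using cd(1)[OF i j] tri[OF j i] by blast
      show "\<beta> j \<subseteq> p (j - v) \<union> p (v - i) \<union> \<beta> i" using cd(2)[OF j i] tri[OF j i] by blast
      show "\<alpha> i \<inter> \<beta> i = {}" using cut_funD(4)[OF c i] by blast
      show "\<beta> j \<inter> \<alpha> j = {}" using cut_funD(4)[OF c j] by blast
    qed
    have 2: "\<exists>s\<in>LL. \<exists>t\<in>LL. s \<inter> t = {} \<and> \<alpha> i \<subseteq> p (v - i) \<union> s \<and> p (v - j) \<subseteq> \<alpha> j \<union> t"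
      if i: "i \<in> F" and j: "j \<in> F" for i j
    proof (rule separation[where M = "\<beta> i" and N = "p (j - v)"])
      show "\<alpha> i \<in> LL" "p (v - i) \<in> LL" "p (v - j) \<in> LL" "\<alpha> j \<in> LL" "\<beta> i \<in> LL" "p (j - v) \<in> LL"
        using i j mem by simp_all
      show "\<alpha> i \<subseteq> \<alpha> j \<union> p (v - i) \<union> p (j - v)" using cd(1)[OF i j] tri[OF j i] by blast
      show "p (v - j) \<subseteq> \<alpha> j \<union> p (v - i) \<union> \<beta> i" using cd(3)[OF i j] tri'(1)[OF i j] by blast
      show "\<alpha> i \<inter> \<beta> i = {}" using cut_funD(4)[OF c i] by blast
      show "p (v - j) \<inter> p (j - v) = {}" using p_diff_disjoint[OF v FV[OF j]] by blast
    qed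
    have 3: "\<exists>s\<in>LL. \<exists>t\<in>LL. s \<inter> t = {} \<and> p (i - v) \<subseteq> \<beta> i \<union> s \<and> \<beta> j \<subseteq> p (j - v) \<union> t"
      if i: "i \<in> F" and j: "j \<in> F" for i j
    proof (rule separation[where M = "p (v - i)" and N = "\<alpha> j"])
      show "p (i - v) \<in> LL" "\<beta> i \<in> LL" "\<beta> j \<in> LL" "p (j - v) \<in> LL" "p (v - i) \<in> LL" "\<alpha> j \<in> LL"
        using i j mem by simp_all
      show "p (i - v) \<subseteq> p (j - v) \<union> \<beta> i \<union> \<alpha> j" using tri'(2)[OF i j] cd(3)[OF i j] by blast
      show "\<beta> j \<subseteq> p (j - v) \<union> \<beta> i \<union> p (v - i)" using cd(2)[OF j i] tri[OF j i] by blast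
      show "p (i - v) \<inter> p (v - i) = {}" using p_diff_disjoint[OF v FV[OF i]] by blast
      show "\<beta> j \<inter> \<alpha> j = {}" using cut_funD(4)[OF c j] by blast
    qed
    have 4: "\<exists>s\<in>LL. \<exists>t\<in>LL. s \<inter> t = {} \<and> p (i - v) \<subseteq> \<beta> i \<union> s \<and> p (v - j) \<subseteq> \<alpha> j \<union> t"
      if i: "i \<in> F" and j: "j \<in> F" for i j
    proof (rule separation[where M = "p (v - i)" and N = "p (j - v)"])
      show "p (i - v) \<in> LL" "\<beta> i \<in> LL" "p (v - j) \<in> LL" "\<alpha> j \<in> LL" "p (v - i) \<in> LL" "p (j - v) \<in> LL"
        using i j mem by simp_all
      show "p (i - v) \<subseteq> \<alpha> j \<union> \<beta> i \<union> p (j - v)" using tri'(2)[OF i j] cd(3)[OF i j] by blast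
      show "p (v - j) \<subseteq> \<alpha> j \<union> \<beta> i \<union> p (v - i)" using cd(3)[OF i j] tri'(1)[OF i j] by blast
      show "p (i - v) \<inter> p (v - i) = {}" using p_diff_disjoint[OF v FV[OF i]] by blast
      show "p (v - j) \<inter> p (j - v) = {}" using p_diff_disjoint[OF v FV[OF j]] by blast
    qed
    show "\<forall>(g, D)\<in>I. \<forall>(e, G)\<in>J. \<exists>s\<in>LL. \<exists>t\<in>LL. s \<inter> t = {} \<and> g \<subseteq> D \<union> s \<and> e \<subseteq> G \<union> t"
      using 1 2 3 4 by (simp add: I_def J_def ball_Un)
  qed
  then obtain s t where st: "s \<in> LL" "t \<in> LL" "s \<inter> t = {}"
    "\<forall>(g, D)\<in>I. g \<subseteq> D \<union> s" "\<forall>(e, G)\<in>J. e \<subseteq> G \<union> t" by blast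
  have st': "\<alpha> i \<subseteq> p (v - i) \<union> s" "p (i - v) \<subseteq> \<beta> i \<union> s"
    "\<beta> i \<subseteq> p (i - v) \<union> t" "p (v - i) \<subseteq> \<alpha> i \<union> t" if "i \<in> F" for i
    using st(4,5) that by (simp_all add: I_def J_def ball_Un)
  \<comment> \<open>Intersecting with all upper bounds does not spoil the lower bounds: by the
    inclusions \<open>*\<close> below, each upper bound by itself satisfies every lower
    bound.\<close>
  define a where "a = s \<inter> (\<Inter>j\<in>F. \<alpha> j \<union> p (j - v))"
  define b where "b = t \<inter> (\<Inter>j\<in>F. \<beta> j \<union> p (v - j))"
  have "cut_point F \<alpha> \<beta> v a b"
    unfolding cut_point_def
  proof (intro conjI ballI)
    show "a \<in> LL" "b \<in> LL" unfolding a_def b_def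
      using F False mem st by (auto intro!: Int_mem finite_Int_mem)
    show "a \<inter> b = {}" using st(3) by (auto simp: a_def b_def)
    fix i assume i: "i \<in> F"
    show "a \<subseteq> \<alpha> i \<union> p (i - v)" "b \<subseteq> \<beta> i \<union> p (v - i)" using i by (auto simp: a_def b_def)
    have *: "\<alpha> i \<subseteq> p (v - i) \<union> (\<alpha> j \<union> p (j - v))" "p (i - v) \<subseteq> \<beta> i \<union> (\<alpha> j \<union> p (j - v))"
      "\<beta> i \<subseteq> p (i - v) \<union> (\<beta> j \<union> p (v - j))" "p (v - i) \<subseteq> \<alpha> i \<union> (\<beta> j \<union> p (v - j))"
      if j: "j \<in> F" for j
      subgoal using cd(1)[OF i j] tri[OF j i] by blast
      subgoal using cd(3)[OF i j] tri'(2)[OF i j] by blast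
      subgoal using cd(2)[OF i j] tri[OF i j] by blast
      subgoal using cd(3)[OF j i] tri'(1)[OF j i] by blast
      done
    show "\<alpha> i \<subseteq> p (v - i) \<union> a" "p (i - v) \<subseteq> \<beta> i \<union> a"
      "\<beta> i \<subseteq> p (i - v) \<union> b" "p (v - i) \<subseteq> \<alpha> i \<union> b"
      unfolding a_def b_def by (intro subset_Un_Int_INT st'[OF i] *; assumption)+
  qed
  then show ?thesis by blast
qed

end

section \<open>Cuts over a countable space\<close>

text \<open>The instances of closedness that an extension by \<open>e\<close> has to satisfy for the pairs
  \<open>(a, e - v)\<close> and \<open>(e - v, a)\<close>. The other signs of \<open>e\<close> are covered by passing from \<open>p\<close>
  to \<open>p (- v)\<close>, which interchanges \<open>\<alpha>\<close> and \<open>\<beta>\<close>.\<close>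

definition (in left_space) task :: "('v \<Rightarrow> 'x set) \<Rightarrow> 'v set \<Rightarrow> ('v \<Rightarrow> 'x set) \<Rightarrow> ('v \<Rightarrow> 'x set) \<Rightarrow> 'v \<times> 'v \<times> 'x set \<Rightarrow> bool" where
  "task q F \<alpha> \<beta> = (\<lambda>(a, v, x). v \<in> F
     \<and> (q a \<subseteq> \<alpha> v \<union> x \<longrightarrow> (\<exists>n>0. v + inverse n *v a \<in> F \<and> q a \<inter> \<beta> (v + inverse n *v a) \<subseteq> x))
     \<and> (\<alpha> v \<subseteq> q a \<union> x \<longrightarrow> (\<exists>n>0. v + n *v a \<in> F \<and> \<alpha> v \<inter> \<alpha> (v + n *v a) \<subseteq> x)))"

section \<open>Closedness of a finite cut, one requirement at a time\<close>

context valued_space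
begin

text \<open>By \<open>closed_mono\<close> every larger multiple works too, so a maximum serves
  finitely many requirements at once.\<close>

lemma uniform_closed:
  assumes cl: closed_val and F: "finite F"
    and *: "\<And>i. i \<in> F \<Longrightarrow> a i \<in> V \<and> b i \<in> V \<and> x i \<in> LL \<and> p (a i) \<subseteq> p (b i) \<union> x i"
  shows "\<exists>n>0. \<forall>i\<in>F. p (a i) \<inter> p (a i - n *v b i) \<subseteq> x i"
  using F *
proof (induction F)
  case empty
  show ?case using division_ring_zero_less_one[where 'k='k] by blast
next
  case (insert i F)
  obtain n where n: "n > 0" "\<forall>i\<in>F. p (a i) \<inter> p (a i - n *v b i) \<subseteq> x i" using insert by blast
  obtain m where m: "m > 0" "p (a i) \<inter> p (a i - m *v b i) \<subseteq> x i"
    using cl insert.prems[of i] unfolding closed_val_def by blast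
  have mn: "m \<le> max m n" "n \<le> max m n" by simp_all
  have "p (a j) \<inter> p (a j - max m n *v b j) \<subseteq> x j" if "j \<in> insert i F" for j
  proof (cases "j = i")
    case True
    then show ?thesis using closed_mono[OF _ _ m(1) mn(1) m(2)] insert.prems[of i] by simp
  next
    case False
    then show ?thesis using closed_mono[OF _ _ n(1) mn(2), of "a j" "b j" "x j"] n(2) insert.prems[OF that] that by simp
  qed
  then show ?case using m(1) by (intro exI[of _ "max m n"]) (simp add: less_max_iff_disj)
qed

text \<open>The point \<open>v = u + inverse n *v a\<close> satisfies
  \<open>n *v (v - e) = a - n *v (e - u)\<close>, so \<open>\<beta> v\<close> decides closedness for
  \<open>a\<close> and \<open>e - u\<close>. Cutting it down to \<open>x \<union> \<beta> u\<close>
  suffices, as \<open>p a\<close> meets \<open>\<beta> u\<close> only inside \<open>x\<close>. The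
  lower bounds imposed by the finitely many \<open>i\<close> permit this once \<open>n\<close> is
  large: closedness of \<open>p\<close> is applied to \<open>a\<close> and \<open>i - u\<close>,
  with \<open>\<alpha> i \<union> x\<close> in place of \<open>x\<close>.\<close>

lemma cut_point_closed_base:
  assumes cl: closed_val and c: "cut_fun F \<alpha> \<beta>" and F: "finite F"
    and a: "a \<in> V" and u: "u \<in> F" and x: "x \<in> LL" and le: "p a \<subseteq> \<alpha> u \<union> x"
  shows "\<exists>n>0. \<exists>A B. cut_point F \<alpha> \<beta> (u + inverse n *v a) A B \<and> p a \<inter> B \<subseteq> x"
proof -
  note cd = cut_funD[OF c]
  have FV: "i \<in> V" if "i \<in> F" for i using cd(1) that by auto
  have pa: "p a \<subseteq> p (i - u) \<union> (\<alpha> i \<union> x)" if "i \<in> F" for i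
    using le cd(5)[OF u that] by blast
  obtain m where m: "m > 0" "\<And>i. i \<in> F \<Longrightarrow> p a \<inter> p (a - m *v (i - u)) \<subseteq> \<alpha> i \<union> x"
    using uniform_closed[OF cl F, of "\<lambda>_. a" "\<lambda>i. i - u" "\<lambda>i. \<alpha> i \<union> x"] pa a FV u x cd(2) by auto
  \<comment> \<open>the multiple \<open>m\<close> gives non-strict inequalities only, \<open>m + 1\<close> makes them strict\<close>
  define n where "n = m + 1"
  have n: "n > 0" "m \<le> n" using m(1) division_ring_zero_less_one[where 'k='k]
    by (simp_all add: n_def add_pos_pos less_imp_le)
  define v where "v = u + inverse n *v a"
  have v: "v \<in> V" using a FV[OF u] by (simp add: v_def)
  have vu: "p (v - u) = p a"
    using p_scale[OF a division_ring_inverse_pos[OF n(1)]] by (simp add: v_def)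
  have nv: "n *v (v - i) = a - n *v (i - u)" for i
    using n(1) by (simp add: v_def scale_diff scale_add scale_inverse)
  have K2: "p a \<inter> p (v - i) \<subseteq> \<alpha> i \<union> x" if i: "i \<in> F" for i
    using closed_mono[OF a _ m(1) n(2) m(2)[OF i]] p_scale[of "v - i" n] n(1) v FV[OF i] FV[OF u] nv[of i] by simp
  have K1: "\<beta> i \<inter> p a \<subseteq> p (i - v) \<union> x" if i: "i \<in> F" for i
  proof -
    have "n *v (i - v) = - (n *v (v - i))" using scale_minus[of n "v - i"] by simp
    also have "\<dots> = (n *v (i - u)) - a" by (simp add: nv)
    finally have 1: "p (i - v) = p (n *v (i - u) - a)"
      using p_scale[of "i - v" n] n(1) v FV[OF i] by simp
    have "(n *v (i - u) - a) + (a - m *v (i - u)) = i - u"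
      by (simp add: n_def add_scale scale_one)
    then have "p (i - u) \<subseteq> p (i - v) \<union> p (a - m *v (i - u))"
      using p_add[of "n *v (i - u) - a" "a - m *v (i - u)"] FV[OF i] FV[OF u] a 1 by simp
    then show ?thesis using m(2)[OF i] pa[OF i] cd(4)[OF i] by blast
  qed
  obtain A B where AB: "cut_point F \<alpha> \<beta> v A B" using cut_point_exists[OF c F v] by blast
  have "cut_point F \<alpha> \<beta> v A (B \<inter> (x \<union> \<beta> u))"
  proof (rule cut_point_shrink_right[OF AB])
    show "x \<union> \<beta> u \<in> LL" using x cd(3)[OF u] by simp
    fix i assume i: "i \<in> F"
    have "p (i - u) \<subseteq> p (i - v) \<union> p (v - u)" "p (v - i) \<subseteq> p (v - u) \<union> p (u - i)"
      using p_triangle FV[OF i] FV[OF u] v by auto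
    then show "\<beta> i \<subseteq> p (i - v) \<union> (x \<union> \<beta> u)" "p (v - i) \<subseteq> \<alpha> i \<union> (x \<union> \<beta> u)"
      using K1[OF i] K2[OF i] cd(6)[OF i u] cd(7)[OF u i] unfolding vu by blast+
  qed
  moreover have "p a \<inter> (B \<inter> (x \<union> \<beta> u)) \<subseteq> x" using le cd(4)[OF u] by blast
  ultimately show ?thesis using n(1) unfolding v_def by blast
qed

text \<open>The value at stake is now \<open>\<alpha>\<close> at \<open>u + n *v b\<close>, the
  future value of \<open>e - u - n *v b\<close>. It is cut down to
  \<open>x \<union> p (- b)\<close>, because \<open>\<alpha> u\<close> meets \<open>p (- b)\<close>
  only inside \<open>x\<close>. Closedness of \<open>p\<close> is applied to \<open>i - u\<close>
  and \<open>b\<close>, with \<open>\<beta> i \<union> x\<close> in place of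
  \<open>x\<close>.\<close>

lemma cut_point_closed_cut:
  assumes cl: closed_val and c: "cut_fun F \<alpha> \<beta>" and F: "finite F"
    and b: "b \<in> V" and u: "u \<in> F" and x: "x \<in> LL" and le: "\<alpha> u \<subseteq> p b \<union> x"
  shows "\<exists>n>0. \<exists>A B. cut_point F \<alpha> \<beta> (u + n *v b) A B \<and> \<alpha> u \<inter> A \<subseteq> x"
proof -
  note cd = cut_funD[OF c]
  have FV: "i \<in> V" if "i \<in> F" for i using cd(1) that by auto
  have pu: "p (i - u) \<subseteq> p b \<union> (\<beta> i \<union> x)" if "i \<in> F" for i
    using le cd(7)[OF that u] by blast
  obtain m where m: "m > 0" "\<And>i. i \<in> F \<Longrightarrow> p (i - u) \<inter> p ((i - u) - m *v b) \<subseteq> \<beta> i \<union> x"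
    using uniform_closed[OF cl F, of "\<lambda>i. i - u" "\<lambda>_. b" "\<lambda>i. \<beta> i \<union> x"] pu b FV u x cd(3) by auto
  \<comment> \<open>The surplus over \<open>m\<close> makes
    \<open>(v - i) + ((i - u) - m *v b)\<close> equal to \<open>b\<close>, on which inclusion
    \<open>4\<close> below rests.\<close>
  define n where "n = m + 1"
  have n: "n > 0" "m \<le> n" using m(1) division_ring_zero_less_one[where 'k='k]
    by (simp_all add: n_def add_pos_pos less_imp_le)
  define v where "v = u + n *v b"
  have v: "v \<in> V" using b FV[OF u] by (simp add: v_def)
  have pn: "p (n *v b) = p b" "p (- (n *v b)) = p (- b)"
    using p_scale[of b n] p_scale[of "- b" n] b n(1) by (simp_all add: scale_minus)
  obtain A B where AB: "cut_point F \<alpha> \<beta> v A B" using cut_point_exists[OF c F v] by blast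
  have "cut_point F \<alpha> \<beta> v (A \<inter> (x \<union> p (- b))) B"
  proof (rule cut_point_shrink_left[OF AB])
    show "x \<union> p (- b) \<in> LL" using x b by simp
    fix i assume i: "i \<in> F"
    have iv: "i - v = (i - u) - n *v b" "v - i = n *v b - (i - u)" by (simp_all add: v_def)
    have V: "i - u \<in> V" "n *v b \<in> V" "m *v b \<in> V" using b FV[OF i] FV[OF u] by simp_all
    have 1: "p (i - u) \<inter> p (i - v) \<subseteq> \<beta> i \<union> x"
      using closed_mono[OF _ b m(1) n(2) m(2)[OF i]] V(1) unfolding iv by simp
    have 2: "p (i - v) \<subseteq> p (i - u) \<union> p (- b)"
      using p_add[of "i - u" "- (n *v b)"] V pn unfolding iv by simp
    show "p (i - v) \<subseteq> \<beta> i \<union> (x \<union> p (- b))" using 1 2 by blast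
    have *: "(v - i) + - (n *v b) = u - i" by (simp add: iv)
    have 3: "p (u - i) \<subseteq> p (v - i) \<union> p (- b)"
      using p_add[of "v - i" "- (n *v b)"] V pn v FV[OF i] unfolding * by simp
    have "(v - i) + ((i - u) - m *v b) = b" by (simp add: iv n_def add_scale scale_one)
    then have 4: "p b \<subseteq> p (v - i) \<union> p ((i - u) - m *v b)"
      using p_add[of "v - i" "(i - u) - m *v b"] V v FV[OF i] by simp
    have 5: "p b \<subseteq> p (v - i) \<union> p (i - u)"
      using p_add[of "v - i" "i - u"] V v FV[OF i] pn by (simp add: iv)
    show "\<alpha> i \<subseteq> p (v - i) \<union> (x \<union> p (- b))"
      using cd(5)[OF i u] le m(2)[OF i] cd(4)[OF i] 3 4 5 by blast
  qed
  moreover have "\<alpha> u \<inter> (A \<inter> (x \<union> p (- b))) \<subseteq> x" using le p_disjoint[OF b] by blast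
  ultimately show ?thesis using n(1) unfolding v_def by blast
qed

section \<open>Total cuts as unions of finite ones\<close>

definition cut_ext :: "'v set \<times> ('v \<Rightarrow> 'x set) \<times> ('v \<Rightarrow> 'x set) \<Rightarrow> 'v set \<times> ('v \<Rightarrow> 'x set) \<times> ('v \<Rightarrow> 'x set) \<Rightarrow> bool" where
  "cut_ext = (\<lambda>(F, \<alpha>, \<beta>) (F', \<alpha>', \<beta>'). F \<subseteq> F' \<and> (\<forall>u\<in>F. \<alpha>' u = \<alpha> u \<and> \<beta>' u = \<beta> u))"

definition cut_state :: "'v set \<times> ('v \<Rightarrow> 'x set) \<times> ('v \<Rightarrow> 'x set) \<Rightarrow> bool" where
  "cut_state = (\<lambda>(F, \<alpha>, \<beta>). finite F \<and> cut_fun F \<alpha> \<beta>)"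

lemma cut_ext_refl: "cut_ext s s"
  by (auto simp: cut_ext_def split: prod.split)

lemma cut_ext_trans: "cut_ext s t \<Longrightarrow> cut_ext t u \<Longrightarrow> cut_ext s u"
  unfolding cut_ext_def by (cases s; cases t; cases u) auto

text \<open>A task asks only for points of \<open>F\<close> and for values at them, so what is
  achieved at a finite stage is never lost.\<close>

lemma task_mono:
  assumes "cut_ext (F, \<alpha>, \<beta>) (F', \<alpha>', \<beta>')" and "task q F \<alpha> \<beta> z" shows "task q F' \<alpha>' \<beta>' z"
proof -
  obtain a v x where z: "z = (a, v, x)" by (cases z) auto
  have *: "F \<subseteq> F'" "\<And>u. u \<in> F \<Longrightarrow> \<alpha>' u = \<alpha> u \<and> \<beta>' u = \<beta> u" using assms(1) by (auto simp: cut_ext_def)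
  note t = assms(2)[unfolded z task_def prod.case]
  have v: "v \<in> F" "\<alpha>' v = \<alpha> v" using t *(2) by simp_all
  show ?thesis
    unfolding z task_def prod.case v(2)
  proof (intro conjI impI)
    show "v \<in> F'" using v(1) *(1) by auto
    assume "q a \<subseteq> \<alpha> v \<union> x"
    then obtain n where "n > 0" "v + inverse n *v a \<in> F" "q a \<inter> \<beta> (v + inverse n *v a) \<subseteq> x" using t by blast
    then show "\<exists>n>0. v + inverse n *v a \<in> F' \<and> q a \<inter> \<beta>' (v + inverse n *v a) \<subseteq> x"
      using * by (intro exI[of _ n]) auto
  next
    assume "\<alpha> v \<subseteq> q a \<union> x"
    then obtain n where "n > 0" "v + n *v a \<in> F" "\<alpha> v \<inter> \<alpha> (v + n *v a) \<subseteq> x" using t by blast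
    then show "\<exists>n>0. v + n *v a \<in> F' \<and> \<alpha> v \<inter> \<alpha>' (v + n *v a) \<subseteq> x"
      using * by (intro exI[of _ n]) auto
  qed
qed

lemma cut_state_insert:
  assumes "cut_state (F, \<alpha>, \<beta>)" "cut_point F \<alpha> \<beta> v a b" "v \<in> V"
  shows "cut_state (insert v F, \<alpha>(v := a), \<beta>(v := b))"
    "cut_ext (F, \<alpha>, \<beta>) (insert v F, \<alpha>(v := a), \<beta>(v := b))"
  using assms cut_fun_insert[of F \<alpha> \<beta> v a b] cut_point_same[of F \<alpha> \<beta> v a b]
  by (auto simp: cut_state_def cut_ext_def)

lemma cut_state_mem:
  assumes s: "cut_state (F, \<alpha>, \<beta>)" and v: "v \<in> V"
  shows "\<exists>F' \<alpha>' \<beta>'. cut_state (F', \<alpha>', \<beta>') \<and> cut_ext (F, \<alpha>, \<beta>) (F', \<alpha>', \<beta>') \<and> v \<in> F'"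
proof -
  obtain a b where q: "cut_point F \<alpha> \<beta> v a b"
    using cut_point_exists[OF _ _ v, of F \<alpha> \<beta>] s unfolding cut_state_def prod.case by blast
  show ?thesis using cut_state_insert[OF s q v] by blast
qed

lemma cut_state_task:
  assumes cl: closed_val and s: "cut_state (F, \<alpha>, \<beta>)" and z: "z \<in> V \<times> V \<times> LL"
  shows "\<exists>F' \<alpha>' \<beta>'. cut_state (F', \<alpha>', \<beta>') \<and> cut_ext (F, \<alpha>, \<beta>) (F', \<alpha>', \<beta>') \<and> task p F' \<alpha>' \<beta>' z"
proof -
  obtain a v x where z: "z = (a, v, x)" "a \<in> V" "v \<in> V" "x \<in> LL" using z by auto
  obtain F1 \<alpha>1 \<beta>1 where 1: "cut_state (F1, \<alpha>1, \<beta>1)" "cut_ext (F, \<alpha>, \<beta>) (F1, \<alpha>1, \<beta>1)" "v \<in> F1"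
    using cut_state_mem[OF s z(3)] by blast
  have c1: "cut_fun F1 \<alpha>1 \<beta>1" "finite F1" using 1(1) by (auto simp: cut_state_def)
  obtain F2 \<alpha>2 \<beta>2 where 2: "cut_state (F2, \<alpha>2, \<beta>2)" "cut_ext (F1, \<alpha>1, \<beta>1) (F2, \<alpha>2, \<beta>2)"
    "p a \<subseteq> \<alpha>1 v \<union> x \<longrightarrow> (\<exists>n>0. v + inverse n *v a \<in> F2 \<and> p a \<inter> \<beta>2 (v + inverse n *v a) \<subseteq> x)"
  proof (cases "p a \<subseteq> \<alpha>1 v \<union> x")
    case True
    then obtain n A B where n: "n > 0" "cut_point F1 \<alpha>1 \<beta>1 (v + inverse n *v a) A B" "p a \<inter> B \<subseteq> x"
      using cut_point_closed_base[OF cl c1 z(2) 1(3) z(4)] by blast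
    show ?thesis
      by (rule that[OF cut_state_insert[OF 1(1) n(2)]]) (use n z in auto)
  qed (use that 1 cut_ext_refl in blast)
  have v2: "v \<in> F2" "\<alpha>2 v = \<alpha>1 v" using 2(2) 1(3) by (auto simp: cut_ext_def)
  have c2: "cut_fun F2 \<alpha>2 \<beta>2" "finite F2" using 2(1) by (auto simp: cut_state_def)
  obtain F3 \<alpha>3 \<beta>3 where 3: "cut_state (F3, \<alpha>3, \<beta>3)" "cut_ext (F2, \<alpha>2, \<beta>2) (F3, \<alpha>3, \<beta>3)"
    "\<alpha>2 v \<subseteq> p a \<union> x \<longrightarrow> (\<exists>n>0. v + n *v a \<in> F3 \<and> \<alpha>2 v \<inter> \<alpha>3 (v + n *v a) \<subseteq> x)"
  proof (cases "\<alpha>2 v \<subseteq> p a \<union> x")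
    case True
    then obtain n A B where n: "n > 0" "cut_point F2 \<alpha>2 \<beta>2 (v + n *v a) A B" "\<alpha>2 v \<inter> A \<subseteq> x"
      using cut_point_closed_cut[OF cl c2 z(2) v2(1) z(4)] by blast
    show ?thesis
      by (rule that[OF cut_state_insert[OF 2(1) n(2)]]) (use n z in auto)
  qed (use that 2 cut_ext_refl in blast)
  have e23: "\<And>u. u \<in> F2 \<Longrightarrow> u \<in> F3 \<and> \<alpha>3 u = \<alpha>2 u \<and> \<beta>3 u = \<beta>2 u" using 3(2) by (auto simp: cut_ext_def)
  have "task p F3 \<alpha>3 \<beta>3 z"
    unfolding z(1) task_def prod.case
  proof (intro conjI impI)
    show "v \<in> F3" using e23[OF v2(1)] by simp
    assume "p a \<subseteq> \<alpha>3 v \<union> x"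
    then obtain n where "n > 0" "v + inverse n *v a \<in> F2" "p a \<inter> \<beta>2 (v + inverse n *v a) \<subseteq> x"
      using 2(3) e23[OF v2(1)] v2(2) by auto
    then show "\<exists>n>0. v + inverse n *v a \<in> F3 \<and> p a \<inter> \<beta>3 (v + inverse n *v a) \<subseteq> x"
      using e23 by (intro exI[of _ n]) auto
  next
    assume "\<alpha>3 v \<subseteq> p a \<union> x"
    then show "\<exists>n>0. v + n *v a \<in> F3 \<and> \<alpha>3 v \<inter> \<alpha>3 (v + n *v a) \<subseteq> x"
      using 3(3) e23[OF v2(1)] by auto
  qed
  then show ?thesis using 3(1) cut_ext_trans[OF cut_ext_trans[OF 1(2) 2(2)] 3(2)] by blast
qed

lemma opposite_closed: "closed_val \<Longrightarrow> valued_space.closed_val scale LL V (\<lambda>v. p (- v))"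
proof -
  interpret op: valued_space scale LL V "\<lambda>v. p (- v)" by (rule opposite)
  assume cl: closed_val
  show op.closed_val
    unfolding op.closed_val_def
  proof (intro ballI impI)
    fix a b x assume "a \<in> V" "b \<in> V" "x \<in> LL" "p (- a) \<subseteq> p (- b) \<union> x"
    then obtain n where "n > 0" "p (- a) \<inter> p (- a - n *v (- b)) \<subseteq> x"
      using cl unfolding closed_val_def by (meson V_closed(4))
    then show "\<exists>n>0. p (- a) \<inter> p (- (a - n *v b)) \<subseteq> x"
      by (intro exI[of _ n]) (simp add: scale_minus algebra_simps)
  qed
qed

lemma opposite_cut_fun: "valued_space.cut_fun LL V (\<lambda>v. p (- v)) F \<beta> \<alpha> \<longleftrightarrow> cut_fun F \<alpha> \<beta>"
proof -
  interpret op: valued_space scale LL V "\<lambda>v. p (- v)" by (rule opposite)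
  show ?thesis unfolding op.cut_fun_def cut_fun_def minus_diff_eq
    by (simp add: Un_commute Int_commute) blast
qed

text \<open>The tasks for \<open>p (- v)\<close> are performed by running
  \<open>cut_state_task\<close> on the opposite space with \<open>\<alpha>\<close> and
  \<open>\<beta>\<close> interchanged; the one done before persists.\<close>

lemma cut_state_tasks:
  assumes cl: closed_val and s: "cut_state s" and z: "z \<in> V \<times> V \<times> LL"
  shows "\<exists>t. cut_state t \<and> cut_ext s t
    \<and> (case t of (F, \<alpha>, \<beta>) \<Rightarrow> task p F \<alpha> \<beta> z \<and> task (\<lambda>v. p (- v)) F \<beta> \<alpha> z)"
proof -
  interpret op: valued_space scale LL V "\<lambda>v. p (- v)" by (rule opposite)
  obtain F \<alpha> \<beta> where sF: "s = (F, \<alpha>, \<beta>)" by (cases s) auto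
  obtain F1 \<alpha>1 \<beta>1 where 1: "cut_state (F1, \<alpha>1, \<beta>1)" "cut_ext (F, \<alpha>, \<beta>) (F1, \<alpha>1, \<beta>1)" "task p F1 \<alpha>1 \<beta>1 z"
    using cut_state_task[OF cl _ z] s unfolding sF by blast
  have "op.cut_state (F1, \<beta>1, \<alpha>1)"
    using 1(1) by (simp add: op.cut_state_def cut_state_def opposite_cut_fun)
  then obtain F2 \<beta>2 \<alpha>2 where 2: "op.cut_state (F2, \<beta>2, \<alpha>2)" "op.cut_ext (F1, \<beta>1, \<alpha>1) (F2, \<beta>2, \<alpha>2)"
    "task (\<lambda>v. p (- v)) F2 \<beta>2 \<alpha>2 z"
    using op.cut_state_task[OF opposite_closed[OF cl] _ z] by blast
  have "cut_state (F2, \<alpha>2, \<beta>2)"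
    using 2(1) by (simp add: op.cut_state_def cut_state_def opposite_cut_fun)
  moreover have e: "cut_ext (F1, \<alpha>1, \<beta>1) (F2, \<alpha>2, \<beta>2)"
    using 2(2) by (auto simp: op.cut_ext_def cut_ext_def)
  ultimately show ?thesis
    using 2(3) task_mono[OF e 1(3)] cut_ext_trans[OF 1(2) e] unfolding sF by (intro exI[of _ "(F2, \<alpha>2, \<beta>2)"]) simp
qed

text \<open>The conditions on a cut involve two points at a time, and a task once performed
  persists. So both pass to the union of an increasing sequence of finite cuts whose step
  \<open>n\<close> performs the \<open>n\<close>-th task of an enumeration.\<close>

theorem cut_fun_total:
  assumes cl: closed_val and V: "countable V" and LL: "countable LL"
    and c: "cut_fun F0 \<alpha>0 \<beta>0" and F0: "finite F0"
  shows "\<exists>\<alpha> \<beta>. cut_fun V \<alpha> \<beta> \<and> (\<forall>u\<in>F0. \<alpha> u = \<alpha>0 u \<and> \<beta> u = \<beta>0 u)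
    \<and> (\<forall>z\<in>V \<times> V \<times> LL. task p V \<alpha> \<beta> z \<and> task (\<lambda>v. p (- v)) V \<beta> \<alpha> z)"
proof -
  define Z where "Z = V \<times> V \<times> LL"
  have Z: "countable Z" "Z \<noteq> {}"
    using V LL V_closed(1) empty_mem unfolding Z_def by (blast intro: countable_SIGMA)+
  define z where "z = from_nat_into Z"
  have zs: "\<exists>n. z n = y" if "y \<in> Z" for y
    unfolding z_def by (rule from_nat_into_surj[OF Z(1) that])
  have zZ: "z n \<in> V \<times> V \<times> LL" for n using from_nat_into[OF Z(2)] by (simp add: z_def Z_def)
  define ok where "ok n t \<longleftrightarrow> (case t of (F, \<alpha>, \<beta>) \<Rightarrow> task p F \<alpha> \<beta> (z n) \<and> task (\<lambda>v. p (- v)) F \<beta> \<alpha> (z n))" for n t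
  have "\<exists>f. \<forall>n. (cut_state (f n) \<and> cut_ext (F0, \<alpha>0, \<beta>0) (f n)) \<and> cut_ext (f n) (f (Suc n)) \<and> ok n (f (Suc n))"
  proof (rule dependent_nat_choice)
    show "\<exists>t. cut_state t \<and> cut_ext (F0, \<alpha>0, \<beta>0) t"
      using c F0 cut_ext_refl by (intro exI[of _ "(F0, \<alpha>0, \<beta>0)"]) (simp add: cut_state_def)
    fix s n assume "cut_state s \<and> cut_ext (F0, \<alpha>0, \<beta>0) s"
    then show "\<exists>t. (cut_state t \<and> cut_ext (F0, \<alpha>0, \<beta>0) t) \<and> cut_ext s t \<and> ok n t"
      using cut_state_tasks[OF cl _ zZ[of n], of s] cut_ext_trans unfolding ok_def by blast
  qed
  then obtain f where f: "\<And>n. cut_state (f n)" "\<And>n. cut_ext (F0, \<alpha>0, \<beta>0) (f n)"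
    "\<And>n. cut_ext (f n) (f (Suc n))" "\<And>n. ok n (f (Suc n))" by blast
  define F where "F n = fst (f n)" for n
  define A where "A n = fst (snd (f n))" for n
  define B where "B n = snd (snd (f n))" for n
  have fn: "f n = (F n, A n, B n)" for n by (simp add: F_def A_def B_def)
  have mono: "cut_ext (f m) (f n)" if "m \<le> n" for m n
    using that by (induction rule: dec_induct) (use cut_ext_refl cut_ext_trans f(3) in blast)+
  have ex: "\<exists>n. v \<in> F n" if "v \<in> V" for v
  proof -
    \<comment> \<open>A task puts its middle component into the domain, so no separate bookkeeping
      is needed to exhaust \<open>V\<close>.\<close>
    have "(v, v, {}) \<in> Z" using that by (simp add: Z_def)
    then obtain n where n: "z n = (v, v, {})" using zs by blast
    then have "v \<in> F (Suc n)" using f(4)[of n] by (simp add: ok_def fn task_def)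
    then show ?thesis by blast
  qed
  define N where "N v = (LEAST n. v \<in> F n)" for v
  define \<alpha> where "\<alpha> v = A (N v) v" for v
  define \<beta> where "\<beta> v = B (N v) v" for v
  have val: "\<alpha> v = A n v \<and> \<beta> v = B n v" if "v \<in> F n" for v n
  proof -
    have "N v \<le> n" "v \<in> F (N v)" unfolding N_def using that by (auto intro: Least_le LeastI)
    then show ?thesis using mono[of "N v" n] by (simp add: cut_ext_def fn \<alpha>_def \<beta>_def)
  qed
  have FV: "F n \<subseteq> V" for n using f(1)[of n] by (simp add: fn cut_state_def cut_fun_def)
  have toV: "cut_ext (F n, A n, B n) (V, \<alpha>, \<beta>)" "cut_ext (F n, B n, A n) (V, \<beta>, \<alpha>)" for n
    using FV val by (auto simp: cut_ext_def)
  have "task p V \<alpha> \<beta> y \<and> task (\<lambda>v. p (- v)) V \<beta> \<alpha> y" if y: "y \<in> Z" for y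
  proof -
    obtain n where n: "z n = y" using zs[OF y] by blast
    show ?thesis
      using f(4)[of n] task_mono[OF toV(1)] task_mono[OF toV(2)] unfolding ok_def fn n by blast
  qed
  moreover have "\<forall>u\<in>F0. \<alpha> u = \<alpha>0 u \<and> \<beta> u = \<beta>0 u"
    using f(2)[of 0] val[of _ 0] by (auto simp: cut_ext_def fn)
  moreover have "cut_fun V \<alpha> \<beta>"
  proof -
    have 1: "\<exists>n. u \<in> F n \<and> v \<in> F n" if uv: "u \<in> V" "v \<in> V" for u v
    proof -
      obtain i j where "u \<in> F i" "v \<in> F j" using ex uv by blast
      then have "u \<in> F (max i j) \<and> v \<in> F (max i j)"
        using mono[of i "max i j"] mono[of j "max i j"] by (auto simp: cut_ext_def fn)
      then show ?thesis by blast
    qed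
    have 2: "cut_fun (F n) \<alpha> \<beta>" for n
      using f(1)[of n] val[of _ n] by (simp add: fn cut_state_def cut_fun_def)
    show ?thesis
      unfolding cut_fun_def
    proof (intro conjI ballI)
      fix u assume u: "u \<in> V"
      then obtain n where n: "u \<in> F n" using ex by blast
      show "\<alpha> u \<in> LL" "\<beta> u \<in> LL" "\<alpha> u \<inter> \<beta> u = {}" using cut_funD(2-4)[OF 2 n] .
      fix v assume "v \<in> V"
      then obtain n where n: "u \<in> F n" "v \<in> F n" using 1 u by blast
      show "\<alpha> u \<subseteq> \<alpha> v \<union> p (v - u)" "\<beta> u \<subseteq> p (u - v) \<union> \<beta> v" "p (u - v) \<subseteq> \<beta> u \<union> \<alpha> v"
        using cut_funD(5-7)[OF 2 n] .
    qed simp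
  qed
  ultimately show ?thesis unfolding Z_def by blast
qed

end

section \<open>Extension by new vectors\<close>

definition (in left_space) closed_at :: "('v \<Rightarrow> 'x set) \<Rightarrow> 'v \<Rightarrow> 'v \<Rightarrow> 'x set \<Rightarrow> bool" where
  "closed_at q a b x \<longleftrightarrow> (q a \<subseteq> q b \<union> x \<longrightarrow> (\<exists>n>0. q a \<inter> q (a - n *v b) \<subseteq> x))"

definition (in left_space) adjoin :: "'v set \<Rightarrow> 'v \<Rightarrow> 'v set" where
  "adjoin V e = {v + c *v e | v c. v \<in> V}"

lemma (in left_space) adjoinI: "z = v + c *v e \<Longrightarrow> v \<in> V \<Longrightarrow> z \<in> adjoin V e"
  by (auto simp: adjoin_def)

lemma (in valued_space) closed_val_iff: "closed_val \<longleftrightarrow> (\<forall>a\<in>V. \<forall>b\<in>V. \<forall>x\<in>LL. closed_at p a b x)"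
  by (simp add: closed_val_def closed_at_def)

text \<open>The new multiple is \<open>c * n * inverse d\<close>, in this order, so that
  \<open>c\<close> can be factored out on the left. It reduces closedness of an extension to vectors
  in which \<open>e\<close> has coefficient \<open>0\<close>, \<open>1\<close> or
  \<open>- 1\<close>.\<close>

lemma (in valued_space) closed_at_scale:
  assumes "closed_at p a b x" "a \<in> V" "b \<in> V" "0 < c" "0 < d"
  shows "closed_at p (c *v a) (d *v b) x"
  unfolding closed_at_def
proof
  assume "p (c *v a) \<subseteq> p (d *v b) \<union> x"
  then obtain n where n: "n > 0" "p a \<inter> p (a - n *v b) \<subseteq> x"
    using assms by (auto simp: closed_at_def p_scale)
  have "c *v a - (c * n * inverse d) *v d *v b = c *v (a - n *v b)"
    using assms by (simp add: scale_scale mult.assoc scale_diff)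
  moreover have "0 < c * n * inverse d"
    using n assms by (intro mult_pos_pos division_ring_inverse_pos)
  ultimately show "\<exists>n>0. p (c *v a) \<inter> p (c *v a - n *v d *v b) \<subseteq> x"
    using n assms by (intro exI[of _ "c * n * inverse d"]) (simp add: p_scale)
qed

text \<open>\<open>Q\<close> is a parameter, not a definition, so that
  \<open>\<lambda>z. Q (- z)\<close> is again an instance with \<open>\<alpha>\<close> and
  \<open>\<beta>\<close> interchanged. This halves the case distinctions below.\<close>

locale cut_extension = valued_space scale LL V p
  for scale :: "'k::{division_ring, linordered_ring_strict} \<Rightarrow> 'v::ab_group_add \<Rightarrow> 'v" (infixr \<open>*v\<close> 75)
    and LL :: "'x set set" and V p +
  fixes e :: 'v and \<alpha> \<beta> Q :: "'v \<Rightarrow> 'x set"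
  assumes cut: "cut_fun V \<alpha> \<beta>"
    and Q_base: "v \<in> V \<Longrightarrow> Q v = p v"
    and Q_pos: "u \<in> V \<Longrightarrow> 0 < c \<Longrightarrow> Q (c *v (e - u)) = \<alpha> u"
    and Q_neg: "u \<in> V \<Longrightarrow> 0 < c \<Longrightarrow> Q (c *v (u - e)) = \<beta> u"
begin

lemma Q_pos_one: "u \<in> V \<Longrightarrow> Q (e - u) = \<alpha> u" and Q_neg_one: "u \<in> V \<Longrightarrow> Q (u - e) = \<beta> u"
  using Q_pos[of u 1] Q_neg[of u 1] division_ring_zero_less_one[where 'k='k] by (simp_all add: scale_one)

lemma opposite_extension: "cut_extension scale LL V (\<lambda>v. p (- v)) e \<beta> \<alpha> (\<lambda>z. Q (- z))"
proof -
  interpret op: valued_space scale LL V "\<lambda>v. p (- v)" by (rule opposite)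
  have m: "- (c *v (e - u)) = c *v (u - e)" "- (c *v (u - e)) = c *v (e - u)" for c u
    by (simp_all add: scale_diff)
  show ?thesis
    by unfold_locales (use opposite_cut_fun cut Q_base in \<open>auto simp: m Q_pos Q_neg\<close>)
qed

lemma adjoin_cases:
  assumes "z \<in> adjoin V e"
  obtains "z \<in> V" | c u where "0 < c" "u \<in> V" "z = c *v (e - u)" | c u where "0 < c" "u \<in> V" "z = c *v (u - e)"
proof -
  obtain v c where z: "v \<in> V" "z = v + c *v e" using assms by (auto simp: adjoin_def)
  define u where "u = - (inverse c *v v)"
  have u: "u \<in> V" using z by (simp add: u_def)
  consider "c = 0" | "0 < c" | "c < 0" by (rule linorder_cases)
  then show thesis
  proof cases
    case 1 then show ?thesis using that(1) z by simp
  next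
    case 2
    then have "z = c *v (e - u)" using z by (simp add: u_def scale_add scale_minus scale_inverse)
    then show ?thesis using that(2) 2 u by blast
  next
    case 3
    then have "z = (- c) *v (u - e)" using z by (simp add: u_def scale_diff scale_add scale_minus minus_scale scale_inverse)
    then show ?thesis using that(3)[of "- c" u] 3 u by simp
  qed
qed

lemma Q_add_base:
  assumes "u \<in> V" "y \<in> V" "0 < c"
  shows "Q (c *v (e - u) + y) \<subseteq> \<alpha> u \<union> p y"
proof -
  have "c *v (e - u) + y = c *v (e - (u - inverse c *v y))"
    using assms by (simp add: scale_diff scale_inverse)
  then have "Q (c *v (e - u) + y) = \<alpha> (u - inverse c *v y)"
    using Q_pos assms by simp
  then show ?thesis
    using cut_funD(5)[OF cut, of "u - inverse c *v y" u] assms p_scale[OF assms(2) division_ring_inverse_pos[OF assms(3)]]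
    by simp
qed

text \<open>The sum is \<open>(c + c') *v (e - w)\<close> for the weighted mean \<open>w\<close> of
  \<open>u\<close> and \<open>u'\<close>. The distances \<open>p (u - w)\<close> and
  \<open>p (u' - w)\<close> equal \<open>p (u - u')\<close> and \<open>p (u' - u)\<close>, which are
  disjoint; comparing \<open>\<alpha> w\<close> with both \<open>\<alpha> u\<close> and
  \<open>\<alpha> u'\<close> thus leaves only
  \<open>\<alpha> u \<union> \<alpha> u'\<close>.\<close>

lemma Q_add_pos:
  assumes u: "u \<in> V" "u' \<in> V" and c: "0 < c" "0 < c'"
  shows "Q (c *v (e - u) + c' *v (e - u')) \<subseteq> \<alpha> u \<union> \<alpha> u'"
proof -
  have cc: "0 < c + c'" "0 < inverse (c + c')" "c + c' \<noteq> 0"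
    using c division_ring_inverse_pos[of "c + c'"] by (simp_all add: add_pos_pos less_imp_neq[symmetric])
  define w where "w = inverse (c + c') *v (c *v u + c' *v u')"
  have w: "w \<in> V" using u by (simp add: w_def)
  have "(c + c') *v w = c *v u + c' *v u'" using cc by (simp add: w_def scale_inverse)
  then have "c *v (e - u) + c' *v (e - u') = (c + c') *v (e - w)"
    by (simp add: scale_diff add_scale)
  then have Q: "Q (c *v (e - u) + c' *v (e - u')) = \<alpha> w" using Q_pos[OF w cc(1)] by simp
  have "u - w = inverse (c + c') *v (c + c') *v u - w" using cc by (simp add: scale_inverse)
  also have "\<dots> = inverse (c + c') *v c' *v (u - u')"
    by (simp add: w_def scale_add scale_diff add_scale)
  finally have 1: "p (u - w) = p (u - u')" using p_scale cc c u by simp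
  have "u' - w = inverse (c + c') *v (c + c') *v u' - w" using cc by (simp add: scale_inverse)
  also have "\<dots> = inverse (c + c') *v c *v (u' - u)"
    by (simp add: w_def scale_add scale_diff add_scale)
  finally have 2: "p (u' - w) = p (u' - u)" using p_scale cc c u by simp
  show ?thesis
    using cut_funD(5)[OF cut w u(1)] cut_funD(5)[OF cut w u(2)] p_diff_disjoint[OF u] unfolding Q 1 2 by blast
qed

text \<open>For \<open>c' < c\<close> the sum is \<open>(c - c') *v (e - w)\<close> with
  \<open>w\<close> on the line through \<open>u\<close> and \<open>u'\<close>, and
  \<open>p (u - w) = p (u' - u)\<close> is covered by \<open>\<beta> u' \<union> \<alpha> u\<close>.
  For \<open>c = c'\<close> the sum lies in \<open>V\<close>. The case \<open>c < c'\<close> is this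
  one in the opposite space.\<close>

lemma Q_add_neg:
  assumes u: "u \<in> V" "u' \<in> V" and c: "0 < c'" "c' \<le> c"
  shows "Q (c *v (e - u) + c' *v (u' - e)) \<subseteq> \<alpha> u \<union> \<beta> u'"
proof (cases "c = c'")
  case True
  have "c *v (e - u) + c' *v (u' - e) = c *v (u' - u)" using True by (simp add: scale_diff)
  then show ?thesis using Q_base[of "c *v (u' - u)"] p_scale[of "u' - u" c] cut_funD(7)[OF cut u(2,1)] u c True by auto
next
  case False
  have cc: "0 < c - c'" "c - c' \<noteq> 0"
    using c False by simp_all
  note ic = division_ring_inverse_pos[OF cc(1)]
  define w where "w = inverse (c - c') *v (c *v u - c' *v u')"
  have w: "w \<in> V" using u by (simp add: w_def)
  have "(c - c') *v w = c *v u - c' *v u'" using cc by (simp add: w_def scale_inverse)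
  then have "c *v (e - u) + c' *v (u' - e) = (c - c') *v (e - w)"
    by (simp add: scale_diff diff_scale)
  then have Q: "Q (c *v (e - u) + c' *v (u' - e)) = \<alpha> w" using Q_pos[OF w cc(1)] by simp
  have "u - w = inverse (c - c') *v (c - c') *v u - w" using cc by (simp add: scale_inverse)
  also have "\<dots> = inverse (c - c') *v c' *v (u' - u)"
    by (simp add: w_def scale_diff diff_scale)
  finally have 1: "p (u - w) = p (u' - u)" using p_scale ic c u by simp
  show ?thesis
    using cut_funD(5)[OF cut w u(1)] cut_funD(7)[OF cut u(2,1)] unfolding Q 1 by blast
qed

lemma Q_add_left:
  assumes u: "u \<in> V" and c: "0 < c" and y: "y \<in> adjoin V e"
  shows "Q (c *v (e - u) + y) \<subseteq> Q (c *v (e - u)) \<union> Q y"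
  using y
proof (cases rule: adjoin_cases)
  case 1 then show ?thesis using Q_add_base[OF u _ c] Q_pos[OF u c] Q_base by auto
next
  case (2 c' u') then show ?thesis using Q_add_pos[OF u _ c] Q_pos u c by auto
next
  case (3 c' u')
  interpret op: cut_extension scale LL V "\<lambda>v. p (- v)" e \<beta> \<alpha> "\<lambda>z. Q (- z)" by (rule opposite_extension)
  have "- (c' *v (e - u') + c *v (u - e)) = c *v (e - u) + c' *v (u' - e)" by (simp add: scale_diff algebra_simps)
  then show ?thesis
    using Q_add_neg[OF u 3(2,1), of c] op.Q_add_neg[OF 3(2) u c, of c'] linear[of c c']
    unfolding Q_pos[OF u c] 3(3) Q_neg[OF 3(2,1)] by (metis Un_commute)
qed

lemma subspace_adjoin: "local.subspace (adjoin V e)"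
  unfolding subspace_def
proof (intro conjI ballI allI)
  show "0 \<in> adjoin V e" by (rule adjoinI[of _ 0 0]) simp_all
  fix x assume x: "x \<in> adjoin V e"
  then obtain v c where v: "x = v + c *v e" "v \<in> V" by (auto simp: adjoin_def)
  show "d *v x \<in> adjoin V e" for d
    unfolding adjoin_def using v by (auto simp: scale_add scale_scale intro!: exI[of _ "d *v v"] exI[of _ "d * c"])
  fix y assume "y \<in> adjoin V e"
  then obtain w d where w: "y = w + d *v e" "w \<in> V" by (auto simp: adjoin_def)
  show "x + y \<in> adjoin V e"
    unfolding adjoin_def using v w by (auto simp: add_scale algebra_simps intro!: exI[of _ "v + w"] exI[of _ "c + d"])
qed

lemma adjoin_base: "V \<subseteq> adjoin V e"
  by (rule subsetI, rule adjoinI[where c = 0]) simp_all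

lemma adjoin_diff: "u \<in> V \<Longrightarrow> e - u \<in> adjoin V e" "u \<in> V \<Longrightarrow> u - e \<in> adjoin V e"
  subgoal by (rule adjoinI[of _ "- u" 1]) (simp_all add: scale_one)
  subgoal by (rule adjoinI[of _ u "- 1"]) (simp_all add: scale_one minus_scale)
  done

lemma valued_space_extension: "valued_space scale LL (adjoin V e) Q"
proof
  interpret op: cut_extension scale LL V "\<lambda>v. p (- v)" e \<beta> \<alpha> "\<lambda>z. Q (- z)" by (rule opposite_extension)
  show "local.subspace (adjoin V e)" by (rule subspace_adjoin)
  have m: "- (c *v (e - u)) = c *v (u - e)" "- (c *v (u - e)) = c *v (e - u)" for c u
    by (simp_all add: scale_diff)
  fix x assume x: "x \<in> adjoin V e"
  show "Q x \<in> LL"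
    using x by (cases rule: adjoin_cases) (use cut_funD(2,3)[OF cut] in \<open>simp_all add: Q_base Q_pos Q_neg\<close>)
  show "Q (d *v x) = Q x" if d: "0 < d" for d
    using x by (cases rule: adjoin_cases)
      (use d in \<open>simp_all add: Q_base Q_pos Q_neg p_scale scale_scale\<close>)
  show "Q x \<inter> Q (- x) = {}"
    using x by (cases rule: adjoin_cases)
      (use cut_funD(4)[OF cut] p_disjoint in \<open>auto simp: Q_base Q_pos Q_neg m\<close>)
  fix y assume y: "y \<in> adjoin V e"
  have my: "- z \<in> adjoin V e" if "z \<in> adjoin V e" for z
    using subspace_adjoin that minus_scale[of 1 z] unfolding subspace_def scale_one by metis
  show "Q (x + y) \<subseteq> Q x \<union> Q y"
    using x
  proof (cases rule: adjoin_cases)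
    case x1: 1
    show ?thesis
      using y
    proof (cases rule: adjoin_cases)
      case 1 then show ?thesis using x1 p_add by (simp add: Q_base)
    next
      case (2 c u) then show ?thesis using Q_add_left[OF 2(2,1) x] by (simp add: Un_commute add.commute)
    next
      case (3 c u)
      have "- (c *v (e - u) + - x) = x + y" "- (c *v (e - u)) = y" by (simp_all add: 3 scale_diff algebra_simps)
      then show ?thesis using op.Q_add_left[OF 3(2,1) my[OF x]] by (simp only: minus_minus Un_commute)
    qed
  next
    case (2 c u) then show ?thesis using Q_add_left[OF 2(2,1) y] by simp
  next
    case (3 c u)
    have "- (c *v (e - u) + - y) = x + y" "- (c *v (e - u)) = x" by (simp_all add: 3 scale_diff algebra_simps)
    then show ?thesis using op.Q_add_left[OF 3(2,1) my[OF y]] by (simp only: minus_minus)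
  qed
qed

text \<open>Tasks concern only \<open>a\<close> in \<open>V\<close>. If \<open>a\<close> is
  \<open>e - u'\<close> or \<open>u' - e\<close>, then subtracting or adding \<open>e - u\<close>
  gives a vector \<open>f\<close> of \<open>V\<close>, to which the case of \<open>V\<close>
  applies.\<close>

lemma closed_at_pos:
  assumes t: "\<And>z. z \<in> V \<times> V \<times> LL \<Longrightarrow> task p V \<alpha> \<beta> z" and a: "a \<in> adjoin V e" and u: "u \<in> V" and x: "x \<in> LL"
    and d: "0 < d"
  shows "closed_at Q a (d *v (e - u)) x"
proof -
  interpret W: valued_space scale LL "adjoin V e" Q by (rule valued_space_extension)
  note aV = subsetD[OF adjoin_base]
  have base: "closed_at Q a (e - u) x" if ax: "a \<in> V" "x \<in> LL" for a x
    unfolding closed_at_def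
  proof
    assume le: "Q a \<subseteq> Q (e - u) \<union> x"
    have "task p V \<alpha> \<beta> (a, u, x)" using t ax u by simp
    then obtain n where n: "n > 0" "u + inverse n *v a \<in> V" "p a \<inter> \<beta> (u + inverse n *v a) \<subseteq> x"
      using le unfolding task_def prod.case Q_pos_one[OF u] Q_base[OF ax(1)] by blast
    have "n *v (u + inverse n *v a - e) = a - n *v (e - u)"
      using n(1) by (simp add: scale_diff scale_add scale_inverse)
    then have "Q (a - n *v (e - u)) = \<beta> (u + inverse n *v a)" using Q_neg[OF n(2,1)] by simp
    then show "\<exists>n>0. Q a \<inter> Q (a - n *v (e - u)) \<subseteq> x" using n ax by (intro exI[of _ n]) (simp add: Q_base)
  qed
  have one: "0 < (1::'k)" by (rule division_ring_zero_less_one)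
  note eu = adjoin_diff(1)[OF u]
  show ?thesis
    using a
  proof (cases rule: adjoin_cases)
    case 1
    then show ?thesis using W.closed_at_scale[OF base[OF _ x], of a 1 d] a eu one d by (simp add: scale_one)
  next
    case (2 c u')
    have "closed_at Q (e - u') (e - u) x"
      unfolding closed_at_def
    proof
      assume le: "Q (e - u') \<subseteq> Q (e - u) \<union> x"
      define f where "f = u - u'"
      have f: "f \<in> V" using u 2 by (simp add: f_def)
      \<comment> \<open>The additional \<open>\<beta> u\<close> does no harm: outside
        \<open>x\<close> the set \<open>Q (e - u')\<close> lies in \<open>\<alpha> u\<close>, which
        misses \<open>\<beta> u\<close>.\<close>
      have "Q f \<subseteq> Q (e - u) \<union> (\<beta> u \<union> x)"
        using le cut_funD(7)[OF cut u 2(2)] f u 2 by (auto simp: f_def Q_base Q_pos_one)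
      then obtain m where m: "m > 0" "Q f \<inter> Q (f - m *v (e - u)) \<subseteq> \<beta> u \<union> x"
        using base[OF f, of "\<beta> u \<union> x"] x cut_funD(3)[OF cut u] by (auto simp: closed_at_def)
      \<comment> \<open>One more multiple than for \<open>f\<close>, because
        \<open>e - u' = f + (e - u)\<close>.\<close>
      have 1: "(e - u') - (m + 1) *v (e - u) = f - m *v (e - u)"
        by (simp add: f_def add_scale scale_one)
      have "Q (f - m *v (e - u)) \<inter> Q (m *v (e - u)) \<subseteq> Q ((f - m *v (e - u)) + m *v (e - u))"
        using f eu aV by (intro W.p_Int) auto
      then have "Q (e - u') \<inter> Q ((e - u') - (m + 1) *v (e - u)) \<subseteq> x"
        using m le cut_funD(4)[OF cut u] unfolding 1 Q_pos[OF u m(1)] Q_pos_one[OF u] diff_add_cancel by blast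
      then show "\<exists>n>0. Q (e - u') \<inter> Q (e - u' - n *v (e - u)) \<subseteq> x"
        using m(1) one by (intro exI[of _ "m + 1"]) (simp add: add_pos_pos)
    qed
    then show ?thesis using W.closed_at_scale 2 adjoin_diff eu d by auto
  next
    case (3 c u')
    have "closed_at Q (u' - e) (e - u) x"
      unfolding closed_at_def
    proof
      assume le: "Q (u' - e) \<subseteq> Q (e - u) \<union> x"
      define f where "f = u' - u"
      have f: "f \<in> V" using u 3 by (simp add: f_def)
      have "Q f \<subseteq> Q (e - u) \<union> x"
        using le cut_funD(7)[OF cut 3(2) u] f u 3 by (auto simp: f_def Q_base Q_pos_one Q_neg_one)
      then obtain m where m: "m > 0" "Q f \<inter> Q (f - m *v (e - u)) \<subseteq> x"
        using base[OF f x] by (auto simp: closed_at_def)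
      \<comment> \<open>Outside \<open>x\<close> the set \<open>Q (u' - e)\<close> lies in
        \<open>Q (e - u)\<close>, and there adding \<open>e - u\<close> to a vector loses no points
        of its value. So the multiple found for \<open>f\<close> also works here.\<close>
      have "Q (u' - e) \<inter> Q (e - u) \<subseteq> Q ((u' - e) + (e - u))"
        using eu adjoin_diff 3 by (intro W.p_Int) auto
      then have 1: "Q (u' - e) \<inter> Q (e - u) \<subseteq> Q f" by (simp add: f_def)
      have "Q (u' - e - m *v (e - u)) \<inter> Q (e - u) \<subseteq> Q ((u' - e - m *v (e - u)) + (e - u))"
        using eu adjoin_diff 3 by (intro W.p_Int) auto
      moreover have "(u' - e - m *v (e - u)) + (e - u) = f - m *v (e - u)" by (simp add: f_def)
      ultimately have "Q (u' - e) \<inter> Q (u' - e - m *v (e - u)) \<subseteq> x" using 1 m le by auto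
      then show "\<exists>n>0. Q (u' - e) \<inter> Q (u' - e - n *v (e - u)) \<subseteq> x" using m by blast
    qed
    then show ?thesis using W.closed_at_scale 3 adjoin_diff eu d by auto
  qed
qed

lemma closed_at_base:
  assumes t: "\<And>z. z \<in> V \<times> V \<times> LL \<Longrightarrow> task p V \<alpha> \<beta> z" and u: "u \<in> V" and b: "b \<in> V" and x: "x \<in> LL" and c: "0 < c"
  shows "closed_at Q (c *v (e - u)) b x"
proof -
  interpret W: valued_space scale LL "adjoin V e" Q by (rule valued_space_extension)
  have "closed_at Q (e - u) b x"
    unfolding closed_at_def
  proof
    assume le: "Q (e - u) \<subseteq> Q b \<union> x"
    have "task p V \<alpha> \<beta> (b, u, x)" using t b u x by simp
    then obtain n where n: "n > 0" "u + n *v b \<in> V" "\<alpha> u \<inter> \<alpha> (u + n *v b) \<subseteq> x"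
      using le Q_pos_one[OF u] b by (auto simp: task_def Q_base)
    have "Q (e - u - n *v b) = \<alpha> (u + n *v b)" using Q_pos_one[OF n(2)] by (simp add: diff_diff_eq)
    then show "\<exists>n>0. Q (e - u) \<inter> Q (e - u - n *v b) \<subseteq> x" using n Q_pos_one[OF u] by (intro exI[of _ n]) simp
  qed
  then show ?thesis
    using W.closed_at_scale[of "e - u" b x c 1] adjoin_diff u b adjoin_base c division_ring_zero_less_one[where 'k='k]
    by (auto simp: scale_one)
qed

lemma closed_extension:
  assumes cl: closed_val and t: "\<And>z. z \<in> V \<times> V \<times> LL \<Longrightarrow> task p V \<alpha> \<beta> z"
    and t': "\<And>z. z \<in> V \<times> V \<times> LL \<Longrightarrow> task (\<lambda>v. p (- v)) V \<beta> \<alpha> z"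
  shows "valued_space.closed_val scale LL (adjoin V e) Q"
proof -
  interpret W: valued_space scale LL "adjoin V e" Q by (rule valued_space_extension)
  interpret op: cut_extension scale LL V "\<lambda>v. p (- v)" e \<beta> \<alpha> "\<lambda>z. Q (- z)" by (rule opposite_extension)
  have m: "- (c *v (e - u)) = c *v (u - e)" "- (c *v (u - e)) = c *v (e - u)" for c u
    by (simp_all add: scale_diff)
  have opp: "closed_at Q a b x" if "closed_at (\<lambda>z. Q (- z)) (- a) (- b) x" for a b x
    using that unfolding closed_at_def by (simp add: scale_minus)
  show ?thesis
    unfolding W.closed_val_iff
  proof (intro ballI)
    fix a b x assume a: "a \<in> adjoin V e" and b: "b \<in> adjoin V e" and x: "x \<in> LL"
    show "closed_at Q a b x"
      using b
    proof (cases rule: adjoin_cases)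
      case b1: 1
      show ?thesis
        using a
      proof (cases rule: adjoin_cases)
        case 1
        then have "closed_at p a b x" using cl b1 x by (simp add: closed_val_iff)
        then show ?thesis using 1 b1 by (simp add: closed_at_def Q_base)
      next
        case (2 c u) then show ?thesis using closed_at_base[OF t 2(2) b1 x] by simp
      next
        case (3 c u) then show ?thesis
          using opp[of a b x] op.closed_at_base[OF t' 3(2) V_closed(4)[OF b1] x 3(1)] by (simp add: m)
      qed
    next
      case (2 c u) then show ?thesis using closed_at_pos[OF t a 2(2) x] by simp
    next
      case (3 c u) then show ?thesis
        using opp[of a b x] op.closed_at_pos[OF t' W.V_closed(4)[OF a] 3(2) x 3(1)] by (simp add: m)
    qed
  qed
qed

end

section \<open>Existence of extensions, prescribed values and positive parts\<close>

context valued_space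
begin

lemma adjoin_unique:
  assumes e: "e \<notin> V" and "v \<in> V" "w \<in> V" "v + c *v e = w + d *v e"
  shows "c = d" "v = w"
proof -
  show cd: "c = d"
  proof (rule ccontr)
    assume "c \<noteq> d"
    then have "c - d \<noteq> 0" by simp
    moreover have "(c - d) *v e = w - v" using assms(4) by (simp add: diff_scale algebra_simps)
    ultimately have "e = inverse (c - d) *v (w - v)" using scale_inverse(2)[of "c - d" e] by simp
    then show False using e assms(2,3) by simp
  qed
  then show "v = w" using assms(4) by simp
qed

lemma extension_exists:
  assumes e: "e \<notin> V" and cut: "cut_fun V \<alpha> \<beta>"
  shows "\<exists>Q. cut_extension scale LL V p e \<alpha> \<beta> Q"
proof -
  define coef where "coef z = (SOME c. z - c *v e \<in> V)" for z
  \<comment> \<open>For either sign of the coefficient, \<open>e - inverse (coef z) *v z\<close>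
    recovers the \<open>u\<close> for which \<open>z\<close> is a positive multiple of
    \<open>e - u\<close> or \<open>u - e\<close>.\<close>
  define Q where "Q z = (if z \<in> V then p z else if 0 < coef z then \<alpha> (e - inverse (coef z) *v z)
    else \<beta> (e - inverse (coef z) *v z))" for z
  have coef: "coef (v + c *v e) = c" if "v \<in> V" for v c
  proof -
    have "v + c *v e - c *v e \<in> V" using that by simp
    then have 1: "v + c *v e - coef (v + c *v e) *v e \<in> V" unfolding coef_def by (rule someI)
    show ?thesis by (rule adjoin_unique(1)[OF e 1 that]) simp
  qed
  have nV: "v + c *v e \<notin> V" if "v \<in> V" "c \<noteq> 0" for v c
    using adjoin_unique(1)[OF e that(1), of "v + c *v e" c 0] that by auto
  have d: "c *v (e - u) = - (c *v u) + c *v e" "c *v (u - e) = c *v u + (- c) *v e" for c u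
    by (simp_all add: scale_diff minus_scale)
  have "Q (c *v (e - u)) = \<alpha> u" if u: "u \<in> V" and c: "0 < c" for c u
  proof -
    have "coef (c *v (e - u)) = c" "c *v (e - u) \<notin> V" unfolding d using coef[of "- (c *v u)" c] nV[of "- (c *v u)" c] u c by simp_all
    then show ?thesis using c by (simp add: Q_def scale_inverse)
  qed
  moreover have "Q (c *v (u - e)) = \<beta> u" if u: "u \<in> V" and c: "0 < c" for c u
  proof -
    have "coef (c *v (u - e)) = - c" "c *v (u - e) \<notin> V" unfolding d using coef[of "c *v u" "- c"] nV u c by simp_all
    moreover have "inverse (- c) *v c *v (u - e) = e - u"
      using scale_inverse(2)[of "- c" "e - u"] c by (simp add: scale_diff minus_scale)
    moreover have "\<not> 0 < - c" using c by simp
    ultimately show ?thesis by (simp add: Q_def)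
  qed
  ultimately have "cut_extension scale LL V p e \<alpha> \<beta> Q"
    by unfold_locales (use cut in \<open>simp_all add: Q_def\<close>)
  then show ?thesis by blast
qed

theorem extend_by_cuts:
  assumes cl: closed_val and V: "countable V" and LL: "countable LL" and e: "e \<notin> V"
    and c: "cut_fun F0 \<alpha>0 \<beta>0" and F0: "finite F0"
  shows "\<exists>Q. valued_space scale LL (adjoin V e) Q \<and> valued_space.closed_val scale LL (adjoin V e) Q
    \<and> (\<forall>v\<in>V. Q v = p v) \<and> (\<forall>u\<in>F0. Q (e - u) = \<alpha>0 u \<and> Q (u - e) = \<beta>0 u)"
proof -
  obtain \<alpha> \<beta> where ab: "cut_fun V \<alpha> \<beta>" "\<forall>u\<in>F0. \<alpha> u = \<alpha>0 u \<and> \<beta> u = \<beta>0 u"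
    and t: "\<And>z. z \<in> V \<times> V \<times> LL \<Longrightarrow> task p V \<alpha> \<beta> z" "\<And>z. z \<in> V \<times> V \<times> LL \<Longrightarrow> task (\<lambda>v. p (- v)) V \<beta> \<alpha> z"
    using cut_fun_total[OF cl V LL c F0] by blast
  obtain Q where "cut_extension scale LL V p e \<alpha> \<beta> Q" using extension_exists[OF e ab(1)] by blast
  then interpret cut_extension scale LL V p e \<alpha> \<beta> Q .
  have "F0 \<subseteq> V" using c by (simp add: cut_fun_def)
  then show ?thesis
    using valued_space_extension closed_extension[OF cl t] ab(2) Q_base Q_pos_one Q_neg_one
    by (intro exI[of _ Q]) auto
qed

definition attains :: "'v set \<Rightarrow> ('v \<Rightarrow> 'x set) \<Rightarrow> 'x set \<Rightarrow> bool" where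
  "attains W q x \<longleftrightarrow> (\<exists>w\<in>W. q w = x \<and> q (- w) = {})"

text \<open>In the quotient by the kernel the three conditions read \<open>0 \<le> w\<close>,
  \<open>v \<le> w\<close> and \<open>w \<sqinter> (w - v) = 0\<close>; they characterize the
  positive part of \<open>v\<close>.\<close>

definition has_pos_part :: "'v set \<Rightarrow> ('v \<Rightarrow> 'x set) \<Rightarrow> 'v \<Rightarrow> bool" where
  "has_pos_part W q v \<longleftrightarrow> (\<exists>w\<in>W. q (- w) = {} \<and> q (v - w) = {} \<and> q w \<inter> q (w - v) = {})"

lemma extend_attains_pos_part:
  assumes cl: closed_val and V: "countable V" and LL: "countable LL" and e: "e \<notin> V"
  shows "\<exists>Q. valued_space scale LL (adjoin V e) Q \<and> valued_space.closed_val scale LL (adjoin V e) Q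
    \<and> (\<forall>v\<in>V. Q v = p v) \<and> (case y of Inl x \<Rightarrow> x \<in> LL \<longrightarrow> attains (adjoin V e) Q x
       | Inr v \<Rightarrow> v \<in> V \<longrightarrow> has_pos_part (adjoin V e) Q v)"
proof -
  have eW: "e \<in> adjoin V e" by (rule adjoinI[of _ 0 1]) (simp_all add: scale_one)
  note step = extend_by_cuts[OF cl V LL e]
  have triv: "cut_fun {} \<alpha> \<beta>" for \<alpha> \<beta> by (simp add: cut_fun_def)
  show ?thesis
  proof (cases y)
    case (Inl x)
    show ?thesis
    proof (cases "x \<in> LL")
      case True
      \<comment> \<open>Prescribed at \<open>0\<close>: the new vector has value \<open>x\<close>
        and its negative has empty value.\<close>
      then have "cut_fun {0} (\<lambda>_. x) (\<lambda>_. {})" by (simp add: cut_fun_def)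
      from step[OF this] show ?thesis
        unfolding Inl attains_def using eW by (simp; blast)
    next
      case False
      then show ?thesis using step[OF triv] Inl by simp
    qed
  next
    case (Inr v)
    show ?thesis
    proof (cases "v \<in> V")
      case True
      \<comment> \<open>The new \<open>e\<close> is meant to be the positive part of
        \<open>v\<close>. So \<open>e\<close> gets value \<open>p v\<close>, and
        \<open>e - v\<close>, the negative part, gets \<open>p (- v)\<close>; \<open>- e\<close> and
        \<open>v - e\<close> get the empty value. For \<open>v = 0\<close> the two points coincide
        and all values are empty.\<close>
      then have "cut_fun {0, v} (\<lambda>u. if u = 0 then p v else p (- v)) (\<lambda>_. {})" by (auto simp: cut_fun_def)
      from step[OF this] obtain Q where Q: "valued_space scale LL (adjoin V e) Q"
        "valued_space.closed_val scale LL (adjoin V e) Q" "\<forall>v\<in>V. Q v = p v"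
        "Q e = p v" "Q (- e) = {}" "Q (v - e) = {}" "v \<noteq> 0 \<longrightarrow> Q (e - v) = p (- v)" by auto
      have "Q e \<inter> Q (e - v) = {}" using Q(4,7) True p_disjoint[of v] by (cases "v = 0") auto
      then show ?thesis using Q(1-3,5,6) eW unfolding Inr has_pos_part_def by auto
    next
      case False
      then show ?thesis using step[OF triv] Inr by simp
    qed
  qed
qed

primrec adjoin_seq :: "(nat \<Rightarrow> 'v) \<Rightarrow> nat \<Rightarrow> 'v set" where
  "adjoin_seq e 0 = V"
| "adjoin_seq e (Suc n) = adjoin (adjoin_seq e n) (e n)"

text \<open>Every new vector demands a positive part of its own, so infinitely many vectors are
  needed. Later steps leave the values already fixed untouched, hence a demand once met stays met in
  the union.\<close>

theorem extend_complete:
  assumes cl: closed_val and V: "countable V" and LL: "countable LL"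
    and K: "countable (UNIV :: 'k set)" and e: "\<And>n. e n \<notin> adjoin_seq e n"
    and W: "W = (\<Union>n. adjoin_seq e n)"
  shows "\<exists>Q. valued_space scale LL W Q \<and> valued_space.closed_val scale LL W Q
    \<and> (\<forall>v\<in>V. Q v = p v) \<and> (\<forall>x\<in>LL. attains W Q x) \<and> (\<forall>v\<in>W. has_pos_part W Q v)"
proof -
  let ?A = "adjoin_seq e"
  have cA: "countable (?A n)" for n
  proof (induction n)
    case (Suc n)
    have "?A (Suc n) = (\<lambda>(v, c). v + c *v e n) ` (?A n \<times> UNIV)" by (auto simp: adjoin_def)
    then show ?case using Suc K by (auto intro!: countable_image countable_SIGMA)
  qed (simp add: V)
  have AS: "?A n \<subseteq> ?A (Suc n)" for n
    by (rule subsetI, simp, rule adjoinI[where c = 0]) simp_all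
  have Am: "?A m \<subseteq> ?A n" if "m \<le> n" for m n
    using AS that by (rule lift_Suc_mono_le)
  have AW: "?A n \<subseteq> W" for n using W by blast
  define Z where "Z = (Inl ` LL \<union> Inr ` W :: ('x set + 'v) set)"
  have Z: "countable Z" "Z \<noteq> {}" using LL cA empty_mem unfolding Z_def W by (blast intro: countable_Un countable_image countable_UN)+
  \<comment> \<open>The decoding repeats every demand at arbitrarily late stages: a positive part of
    \<open>v\<close> can be supplied only after \<open>v\<close> has entered some
    \<open>adjoin_seq e n\<close>.\<close>
  define z where "z n = from_nat_into Z (fst (prod_decode n))" for n
  have zs: "\<exists>n\<ge>m. z n = y" if y: "y \<in> Z" for y m
  proof -
    obtain k where k: "from_nat_into Z k = y" using from_nat_into_surj[OF Z(1) y] by blast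
    then have "z (prod_encode (k, m)) = y" by (simp add: z_def)
    then show ?thesis using le_prod_encode_2 by blast
  qed
  define good where "good n q \<longleftrightarrow> valued_space scale LL (?A n) q \<and> valued_space.closed_val scale LL (?A n) q
    \<and> (\<forall>v\<in>V. q v = p v)" for n q
  define step where "step n q q' \<longleftrightarrow> (\<forall>v\<in>?A n. q' v = q v) \<and> (case z n of Inl x \<Rightarrow> x \<in> LL \<longrightarrow> attains (?A (Suc n)) q' x
       | Inr v \<Rightarrow> v \<in> ?A n \<longrightarrow> has_pos_part (?A (Suc n)) q' v)" for n q q'
  have "\<exists>q. \<forall>n. good n (q n) \<and> step n (q n) (q (Suc n))"
  proof (rule dependent_nat_choice)
    show "\<exists>q. good 0 q" using cl valued_space_axioms by (auto simp: good_def)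
    fix q n assume g: "good n q"
    then interpret An: valued_space scale LL "?A n" q by (simp add: good_def)
    have "An.closed_val" using g by (simp add: good_def)
    from An.extend_attains_pos_part[OF this cA LL e, of "z n"]
    obtain q' where q': "valued_space scale LL (?A (Suc n)) q'"
      "valued_space.closed_val scale LL (?A (Suc n)) q'" "\<forall>v\<in>?A n. q' v = q v"
      "case z n of Inl x \<Rightarrow> x \<in> LL \<longrightarrow> attains (?A (Suc n)) q' x
       | Inr v \<Rightarrow> v \<in> ?A n \<longrightarrow> has_pos_part (?A (Suc n)) q' v"
      unfolding attains_def An.attains_def has_pos_part_def An.has_pos_part_def adjoin_seq.simps by blast
    have "V \<subseteq> ?A n" using Am[of 0 n] by simp
    then have "good (Suc n) q'" using q' g unfolding good_def by auto
    then show "\<exists>q'. good (Suc n) q' \<and> step n q q'" using q' unfolding step_def by blast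
  qed
  then obtain q where q: "\<And>n. good n (q n)" "\<And>n. step n (q n) (q (Suc n))" by blast
  have qe: "q n v = q m v" if "m \<le> n" "v \<in> ?A m" for m n v
    using that(1)
  proof (induction rule: dec_induct)
    case (step n)
    have "v \<in> ?A n" using Am[OF step(1)] that(2) by blast
    then show ?case using q(2)[of n] step(3) unfolding step_def by simp
  qed simp
  define Q where "Q v = q (LEAST n. v \<in> ?A n) v" for v
  have Q: "Q v = q n v" if "v \<in> ?A n" for v n
  proof -
    have "(LEAST n. v \<in> ?A n) \<le> n" "v \<in> ?A (LEAST n. v \<in> ?A n)" using that by (auto intro: Least_le LeastI)
    then show ?thesis using qe unfolding Q_def by metis
  qed
  have vn: "valued_space scale LL (?A n) (q n)" for n using q(1) by (simp add: good_def)
  have two: "\<exists>n. x \<in> ?A n \<and> y \<in> ?A n" if xy: "x \<in> W" "y \<in> W" for x y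
  proof -
    obtain m n where "x \<in> ?A m" "y \<in> ?A n" using xy W by blast
    then have "x \<in> ?A (max m n) \<and> y \<in> ?A (max m n)" using Am[of m "max m n"] Am[of n "max m n"] by auto
    then show ?thesis by blast
  qed
  have vW: "valued_space scale LL W Q"
  proof
    show "local.subspace W"
      unfolding subspace_def
    proof (intro conjI ballI allI)
      show "0 \<in> W" using AW[of 0] by auto
    next
      fix x y assume "x \<in> W" "y \<in> W"
      then obtain n where n: "x \<in> ?A n" "y \<in> ?A n" using two by blast
      then show "x + y \<in> W" using valued_space.V_closed(2)[OF vn n] AW by blast
    next
      fix c x assume "x \<in> W"
      then obtain n where n: "x \<in> ?A n" using two by blast
      then show "c *v x \<in> W" using valued_space.V_closed(3)[OF vn n] AW by blast
    qed
    fix x assume x: "x \<in> W"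
    then obtain n where n: "x \<in> ?A n" using W by blast
    then interpret An: valued_space scale LL "?A n" "q n" using vn by simp
    show "Q x \<in> LL" using Q[OF n] n by simp
    show "Q (c *v x) = Q x" if "0 < c" for c using Q[OF n] Q[of "c *v x" n] n that An.p_scale by simp
    show "Q x \<inter> Q (- x) = {}" using Q[OF n] Q[of "- x" n] n An.p_disjoint by simp
    fix y assume "y \<in> W"
    then obtain n where n: "x \<in> ?A n" "y \<in> ?A n" using two x by blast
    then show "Q (x + y) \<subseteq> Q x \<union> Q y"
      using Q[OF n(1)] Q[OF n(2)] Q[of "x + y" n] valued_space.V_closed(2)[OF vn] valued_space.p_add[OF vn] by simp
  qed
  moreover have "valued_space.closed_val scale LL W Q"
    unfolding valued_space.closed_val_def[OF vW]
  proof (intro ballI impI)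
    fix a b x assume "a \<in> W" "b \<in> W" and x: "x \<in> LL" and le: "Q a \<subseteq> Q b \<union> x"
    then obtain n where n: "a \<in> ?A n" "b \<in> ?A n" using two by blast
    interpret An: valued_space scale LL "?A n" "q n" using vn by simp
    have "An.closed_val" using q(1)[of n] by (simp add: good_def)
    then obtain r where r: "r > 0" "q n a \<inter> q n (a - r *v b) \<subseteq> x"
      using n x le Q unfolding An.closed_val_def by metis
    then show "\<exists>r>0. Q a \<inter> Q (a - r *v b) \<subseteq> x"
      using Q[OF n(1)] Q[of "a - r *v b" n] n by (intro exI[of _ r]) simp
  qed
  moreover have "\<forall>v\<in>V. Q v = p v" using Q[of _ 0] q(1)[of 0] by (simp add: good_def)
  moreover have "attains W Q x" if x: "x \<in> LL" for x
  proof -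
    obtain n where "z n = Inl x" using zs[of "Inl x" 0] x by (auto simp: Z_def)
    then obtain w where w: "w \<in> ?A (Suc n)" "q (Suc n) w = x" "q (Suc n) (- w) = {}"
      using q(2)[of n] x by (auto simp: step_def attains_def)
    have "- w \<in> ?A (Suc n)" using valued_space.V_closed(4)[OF vn w(1)] .
    then show ?thesis using w Q AW unfolding attains_def by blast
  qed
  moreover have "has_pos_part W Q v" if v: "v \<in> W" for v
  proof -
    obtain m where m: "v \<in> ?A m" using v W by blast
    obtain n where n: "n \<ge> m" "z n = Inr v" using zs[of "Inr v" m] v by (auto simp: Z_def)
    then have vn': "v \<in> ?A n" "v \<in> ?A (Suc n)" using m Am[OF n(1)] AS by blast+
    then have "has_pos_part (?A (Suc n)) (q (Suc n)) v"
      using q(2)[of n] n(2) by (simp add: step_def)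
    then obtain w where w: "w \<in> ?A (Suc n)" "q (Suc n) (- w) = {}" "q (Suc n) (v - w) = {}"
        "q (Suc n) w \<inter> q (Suc n) (w - v) = {}"
      by (auto simp: has_pos_part_def)
    interpret An: valued_space scale LL "?A (Suc n)" "q (Suc n)" by (rule vn)
    have "- w \<in> ?A (Suc n)" "v - w \<in> ?A (Suc n)" "w - v \<in> ?A (Suc n)"
      using An.V_closed(4,5) w(1) vn'(2) by blast+
    then have "Q (- w) = {} \<and> Q (v - w) = {} \<and> Q w \<inter> Q (w - v) = {}" using w Q by metis
    then show ?thesis using w(1) AW unfolding has_pos_part_def by blast
  qed
  ultimately show ?thesis by blast
qed

end

section \<open>Stone representation\<close>

context distributive_zero_lattice
begin

definition prime_filters :: "'a set set" where
  "prime_filters = {F. F \<subseteq> carrier L \<and> \<bottom> \<notin> F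
     \<and> (\<forall>x\<in>F. \<forall>y\<in>carrier L. x \<sqsubseteq> y \<longrightarrow> y \<in> F)
     \<and> (\<forall>x\<in>F. \<forall>y\<in>F. x \<sqinter> y \<in> F)
     \<and> (\<forall>x\<in>carrier L. \<forall>y\<in>carrier L. x \<squnion> y \<in> F \<longrightarrow> x \<in> F \<or> y \<in> F)}"

definition stone :: "'a \<Rightarrow> 'a set set" where
  "stone a = {F \<in> prime_filters. a \<in> F}"

text \<open>A filter maximal among those containing \<open>a\<close> and missing \<open>b\<close> is
  prime. If \<open>x\<close> and \<open>y\<close> are outside, then \<open>m \<sqinter> x\<close>
  and \<open>n \<sqinter> y\<close> lie below \<open>b\<close> for some members \<open>m\<close> and
  \<open>n\<close>, and distributivity puts
  \<open>(m \<sqinter> n) \<sqinter> (x \<squnion> y)\<close> below \<open>b\<close> as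
  well.\<close>

lemma prime_filter_exists:
  assumes a: "a \<in> carrier L" and b: "b \<in> carrier L" and ab: "\<not> a \<sqsubseteq> b"
  shows "\<exists>F\<in>prime_filters. a \<in> F \<and> b \<notin> F"
proof -
  define \<A> where "\<A> = {F. F \<subseteq> carrier L \<and> a \<in> F \<and> b \<notin> F
     \<and> (\<forall>x\<in>F. \<forall>y\<in>carrier L. x \<sqsubseteq> y \<longrightarrow> y \<in> F) \<and> (\<forall>x\<in>F. \<forall>y\<in>F. x \<sqinter> y \<in> F)}"
  have "\<exists>M\<in>\<A>. \<forall>G\<in>\<A>. M \<subseteq> G \<longrightarrow> G = M"
  proof (rule subset_Zorn_nonempty)
    have "{x \<in> carrier L. a \<sqsubseteq> x} \<in> \<A>"
      unfolding \<A>_def using a b ab by (auto intro: le_trans meet_le)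
    then show "\<A> \<noteq> {}" by blast
  next
    fix C assume C: "C \<noteq> {}" "subset.chain \<A> C"
    then have 1: "G \<in> \<A>" if "G \<in> C" for G using that by (auto simp: subset_chain_def)
    have 2: "G \<subseteq> H \<or> H \<subseteq> G" if "G \<in> C" "H \<in> C" for G H using C(2) that by (auto simp: subset_chain_def)
    have "x \<sqinter> y \<in> \<Union>C" if xy: "x \<in> \<Union>C" "y \<in> \<Union>C" for x y
    proof -
      obtain G H where GH: "G \<in> C" "x \<in> G" "H \<in> C" "y \<in> H" using xy by blast
      then obtain Z where "Z \<in> C" "x \<in> Z" "y \<in> Z" using 2[of G H] by blast
      then show ?thesis using 1[of Z] unfolding \<A>_def by blast
    qed
    then show "\<Union>C \<in> \<A>" using 1 C(1) unfolding \<A>_def by blast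
  qed
  then obtain M where M: "M \<in> \<A>" and max: "\<And>G. G \<in> \<A> \<Longrightarrow> M \<subseteq> G \<Longrightarrow> G = M" by blast
  have Mc: "M \<subseteq> carrier L" "a \<in> M" "b \<notin> M"
    and up: "\<And>x y. x \<in> M \<Longrightarrow> y \<in> carrier L \<Longrightarrow> x \<sqsubseteq> y \<Longrightarrow> y \<in> M"
    and meet: "\<And>x y. x \<in> M \<Longrightarrow> y \<in> M \<Longrightarrow> x \<sqinter> y \<in> M"
    using M unfolding \<A>_def by blast+
  have gen: "\<exists>m\<in>M. m \<sqinter> x \<sqsubseteq> b" if x: "x \<in> carrier L" "x \<notin> M" for x
  proof (rule ccontr)
    assume no: "\<not> (\<exists>m\<in>M. m \<sqinter> x \<sqsubseteq> b)"
    define G where "G = {y \<in> carrier L. \<exists>m\<in>M. m \<sqinter> x \<sqsubseteq> y}"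
    have MG: "M \<subseteq> G" unfolding G_def using Mc x meet_left by blast
    have "x \<in> G" unfolding G_def using Mc x meet_right[of a x] a by blast
    have "y \<sqinter> z \<in> G" if yz: "y \<in> G" "z \<in> G" for y z
    proof -
      obtain m n where mn: "m \<in> M" "n \<in> M" "m \<sqinter> x \<sqsubseteq> y" "n \<sqinter> x \<sqsubseteq> z" and c: "y \<in> carrier L" "z \<in> carrier L"
        using yz unfolding G_def by blast
      have mc: "m \<in> carrier L" "n \<in> carrier L" using mn Mc by auto
      have l: "(m \<sqinter> n) \<sqinter> x \<sqsubseteq> m" "(m \<sqinter> n) \<sqinter> x \<sqsubseteq> n" "(m \<sqinter> n) \<sqinter> x \<sqsubseteq> x"
        using mc x(1) by (meson meet_closed meet_left meet_right le_trans)+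
      have "(m \<sqinter> n) \<sqinter> x \<sqsubseteq> m \<sqinter> x" "(m \<sqinter> n) \<sqinter> x \<sqsubseteq> n \<sqinter> x"
        using l mc x(1) by (auto intro!: meet_le)
      then have "(m \<sqinter> n) \<sqinter> x \<sqsubseteq> y" "(m \<sqinter> n) \<sqinter> x \<sqsubseteq> z"
        using mn(3,4) mc c x(1) by (meson meet_closed le_trans)+
      then have "(m \<sqinter> n) \<sqinter> x \<sqsubseteq> y \<sqinter> z" using mc c x(1) by (intro meet_le) auto
      then show ?thesis unfolding G_def using meet[OF mn(1,2)] c by auto
    qed
    moreover have "z \<in> G" if "y \<in> G" "z \<in> carrier L" "y \<sqsubseteq> z" for y z
      using that unfolding G_def using Mc x(1) by (auto intro: le_trans meet_closed)
    moreover have "a \<in> G" "b \<notin> G" using MG Mc no unfolding G_def by auto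
    ultimately have "G \<in> \<A>" unfolding \<A>_def G_def by blast
    then show False using max[OF _ MG] \<open>x \<in> G\<close> x by simp
  qed
  have "x \<in> M \<or> y \<in> M" if xy: "x \<in> carrier L" "y \<in> carrier L" "x \<squnion> y \<in> M" for x y
  proof (rule ccontr)
    assume "\<not> (x \<in> M \<or> y \<in> M)"
    then obtain m n where mn: "m \<in> M" "n \<in> M" "m \<sqinter> x \<sqsubseteq> b" "n \<sqinter> y \<sqsubseteq> b"
      using gen[OF xy(1)] gen[OF xy(2)] by blast
    have mc: "m \<in> carrier L" "n \<in> carrier L" using mn Mc by auto
    have "(m \<sqinter> n) \<sqinter> x \<sqsubseteq> m \<sqinter> x" "(m \<sqinter> n) \<sqinter> y \<sqsubseteq> n \<sqinter> y"
      using mc xy(1,2) by (meson meet_closed meet_left meet_right le_trans meet_le)+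
    then have "(m \<sqinter> n) \<sqinter> x \<sqsubseteq> b" "(m \<sqinter> n) \<sqinter> y \<sqsubseteq> b"
      using mn(3,4) mc b xy(1,2) by (meson meet_closed le_trans)+
    then have "(m \<sqinter> n) \<sqinter> (x \<squnion> y) \<sqsubseteq> b"
      using mc b xy(1,2) by (simp add: distrib join_le)
    moreover have "(m \<sqinter> n) \<sqinter> (x \<squnion> y) \<in> M" using meet mn xy(3) by blast
    ultimately show False using up b Mc(3) by blast
  qed
  moreover have "\<bottom> \<notin> M" using up[of "\<bottom>" b] Mc(3) b bottom_lower by blast
  ultimately have "M \<in> prime_filters"
    unfolding prime_filters_def using Mc(1) up meet by blast
  then show ?thesis using Mc by blast
qed

lemma stone_subset_iff:
  assumes "a \<in> carrier L" "b \<in> carrier L"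
  shows "stone a \<subseteq> stone b \<longleftrightarrow> a \<sqsubseteq> b"
  using prime_filter_exists[OF assms] assms unfolding stone_def prime_filters_def by blast

lemma stone_inj: "inj_on stone (carrier L)"
  by (rule inj_onI) (metis stone_subset_iff order_refl le_antisym)

lemma stone_bottom: "stone \<bottom> = {}"
  by (auto simp: stone_def prime_filters_def)

lemma stone_join:
  assumes "a \<in> carrier L" "b \<in> carrier L"
  shows "stone (a \<squnion> b) = stone a \<union> stone b"
proof
  show "stone (a \<squnion> b) \<subseteq> stone a \<union> stone b" using assms unfolding stone_def prime_filters_def by blast
  show "stone a \<union> stone b \<subseteq> stone (a \<squnion> b)"
    using stone_subset_iff[of a "a \<squnion> b"] stone_subset_iff[of b "a \<squnion> b"] assms join_left join_right by simp
qed

lemma stone_meet: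
  assumes "a \<in> carrier L" "b \<in> carrier L"
  shows "stone (a \<sqinter> b) = stone a \<inter> stone b"
proof
  show "stone a \<inter> stone b \<subseteq> stone (a \<sqinter> b)" unfolding stone_def prime_filters_def by blast
  show "stone (a \<sqinter> b) \<subseteq> stone a \<inter> stone b"
    using stone_subset_iff[of "a \<sqinter> b" a] stone_subset_iff[of "a \<sqinter> b" b] assms meet_left meet_right by simp
qed

lemma normal_set_ring_stone:
  assumes "completely_normal L" shows "normal_set_ring (stone ` carrier L)"
proof
  show "{} \<in> stone ` carrier L" using stone_bottom bottom_closed by blast
  fix a b assume "a \<in> stone ` carrier L" "b \<in> stone ` carrier L"
  then obtain x y where xy: "x \<in> carrier L" "y \<in> carrier L" "a = stone x" "b = stone y" by blast
  show "a \<union> b \<in> stone ` carrier L" using stone_join[OF xy(1,2)] xy join_closed by blast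
  show "a \<inter> b \<in> stone ` carrier L" using stone_meet[OF xy(1,2)] xy meet_closed by blast
  obtain u v where uv: "u \<in> carrier L" "v \<in> carrier L" "x \<squnion> y = x \<squnion> v" "x \<squnion> y = u \<squnion> y" "u \<sqinter> v = \<bottom>"
    using assms xy(1,2) unfolding completely_normal_def by blast
  have "a \<union> b = a \<union> stone v" "a \<union> b = stone u \<union> b" "stone u \<inter> stone v = {}"
    using stone_join xy uv stone_meet[of u v] stone_bottom by metis+
  then show "\<exists>x\<in>stone ` carrier L. \<exists>y\<in>stone ` carrier L. a \<subseteq> b \<union> x \<and> b \<subseteq> a \<union> y \<and> x \<inter> y = {}"
    using uv by blast
qed

end

section \<open>Lattice structure transported along order isomorphisms\<close>

lemma (in lattice) join_eqI: "least L s (Upper L {x, y}) \<Longrightarrow> x \<squnion> y = s"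
  unfolding join_def sup_def by (metis least_unique someI)

lemma (in lattice) meet_eqI: "greatest L s (Lower L {x, y}) \<Longrightarrow> x \<sqinter> y = s"
  unfolding meet_def inf_def by (metis greatest_unique someI)

text \<open>Joins and meets depend on the order alone. For \<open>Idc\<close> this avoids computing
  joins and meets of principal ideals: an order isomorphism onto the given lattice is
  enough.\<close>

lemma (in partial_order) lattice_of_order_iso:
  assumes B: "lattice B" and h: "bij_betw h (carrier L) (carrier B)"
    and le: "\<And>x y. x \<in> carrier L \<Longrightarrow> y \<in> carrier L \<Longrightarrow> x \<sqsubseteq> y \<longleftrightarrow> h x \<sqsubseteq>\<^bsub>B\<^esub> h y"
  shows "lattice L" "lattice_iso L B h"
proof -
  interpret B: lattice B by (rule B)
  have hc: "h x \<in> carrier B" if "x \<in> carrier L" for x using h that by (auto simp: bij_betw_def)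
  have hs: "\<exists>x\<in>carrier L. h x = y" if "y \<in> carrier B" for y
    using that unfolding bij_betw_imp_surj_on[OF h, symmetric] by blast
  have sup: "least L s (Upper L {x, y})" if xy: "x \<in> carrier L" "y \<in> carrier L" and s: "s \<in> carrier L" "h s = h x \<squnion>\<^bsub>B\<^esub> h y" for x y s
  proof (rule least_UpperI)
    show "z \<sqsubseteq> s" if "z \<in> {x, y}" for z
      using that xy s le hc B.join_left B.join_right by auto
    show "s \<sqsubseteq> z" if "z \<in> Upper L {x, y}" for z
    proof -
      have "z \<in> carrier L" "x \<sqsubseteq> z" "y \<sqsubseteq> z" using that xy by (auto simp: Upper_def)
      then show ?thesis using le s xy hc B.join_le by auto
    qed
  qed (use xy s in auto)
  have inf: "greatest L s (Lower L {x, y})" if xy: "x \<in> carrier L" "y \<in> carrier L" and s: "s \<in> carrier L" "h s = h x \<sqinter>\<^bsub>B\<^esub> h y" for x y s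
  proof (rule greatest_LowerI)
    show "s \<sqsubseteq> z" if "z \<in> {x, y}" for z
      using that xy s le hc B.meet_left B.meet_right by auto
    show "z \<sqsubseteq> s" if "z \<in> Lower L {x, y}" for z
    proof -
      have "z \<in> carrier L" "z \<sqsubseteq> x" "z \<sqsubseteq> y" using that xy by (auto simp: Lower_def)
      then show ?thesis using le s xy hc B.meet_le by auto
    qed
  qed (use xy s in auto)
  have ex: "\<exists>s\<in>carrier L. h s = h x \<squnion>\<^bsub>B\<^esub> h y" "\<exists>s\<in>carrier L. h s = h x \<sqinter>\<^bsub>B\<^esub> h y"
    if "x \<in> carrier L" "y \<in> carrier L" for x y
    using hs that hc by auto
  show lat: "lattice L"
  proof unfold_locales
    fix x y assume xy: "x \<in> carrier L" "y \<in> carrier L"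
    obtain s where "s \<in> carrier L" "h s = h x \<squnion>\<^bsub>B\<^esub> h y" using ex(1)[OF xy] by blast
    then show "\<exists>s. least L s (Upper L {x, y})" by (intro exI sup[OF xy])
    obtain s where "s \<in> carrier L" "h s = h x \<sqinter>\<^bsub>B\<^esub> h y" using ex(2)[OF xy] by blast
    then show "\<exists>s. greatest L s (Lower L {x, y})" by (intro exI inf[OF xy])
  qed
  interpret lattice L by (rule lat)
  have "h (x \<squnion> y) = h x \<squnion>\<^bsub>B\<^esub> h y" if xy: "x \<in> carrier L" "y \<in> carrier L" for x y
  proof -
    obtain s where s: "s \<in> carrier L" "h s = h x \<squnion>\<^bsub>B\<^esub> h y" using ex xy by blast
    then have "x \<squnion> y = s" using join_eqI[OF sup[OF xy s]] by simp
    then show ?thesis using s by simp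
  qed
  moreover have "h (x \<sqinter> y) = h x \<sqinter>\<^bsub>B\<^esub> h y" if xy: "x \<in> carrier L" "y \<in> carrier L" for x y
  proof -
    obtain s where s: "s \<in> carrier L" "h s = h x \<sqinter>\<^bsub>B\<^esub> h y" using ex xy by blast
    then have "x \<sqinter> y = s" using meet_eqI[OF inf[OF xy s]] by simp
    then show ?thesis using s by simp
  qed
  ultimately show "lattice_iso L B h"
    using lat B h hc by (auto simp: lattice_iso_def lattice_hom_def join_pres_def meet_pres_def)
qed

section \<open>The vector lattice of a complete valued space\<close>

locale complete_valued_space = valued_space scale LL V p
  for scale :: "'k::{division_ring, linordered_ring_strict} \<Rightarrow> 'v::ab_group_add \<Rightarrow> 'v" (infixr \<open>*v\<close> 75)
    and LL :: "'x set set" and V p +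
  assumes countable_V: "countable V"
    and p_closed: "a \<in> V \<Longrightarrow> b \<in> V \<Longrightarrow> x \<in> LL \<Longrightarrow> p a \<subseteq> p b \<union> x \<Longrightarrow> \<exists>n>0. p a \<inter> p (a - n *v b) \<subseteq> x"
    and attained: "x \<in> LL \<Longrightarrow> \<exists>w\<in>V. p w = x \<and> p (- w) = {}"
    and pos_part: "v \<in> V \<Longrightarrow> \<exists>w\<in>V. p (- w) = {} \<and> p (v - w) = {} \<and> p w \<inter> p (w - v) = {}"
begin

definition eqv :: "'v \<Rightarrow> 'v \<Rightarrow> bool" where
  "eqv x y \<longleftrightarrow> p (x - y) = {} \<and> p (y - x) = {}"

text \<open>Classes are coded by the least code of a member, in order to have the carrier in \<open>nat\<close>.\<close>

definition cls :: "'v \<Rightarrow> nat" where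
  "cls x = (LEAST n. \<exists>y\<in>V. eqv x y \<and> to_nat_on V y = n)"

definition rep :: "nat \<Rightarrow> 'v" where
  "rep n = (SOME x. x \<in> V \<and> cls x = n)"

definition quot :: "('k, nat) ordered_module" where
  "quot = \<lparr>carrier = cls ` V, monoid.mult = (\<lambda>_ _. 0), one = 0, ring.zero = cls 0, ring.add = (\<lambda>m n. cls (rep m + rep n)),
     smult = (\<lambda>c n. cls (c *v rep n)), vle = (\<lambda>m n. p (rep m - rep n) = {})\<rparr>"

lemma p_sub_add: "x \<in> V \<Longrightarrow> y \<in> V \<Longrightarrow> p x = {} \<Longrightarrow> p y = {} \<Longrightarrow> p (x + y) = {}"
  using p_add[of x y] by blast

lemma le_trans: "x \<in> V \<Longrightarrow> y \<in> V \<Longrightarrow> z \<in> V \<Longrightarrow> p (x - y) = {} \<Longrightarrow> p (y - z) = {} \<Longrightarrow> p (x - z) = {}"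
  using p_triangle[of x y z] by blast

lemma eqv_refl: "x \<in> V \<Longrightarrow> eqv x x"
  by (simp add: eqv_def)

lemma eqv_sym: "eqv x y \<Longrightarrow> eqv y x"
  by (simp add: eqv_def)

lemma eqv_trans: "x \<in> V \<Longrightarrow> y \<in> V \<Longrightarrow> z \<in> V \<Longrightarrow> eqv x y \<Longrightarrow> eqv y z \<Longrightarrow> eqv x z"
  unfolding eqv_def using le_trans by blast

lemma cls_eq_iff:
  assumes "x \<in> V" "y \<in> V"
  shows "cls x = cls y \<longleftrightarrow> eqv x y"
proof
  have ex: "\<exists>z\<in>V. eqv x z \<and> to_nat_on V z = cls x" if "x \<in> V" for x
    unfolding cls_def by (rule LeastI_ex) (use that eqv_refl in blast)
  assume eq: "cls x = cls y"
  obtain z where z: "z \<in> V" "eqv x z" "to_nat_on V z = cls x" using ex[OF assms(1)] by blast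
  obtain w where w: "w \<in> V" "eqv y w" "to_nat_on V w = cls y" using ex[OF assms(2)] by blast
  have "z = w" using z w eq countable_V by (metis inj_onD inj_on_to_nat_on)
  then show "eqv x y" using eqv_trans[OF assms(1) z(1) assms(2) z(2)] eqv_sym[OF w(2)] by simp
next
  assume "eqv x y"
  then have "eqv x z \<longleftrightarrow> eqv y z" if "z \<in> V" for z
    using eqv_trans eqv_sym assms that by blast
  then show "cls x = cls y" unfolding cls_def by (intro arg_cong[where f = Least] ext) blast
qed

lemma rep_cls: assumes "x \<in> V" shows "rep (cls x) \<in> V" "eqv (rep (cls x)) x"
proof -
  have "rep (cls x) \<in> V \<and> cls (rep (cls x)) = cls x"
    unfolding rep_def by (rule someI[of _ x]) (use assms in simp)
  then show "rep (cls x) \<in> V" "eqv (rep (cls x)) x" using cls_eq_iff assms by blast+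
qed

lemma carrier_quot [simp]: "carrier quot = cls ` V" and zero_quot: "\<zero>\<^bsub>quot\<^esub> = cls 0"
  by (simp_all add: quot_def)

lemma add_quot [simp]: assumes "x \<in> V" "y \<in> V" shows "cls x \<oplus>\<^bsub>quot\<^esub> cls y = cls (x + y)"
proof -
  have "p ((rep (cls x) - x) + (rep (cls y) - y)) = {}" "p ((x - rep (cls x)) + (y - rep (cls y))) = {}"
    using rep_cls[OF assms(1)] rep_cls[OF assms(2)] assms unfolding eqv_def by (simp_all add: p_sub_add)
  then have "eqv (rep (cls x) + rep (cls y)) (x + y)" by (simp add: eqv_def algebra_simps)
  then show ?thesis using rep_cls(1) assms by (simp add: quot_def cls_eq_iff)
qed

text \<open>For negative \<open>c\<close> the two hypotheses change places. The kernel is therefore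
  closed under all scalars, and scalar multiplication is well defined on classes.\<close>

lemma p_scale_empty: assumes "x \<in> V" "p x = {}" "p (- x) = {}" shows "p (c *v x) = {}"
proof -
  consider "c = 0" | "0 < c" | "c < 0" by (rule linorder_cases)
  then show ?thesis
  proof cases
    case 3
    then have "p ((- c) *v (- x)) = {}" using p_scale[of "- x" "- c"] assms by simp
    then show ?thesis by (simp add: minus_scale scale_minus)
  qed (use assms p_scale in simp_all)
qed

lemma smult_quot [simp]: assumes "x \<in> V" shows "c \<odot>\<^bsub>quot\<^esub> cls x = cls (c *v x)"
proof -
  have "p (c *v (rep (cls x) - x)) = {}" "p (c *v (x - rep (cls x))) = {}"
    using rep_cls[OF assms] assms p_scale_empty[of "rep (cls x) - x" c] p_scale_empty[of "x - rep (cls x)" c]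
    unfolding eqv_def by simp_all
  then have "eqv (c *v rep (cls x)) (c *v x)" by (simp add: eqv_def scale_diff)
  then show ?thesis using rep_cls(1) assms by (simp add: quot_def cls_eq_iff)
qed

lemma vle_quot [simp]: assumes "x \<in> V" "y \<in> V" shows "vle quot (cls x) (cls y) \<longleftrightarrow> p (x - y) = {}"
proof -
  note x = rep_cls[OF assms(1)] and y = rep_cls[OF assms(2)]
  have 1: "p (rep (cls x) - rep (cls y)) \<subseteq> p (rep (cls x) - x) \<union> (p (x - y) \<union> p (y - rep (cls y)))"
    using p_triangle[OF x(1) assms(1) y(1)] p_triangle[OF assms y(1)] by blast
  have 2: "p (x - y) \<subseteq> p (x - rep (cls x)) \<union> (p (rep (cls x) - rep (cls y)) \<union> p (rep (cls y) - y))"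
    using p_triangle[OF assms(1) x(1) assms(2)] p_triangle[OF x(1) y(1) assms(2)] by blast
  have "p (rep (cls x) - rep (cls y)) = {} \<longleftrightarrow> p (x - y) = {}"
    using 1 2 x(2) y(2) unfolding eqv_def by blast
  then show ?thesis by (simp add: quot_def)
qed

lemma cls_eqI: "x \<in> V \<Longrightarrow> y \<in> V \<Longrightarrow> p (x - y) = {} \<Longrightarrow> p (y - x) = {} \<Longrightarrow> cls x = cls y"
  by (simp add: cls_eq_iff eqv_def)

section \<open>Lattice operations of the quotient\<close>

sublocale ord: partial_order "order_of quot"
proof
  fix x y z assume "x \<in> carrier (order_of quot)" "y \<in> carrier (order_of quot)" "z \<in> carrier (order_of quot)"
  then obtain a b c where abc: "a \<in> V" "b \<in> V" "c \<in> V" "x = cls a" "y = cls b" "z = cls c" by auto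
  show "x \<sqsubseteq>\<^bsub>order_of quot\<^esub> y \<Longrightarrow> y \<sqsubseteq>\<^bsub>order_of quot\<^esub> z \<Longrightarrow> x \<sqsubseteq>\<^bsub>order_of quot\<^esub> z"
    using le_trans[of a b c] unfolding abc le_order_of by (simp add: abc(1-3))
  show "x \<sqsubseteq>\<^bsub>order_of quot\<^esub> y \<Longrightarrow> y \<sqsubseteq>\<^bsub>order_of quot\<^esub> x \<Longrightarrow> x .=\<^bsub>order_of quot\<^esub> y"
    using cls_eqI[of a b] unfolding abc le_order_of by (simp add: abc(1-3) order_of_def)
  show "x \<sqsubseteq>\<^bsub>order_of quot\<^esub> x" unfolding abc le_order_of by (simp add: abc(1))
qed (simp_all add: order_of_def)

text \<open>\<open>w\<close> acts as the positive part of \<open>x - y\<close>, and the join of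
  \<open>x\<close> and \<open>y\<close> is \<open>y\<close> plus that part. For an upper bound
  \<open>u\<close> the value of \<open>y + w - u\<close> is contained in both \<open>p w\<close> and
  \<open>p (w - (x - y))\<close>, which are disjoint.\<close>

lemma least_quot:
  assumes xyw: "x \<in> V" "y \<in> V" "w \<in> V" and w: "p (- w) = {}" "p (x - y - w) = {}" "p w \<inter> p (w - (x - y)) = {}"
  shows "least (order_of quot) (cls (y + w)) (Upper (order_of quot) {cls x, cls y})"
proof (rule least_UpperI)
  show "z \<sqsubseteq>\<^bsub>order_of quot\<^esub> cls (y + w)" if "z \<in> {cls x, cls y}" for z
    using that xyw w(1,2) by (auto simp: diff_diff_eq)
  show "cls (y + w) \<sqsubseteq>\<^bsub>order_of quot\<^esub> z" if z: "z \<in> Upper (order_of quot) {cls x, cls y}" for z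
  proof -
    obtain u where u: "u \<in> V" "z = cls u" "p (x - u) = {}" "p (y - u) = {}"
      using z xyw by (auto simp: Upper_def)
    have "p ((y - u) + w) \<subseteq> p w" "p ((x - u) + (w - (x - y))) \<subseteq> p (w - (x - y))"
      using p_add[of "y - u" w] p_add[of "x - u" "w - (x - y)"] u xyw by auto
    moreover have "(y - u) + w = y + w - u" "(x - u) + (w - (x - y)) = y + w - u" by (simp_all add: algebra_simps)
    ultimately have "p (y + w - u) = {}" using w(3) by auto
    then show ?thesis using u xyw by simp
  qed
qed (use xyw in auto)

text \<open>Dually, the meet is \<open>x\<close> minus the positive part of
  \<open>x - y\<close>.\<close>

lemma greatest_quot:
  assumes xyw: "x \<in> V" "y \<in> V" "w \<in> V" and w: "p (- w) = {}" "p (x - y - w) = {}" "p w \<inter> p (w - (x - y)) = {}"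
  shows "greatest (order_of quot) (cls (x - w)) (Lower (order_of quot) {cls x, cls y})"
proof (rule greatest_LowerI)
  have *: "x - w - y = x - y - w" by (simp add: algebra_simps)
  show "cls (x - w) \<sqsubseteq>\<^bsub>order_of quot\<^esub> z" if "z \<in> {cls x, cls y}" for z
    using that xyw w(1,2) by (auto simp: *)
  show "z \<sqsubseteq>\<^bsub>order_of quot\<^esub> cls (x - w)" if z: "z \<in> Lower (order_of quot) {cls x, cls y}" for z
  proof -
    obtain u where u: "u \<in> V" "z = cls u" "p (u - x) = {}" "p (u - y) = {}"
      using z xyw by (auto simp: Lower_def)
    have "p ((u - x) + w) \<subseteq> p w" "p ((u - y) + (w - (x - y))) \<subseteq> p (w - (x - y))"
      using p_add[of "u - x" w] p_add[of "u - y" "w - (x - y)"] u xyw by auto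
    moreover have "(u - x) + w = u - (x - w)" "(u - y) + (w - (x - y)) = u - (x - w)" by (simp_all add: algebra_simps)
    ultimately have "p (u - (x - w)) = {}" using w(3) by auto
    then show ?thesis using u xyw by simp
  qed
qed (use xyw in auto)

lemma lattice_quot: "lattice (order_of quot)"
proof unfold_locales
  fix m n assume "m \<in> carrier (order_of quot)" "n \<in> carrier (order_of quot)"
  then obtain x y where xy: "x \<in> V" "y \<in> V" "m = cls x" "n = cls y" by auto
  obtain w where w: "w \<in> V" "p (- w) = {}" "p (x - y - w) = {}" "p w \<inter> p (w - (x - y)) = {}"
    using pos_part[of "x - y"] xy by auto
  show "\<exists>s. least (order_of quot) s (Upper (order_of quot) {m, n})"
    unfolding xy(3,4) by (rule exI, rule least_quot[OF xy(1,2) w])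
  show "\<exists>s. greatest (order_of quot) s (Lower (order_of quot) {m, n})"
    unfolding xy(3,4) by (rule exI, rule greatest_quot[OF xy(1,2) w])
qed

sublocale quot: vector_lattice quot
proof -
  have "abelian_group quot"
  proof (rule abelian_groupI)
    fix x assume "x \<in> carrier quot"
    then obtain a where a: "a \<in> V" "x = cls a" by auto
    then show "\<exists>y\<in>carrier quot. y \<oplus>\<^bsub>quot\<^esub> x = \<zero>\<^bsub>quot\<^esub>"
      by (intro bexI[of _ "cls (- a)"]) (auto simp: zero_quot)
  qed (auto simp: zero_quot algebra_simps)
  then show "vector_lattice quot"
  proof (intro vector_lattice.intro vector_lattice_axioms.intro, goal_cases)
    case 7 show ?case by (rule lattice_quot)
  next
    case (8 x y z)
    then show ?case by auto
  next
    case (9 c x)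
    then obtain a where a: "a \<in> V" "x = cls a" "p (- a) = {}" by (auto simp: zero_quot)
    then have "p (c *v (- a)) = {}" using p_scale[of "- a" c] 9(2) by (cases "c = 0") auto
    then show ?case using a by (simp add: zero_quot scale_minus)
  qed (auto simp: add_scale scale_add scale_scale scale_one)
qed

section \<open>Principal ideals of the quotient\<close>

lemma zero_le_cls: "x \<in> V \<Longrightarrow> vle quot \<zero>\<^bsub>quot\<^esub> (cls x) \<longleftrightarrow> p (- x) = {}"
  using vle_quot[of 0 x] by (simp add: zero_quot)

lemma pos_cone_quot: "pos_cone quot = cls ` {x \<in> V. p (- x) = {}}"
  by (auto simp: pos_cone_def zero_le_cls)

lemma minus_quot: "x \<in> V \<Longrightarrow> \<ominus>\<^bsub>quot\<^esub> cls x = cls (- x)"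
  by (rule quot.minus_equality) (auto simp: zero_quot)

lemma vabs_quot:
  assumes "x \<in> V" "p (- x) = {}" shows "vabs quot (cls x) = cls x"
proof -
  interpret lattice "order_of quot" by (rule lattice_quot)
  have "p (- x - x) = {}" using p_sub_add[of "- x" "- x"] assms by simp
  then have "cls (- x) \<sqsubseteq>\<^bsub>order_of quot\<^esub> cls x" using assms by simp
  then have "least (order_of quot) (cls x) (Upper (order_of quot) {cls x, cls (- x)})"
    using assms by (intro least_UpperI) (auto simp: Upper_def)
  then show ?thesis using join_eqI assms by (simp add: vabs_def minus_quot)
qed

text \<open>The direction from values to ideals is closedness at \<open>{}\<close>: it yields
  \<open>n\<close> with \<open>p a\<close> disjoint from \<open>p (a - n *v b)\<close>, and the
  latter is contained in \<open>p a\<close> because \<open>b\<close> is positive.\<close>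

lemma principal_ideal_subset_iff:
  assumes a: "a \<in> V" "p (- a) = {}" and b: "b \<in> V" "p (- b) = {}"
  shows "principal_ideal quot (cls a) \<subseteq> principal_ideal quot (cls b) \<longleftrightarrow> p a \<subseteq> p b"
proof -
  have "principal_ideal quot (cls a) \<subseteq> principal_ideal quot (cls b) \<longleftrightarrow> cls a \<in> principal_ideal quot (cls b)"
    using quot.principal_ideal_self[of "cls a"] quot.principal_ideal_mono[of "cls a" "cls b"] a b by auto
  also have "\<dots> \<longleftrightarrow> (\<exists>c\<ge>0. p (a - c *v b) = {})"
    using a b by (simp add: principal_ideal_def vabs_quot)
  also have "\<dots> \<longleftrightarrow> p a \<subseteq> p b"
  proof
    assume "\<exists>c\<ge>0. p (a - c *v b) = {}"
    then obtain c where c: "c \<ge> 0" "p (a - c *v b) = {}" by blast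
    have "p a \<subseteq> p (c *v b)" using p_add[of "a - c *v b" "c *v b"] c a b by simp
    also have "\<dots> \<subseteq> p b" using p_scale[of b c] c b by (cases "c = 0") auto
    finally show "p a \<subseteq> p b" .
  next
    assume "p a \<subseteq> p b"
    then obtain n where n: "n > 0" "p a \<inter> p (a - n *v b) \<subseteq> {}" using p_closed[OF a(1) b(1), of "{}"] by auto
    have "p (- (n *v b)) = {}" using p_scale[of "- b" n] n b by (simp add: scale_minus)
    then have "p (a - n *v b) \<subseteq> p a" using p_add[of a "- (n *v b)"] a b by simp
    then show "\<exists>c\<ge>0. p (a - c *v b) = {}" using n by (intro exI[of _ n]) auto
  qed
  finally show ?thesis .
qed

definition idc_val :: "nat set \<Rightarrow> 'x set" where
  "idc_val I = p (SOME a. a \<in> V \<and> p (- a) = {} \<and> I = principal_ideal quot (cls a))"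

lemma idc_val: assumes a: "a \<in> V" "p (- a) = {}" shows "idc_val (principal_ideal quot (cls a)) = p a"
proof -
  define b where "b = (SOME b. b \<in> V \<and> p (- b) = {} \<and> principal_ideal quot (cls a) = principal_ideal quot (cls b))"
  have "b \<in> V \<and> p (- b) = {} \<and> principal_ideal quot (cls a) = principal_ideal quot (cls b)"
    unfolding b_def by (rule someI[of _ a]) (use a in simp)
  then have "p a = p b" using principal_ideal_subset_iff a by blast
  then show ?thesis by (simp add: idc_val_def b_def)
qed

lemma carrier_Idc: "carrier (Idc quot) = {principal_ideal quot (cls a) | a. a \<in> V \<and> p (- a) = {}}"
  by (auto simp: Idc_def pos_cone_quot)

lemma idc_val_bij: "bij_betw idc_val (carrier (Idc quot)) LL"
proof (rule bij_betw_imageI)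
  show "inj_on idc_val (carrier (Idc quot))"
  proof (rule inj_onI)
    fix I J assume "I \<in> carrier (Idc quot)" "J \<in> carrier (Idc quot)" and eq: "idc_val I = idc_val J"
    then obtain a b where ab: "a \<in> V" "p (- a) = {}" "b \<in> V" "p (- b) = {}"
      and IJ: "I = principal_ideal quot (cls a)" "J = principal_ideal quot (cls b)"
      unfolding carrier_Idc by blast
    have "p a = p b" using eq ab by (simp add: IJ idc_val)
    then show "I = J" using ab unfolding IJ by (intro subset_antisym) (simp_all add: principal_ideal_subset_iff)
  qed
  show "idc_val ` carrier (Idc quot) = LL"
  proof
    show "idc_val ` carrier (Idc quot) \<subseteq> LL" by (auto simp: carrier_Idc idc_val)
    show "LL \<subseteq> idc_val ` carrier (Idc quot)"
    proof
      fix x assume "x \<in> LL"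
      then obtain w where "w \<in> V" "p w = x" "p (- w) = {}" using attained by blast
      then show "x \<in> idc_val ` carrier (Idc quot)"
        by (intro image_eqI[of _ _ "principal_ideal quot (cls w)"]) (auto simp: carrier_Idc idc_val)
    qed
  qed
qed

lemma idc_val_le:
  "I \<in> carrier (Idc quot) \<Longrightarrow> J \<in> carrier (Idc quot) \<Longrightarrow> I \<sqsubseteq>\<^bsub>Idc quot\<^esub> J \<longleftrightarrow> idc_val I \<subseteq> idc_val J"
proof -
  assume "I \<in> carrier (Idc quot)" "J \<in> carrier (Idc quot)"
  then obtain a b where ab: "a \<in> V" "p (- a) = {}" "b \<in> V" "p (- b) = {}"
    and IJ: "I = principal_ideal quot (cls a)" "J = principal_ideal quot (cls b)"
    unfolding carrier_Idc by blast
  then show ?thesis by (simp add: idc_val principal_ideal_subset_iff) (simp add: Idc_def principal_ideal_subset_iff)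
qed

lemma partial_order_Idc: "partial_order (Idc quot)"
  by unfold_locales (auto simp: Idc_def)

end

section \<open>Homomorphisms induced by inclusions\<close>

locale valued_space_map =
  S: complete_valued_space scale LL V p + T: complete_valued_space scale LL' V' p'
  for scale :: "'k::{division_ring, linordered_ring_strict} \<Rightarrow> 'v::ab_group_add \<Rightarrow> 'v" (infixr \<open>*v\<close> 75)
    and LL LL' :: "'x set set" and V p V' p' +
  assumes sub: "V \<subseteq> V'"
    and disjoint_map: "x \<in> V \<Longrightarrow> y \<in> V \<Longrightarrow> p x \<inter> p y = {} \<Longrightarrow> p' x \<inter> p' y = {}"
begin

lemma empty_map: "x \<in> V \<Longrightarrow> p x = {} \<Longrightarrow> p' x = {}"
  using disjoint_map[of x x] by simp

definition induced :: "nat \<Rightarrow> nat" where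
  "induced = T.cls \<circ> S.rep"

lemma induced_cls [simp]:
  assumes x: "x \<in> V" shows "induced (S.cls x) = T.cls x"
  using S.rep_cls[OF x] x sub empty_map[of "S.rep (S.cls x) - x"] empty_map[of "x - S.rep (S.cls x)"]
  unfolding induced_def S.eqv_def by (auto intro!: T.cls_eqI)

text \<open>A vector \<open>w\<close> acting as the positive part of \<open>x - y\<close> in the
  source still does so in the target, as this only involves empty and disjoint values. The same
  \<open>w\<close> thus computes joins and meets on both sides, which is why
  \<open>disjoint_map\<close> is enough of a link between \<open>p\<close> and
  \<open>p'\<close>.\<close>

lemma induced_hom: "vector_lattice_hom S.quot T.quot induced"
proof -
  interpret SL: lattice "order_of S.quot" by (rule S.lattice_quot)
  interpret TL: lattice "order_of T.quot" by (rule T.lattice_quot)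
  have VV: "x \<in> V'" if "x \<in> V" for x using sub that by blast
  have jm: "induced (m \<squnion>\<^bsub>order_of S.quot\<^esub> n) = induced m \<squnion>\<^bsub>order_of T.quot\<^esub> induced n \<and>
    induced (m \<sqinter>\<^bsub>order_of S.quot\<^esub> n) = induced m \<sqinter>\<^bsub>order_of T.quot\<^esub> induced n"
    if mn: "m \<in> S.cls ` V" "n \<in> S.cls ` V" for m n
  proof -
    obtain x y where xy: "x \<in> V" "y \<in> V" "m = S.cls x" "n = S.cls y" using mn by blast
    obtain w where w: "w \<in> V" "p (- w) = {}" "p (x - y - w) = {}" "p w \<inter> p (w - (x - y)) = {}"
      using S.pos_part[of "x - y"] xy by auto
    have w': "p' (- w) = {}" "p' (x - y - w) = {}" "p' w \<inter> p' (w - (x - y)) = {}"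
      using w xy empty_map disjoint_map by simp_all
    show ?thesis
      using SL.join_eqI[OF S.least_quot[OF xy(1,2) w]] SL.meet_eqI[OF S.greatest_quot[OF xy(1,2) w]]
        TL.join_eqI[OF T.least_quot[OF VV[OF xy(1)] VV[OF xy(2)] VV[OF w(1)] w']]
        TL.meet_eqI[OF T.greatest_quot[OF VV[OF xy(1)] VV[OF xy(2)] VV[OF w(1)] w']]
        xy w(1) by simp
  qed
  show ?thesis
    unfolding vector_lattice_hom_def lattice_hom_def join_pres_def meet_pres_def
    using jm VV S.lattice_quot T.lattice_quot by auto
qed

lemma Idc_map_induced:
  assumes "a \<in> V" "p (- a) = {}"
  shows "Idc_map S.quot T.quot induced (principal_ideal S.quot (S.cls a)) = principal_ideal T.quot (T.cls a)"
  using Idc_map_principal_ideal[OF S.quot.vector_lattice_axioms T.quot.vector_lattice_axioms induced_hom, of "S.cls a"] assms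
  by (simp add: S.pos_cone_quot)

end

section \<open>Diagrams over a forest\<close>

definition fscale :: "'k::{division_ring, linordered_ring_strict} \<Rightarrow> ('i \<Rightarrow> 'k) \<Rightarrow> 'i \<Rightarrow> 'k" where
  "fscale c f = (\<lambda>i. c * f i)"

interpretation fscale: left_space fscale
  by unfold_locales (auto simp: fscale_def fun_eq_iff distrib_left distrib_right mult.assoc)

text \<open>The free left vector space on the pairs with first component in \<open>A\<close>. All
  these spaces share one type, so for \<open>s \<le> t\<close> the space at \<open>s\<close> is a
  subspace of the one at \<open>t\<close>.\<close>

definition supported :: "'t set \<Rightarrow> ('t \<times> nat \<Rightarrow> 'k::zero) set" where
  "supported A = {f. finite {i. f i \<noteq> 0} \<and> (\<forall>i. f i \<noteq> 0 \<longrightarrow> fst i \<in> A)}"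

lemma supported_mono: "A \<subseteq> B \<Longrightarrow> supported A \<subseteq> supported B"
  by (auto simp: supported_def)

lemma subspace_supported:
  "fscale.subspace (supported A :: ('t \<times> nat \<Rightarrow> 'k::{division_ring, linordered_ring_strict}) set)"
  unfolding fscale.subspace_def
proof (intro conjI ballI allI)
  fix f g :: "'t \<times> nat \<Rightarrow> 'k" and c assume f: "f \<in> supported A" and g: "g \<in> supported A"
  have "{i. (f + g) i \<noteq> 0} \<subseteq> {i. f i \<noteq> 0} \<union> {i. g i \<noteq> 0}" by auto
  then have "finite {i. (f + g) i \<noteq> 0}" using f g by (auto simp: supported_def intro: finite_subset)
  moreover have "fst i \<in> A" if "(f + g) i \<noteq> 0" for i
    using f g that unfolding supported_def by (cases i; cases "f i = 0") auto
  ultimately show "f + g \<in> supported A" unfolding supported_def mem_Collect_eq by blast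
next
  fix f :: "'t \<times> nat \<Rightarrow> 'k" and c assume f: "f \<in> supported A"
  have "{i. fscale c f i \<noteq> 0} \<subseteq> {i. f i \<noteq> 0}" by (auto simp: fscale_def)
  then have "finite {i. fscale c f i \<noteq> 0}" using f by (auto simp: supported_def intro: finite_subset)
  then show "fscale c f \<in> supported A" using f by (auto simp: supported_def fscale_def)
qed (simp add: supported_def)

lemma countable_supported:
  assumes "countable A" "countable (UNIV :: 'k::{division_ring, linordered_ring_strict} set)"
  shows "countable (supported A :: ('t \<times> nat \<Rightarrow> 'k) set)"
proof -
  let ?h = "\<lambda>xs i. case map_of xs i of None \<Rightarrow> (0 :: 'k) | Some c \<Rightarrow> c"
  let ?S = "(A \<times> (UNIV :: nat set)) \<times> (UNIV :: 'k set)"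
  have "supported A \<subseteq> ?h ` lists ?S"
  proof
    fix f :: "'t \<times> nat \<Rightarrow> 'k" assume f: "f \<in> supported A"
    then have "finite {i. f i \<noteq> 0}" by (simp add: supported_def)
    then obtain js where js: "set js = {i. f i \<noteq> 0}" using finite_list by blast
    have "f = ?h (map (\<lambda>i. (i, f i)) js)"
    proof
      fix i
      show "f i = ?h (map (\<lambda>i. (i, f i)) js) i"
        using js by (auto simp: map_of_map_restrict restrict_map_def)
    qed
    moreover have "fst i \<in> A" if "i \<in> set js" for i
      using f that js unfolding supported_def by blast
    then have "map (\<lambda>i. (i, f i)) js \<in> lists ?S" by (auto simp: mem_Times_iff)
    ultimately show "f \<in> ?h ` lists ?S" by blast
  qed
  moreover have "countable ?S" using assms by (intro countable_SIGMA) auto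
  ultimately show ?thesis by (meson countable_lists countable_image countable_subset)
qed

section \<open>Recursion along the forest\<close>

locale set_diagram =
  fixes T :: "'t set" and r :: "'t rel" and LL :: "'t \<Rightarrow> 'x set set" and \<Phi> :: "'t \<Rightarrow> 't \<Rightarrow> 'x set \<Rightarrow> 'x set"
  assumes forest: "forest T r"
    and height: "t \<in> T \<Longrightarrow> countable_height r t"
    and LL: "t \<in> T \<Longrightarrow> normal_set_ring (LL t)" "t \<in> T \<Longrightarrow> countable (LL t)"
    and map_mem: "(s, t) \<in> r \<Longrightarrow> a \<in> LL s \<Longrightarrow> \<Phi> s t a \<in> LL t"
    and map_empty: "(s, t) \<in> r \<Longrightarrow> \<Phi> s t {} = {}"
    and map_Un: "(s, t) \<in> r \<Longrightarrow> a \<in> LL s \<Longrightarrow> b \<in> LL s \<Longrightarrow> \<Phi> s t (a \<union> b) = \<Phi> s t a \<union> \<Phi> s t b"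
    and map_Int: "(s, t) \<in> r \<Longrightarrow> a \<in> LL s \<Longrightarrow> b \<in> LL s \<Longrightarrow> \<Phi> s t (a \<inter> b) = \<Phi> s t a \<inter> \<Phi> s t b"
    and map_closed: "(s, t) \<in> r \<Longrightarrow> a \<in> LL s \<Longrightarrow> b \<in> LL s \<Longrightarrow> x \<in> LL t \<Longrightarrow> \<Phi> s t a \<subseteq> \<Phi> s t b \<union> x
      \<Longrightarrow> \<exists>u\<in>LL s. a \<subseteq> b \<union> u \<and> \<Phi> s t u \<subseteq> x"
    and map_id: "t \<in> T \<Longrightarrow> a \<in> LL t \<Longrightarrow> \<Phi> t t a = a"
    and map_comp: "(s, t) \<in> r \<Longrightarrow> (t, u) \<in> r \<Longrightarrow> a \<in> LL s \<Longrightarrow> \<Phi> s u a = \<Phi> t u (\<Phi> s t a)"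
begin

lemma order: "r \<subseteq> T \<times> T" "t \<in> T \<Longrightarrow> (t, t) \<in> r" "trans r" "antisym r"
  using forest by (auto simp: forest_def partial_order_on_def preorder_on_def refl_on_def)

lemma well_order: "t \<in> T \<Longrightarrow> well_order_on (under r t) (Restr r (under r t))"
  using forest by (simp add: forest_def)

lemma comparable:
  assumes "(s, t) \<in> r" "(s', t) \<in> r" shows "(s, s') \<in> r \<or> (s', s) \<in> r"
proof -
  have "t \<in> T" using assms order(1) by blast
  then have "total_on (under r t) (Restr r (under r t))"
    using well_order by (auto simp: well_order_on_def linear_order_on_def)
  moreover have "(s, s) \<in> r" using assms order by blast
  ultimately show ?thesis using assms by (auto simp: total_on_def under_def)
qed

text \<open>A nonempty \<open>Q\<close> is cut down to the well-ordered ideal of one of its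
  elements. A minimal element there is minimal in \<open>Q\<close>, because the ideal is downward
  closed.\<close>

lemma wf_strict: "wf (r - Id)"
proof (rule wfI_min)
  fix q :: 't and Q assume q: "q \<in> Q"
  show "\<exists>z\<in>Q. \<forall>y. (y, z) \<in> r - Id \<longrightarrow> y \<notin> Q"
  proof (cases "q \<in> T")
    case True
    have "wf (Restr r (under r q) - Id)" using well_order[OF True] by (simp add: well_order_on_def)
    moreover have "q \<in> Q \<inter> under r q" using q order(2)[OF True] by (simp add: under_def)
    ultimately obtain z where z: "z \<in> Q \<inter> under r q"
      "\<And>y. (y, z) \<in> Restr r (under r q) - Id \<Longrightarrow> y \<notin> Q \<inter> under r q"
      by (erule_tac wfE_min) blast+
    have "y \<notin> Q" if y: "(y, z) \<in> r - Id" for y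
    proof -
      have "y \<in> under r q" using y z(1) order(3) by (auto simp: under_def dest: transD)
      then show ?thesis using z y by auto
    qed
    then show ?thesis using z(1) by blast
  qed (use q order(1) in blast)
qed

lemma countable_under: assumes t: "t \<in> T" shows "countable (under r t)" "countable (underS r t)"
proof -
  have "underS r t \<subseteq> Field (height r t)"
    using order(1,2) t by (fastforce simp: height_def Field_def underS_def)
  then show S: "countable (underS r t)"
    using height[OF t] by (auto simp: countable_height_def intro: countable_subset)
  have "under r t \<subseteq> insert t (underS r t)" by (auto simp: under_def underS_def)
  then show "countable (under r t)" using S by (meson countable_insert countable_subset)
qed

text \<open>Principal ideals are chains, so their finite nonempty subsets have greatest elements.
  Hence a finitely supported vector below \<open>t\<close> already lives over a single
  \<open>s\<close>, and incomparable stages never have to be combined.\<close>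

lemma common_bound:
  assumes "finite A" "A \<noteq> {}" "A \<subseteq> under r t" shows "\<exists>s\<in>A. A \<subseteq> under r s"
  using assms
proof (induction rule: finite_ne_induct)
  case (singleton x)
  then show ?case using order by (auto simp: under_def)
next
  case (insert x A)
  then obtain s where s: "s \<in> A" "A \<subseteq> under r s" by blast
  have "(x, s) \<in> r \<or> (s, x) \<in> r" using comparable[of x t s] insert.prems s(1) by (auto simp: under_def)
  then show ?case
  proof
    assume "(x, s) \<in> r" then show ?thesis using s by (auto simp: under_def)
  next
    assume sx: "(s, x) \<in> r"
    then have "A \<subseteq> under r x" using s(2) order(3) by (auto simp: under_def dest: transD)
    moreover have "(x, x) \<in> r" using sx order by blast
    ultimately show ?thesis by (auto simp: under_def)
  qed
qed

text \<open>\<open>P\<close> enters only through its values strictly below \<open>t\<close>, as the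
  recursion requires. Outside \<open>T\<close> the condition is vacuous, so that the recursion can
  run over the whole type.\<close>

definition good :: "('t \<Rightarrow> ('t \<times> nat \<Rightarrow> 'k::{division_ring, linordered_ring_strict}) \<Rightarrow> 'x set) \<Rightarrow> 't
    \<Rightarrow> (('t \<times> nat \<Rightarrow> 'k) \<Rightarrow> 'x set) \<Rightarrow> bool" where
  "good P t p \<longleftrightarrow> (t \<in> T \<longrightarrow> complete_valued_space fscale (LL t) (supported (under r t)) p
     \<and> (\<forall>s\<in>underS r t. \<forall>v\<in>supported (under r s). p v = \<Phi> s t (P s v)))"

context
  fixes t and P :: "'t \<Rightarrow> ('t \<times> nat \<Rightarrow> 'k::{division_ring, linordered_ring_strict}) \<Rightarrow> 'x set"
  assumes K: "countable (UNIV :: 'k set)" and t: "t \<in> T" and P: "\<And>s. s \<in> underS r t \<Longrightarrow> good P s (P s)"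
begin

lemma P_complete: "s \<in> underS r t \<Longrightarrow> complete_valued_space fscale (LL s) (supported (under r s)) (P s)"
  using P order(1) by (auto simp: good_def underS_def)

lemma P_map: "(s, s') \<in> r \<Longrightarrow> s' \<in> underS r t \<Longrightarrow> v \<in> supported (under r s) \<Longrightarrow> P s' v = \<Phi> s s' (P s v)"
proof (cases "s = s'")
  case True
  assume "s' \<in> underS r t" "v \<in> supported (under r s)"
  then interpret complete_valued_space fscale "LL s" "supported (under r s)" "P s" using P_complete True by simp
  have "s \<in> T" using \<open>s' \<in> _\<close> True order(1) by (auto simp: underS_def)
  moreover have "P s v \<in> LL s" using \<open>v \<in> _\<close> by simp
  ultimately show ?thesis using map_id True by simp
next
  case False
  assume "(s, s') \<in> r" "s' \<in> underS r t" "v \<in> supported (under r s)"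
  then show ?thesis using P[of s'] False order(1) by (auto simp: good_def underS_def)
qed

text \<open>The maps \<open>P s\<close> for \<open>s < t\<close>, pushed to \<open>LL t\<close> and
  glued; by \<open>limit_val_eq\<close> the chosen stage does not matter. If \<open>t\<close> is
  minimal there is no stage, but then the space is \<open>0\<close> and the value must be
  empty.\<close>

definition limit_val :: "('t \<times> nat \<Rightarrow> 'k) \<Rightarrow> 'x set" where
  "limit_val v = (if underS r t = {} then {} else
     (let s = SOME s. s \<in> underS r t \<and> v \<in> supported (under r s) in \<Phi> s t (P s v)))"

lemma limit_val_eq:
  assumes s: "s \<in> underS r t" and v: "v \<in> supported (under r s)"
  shows "limit_val v = \<Phi> s t (P s v)"
proof -
  define s' where "s' = (SOME s. s \<in> underS r t \<and> v \<in> supported (under r s))"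
  have s': "s' \<in> underS r t \<and> v \<in> supported (under r s')"
    unfolding s'_def by (rule someI[of _ s]) (use s v in simp)
  have lim: "limit_val v = \<Phi> s' t (P s' v)" using s by (auto simp: limit_val_def s'_def Let_def)
  have mem: "P s v \<in> LL s" "P s' v \<in> LL s'"
    using complete_valued_space.axioms(1)[OF P_complete] valued_space.p_mem s v s' by blast+
  have rt: "(s, t) \<in> r" "(s', t) \<in> r" using s s' by (auto simp: underS_def)
  from comparable[OF rt] show ?thesis
  proof
    assume "(s, s') \<in> r"
    then show ?thesis using P_map[of s s' v] s' v map_comp[OF _ rt(2) mem(1)] lim by simp
  next
    assume "(s', s) \<in> r"
    then show ?thesis using P_map[of s' s v] s s' map_comp[OF _ rt(1) mem(2)] lim by simp
  qed
qed

lemma common_stage: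
  fixes x y :: "'t \<times> nat \<Rightarrow> 'k"
  assumes "x \<in> supported (underS r t)" "y \<in> supported (underS r t)" "underS r t \<noteq> {}"
  shows "\<exists>s\<in>underS r t. x \<in> supported (under r s) \<and> y \<in> supported (under r s)"
proof -
  obtain d where d: "d \<in> underS r t" using assms by blast
  \<comment> \<open>Including \<open>d\<close> keeps \<open>A\<close> nonempty when both vectors
    vanish.\<close>
  define A where "A = insert d (fst ` ({i. x i \<noteq> (0::'k)} \<union> {i. y i \<noteq> 0}))"
  have A: "finite A" "A \<noteq> {}" "A \<subseteq> underS r t" using assms d by (auto simp: A_def supported_def)
  then have "A \<subseteq> under r t" by (auto simp: under_def underS_def)
  then obtain s where "s \<in> A" "A \<subseteq> under r s" using common_bound A by blast
  then show ?thesis using A assms unfolding A_def supported_def by (intro bexI[of _ s]) auto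
qed

lemma limit_valued_space: "valued_space fscale (LL t) (supported (underS r t)) limit_val"
proof (cases "underS r t = {}")
  case True
  then have "x = 0" if "x \<in> supported (underS r t)" for x :: "'t \<times> nat \<Rightarrow> 'k"
    using that by (auto simp: supported_def fun_eq_iff)
  moreover interpret normal_set_ring "LL t" using LL t by simp
  show ?thesis
    by unfold_locales (use subspace_supported True in \<open>auto simp: limit_val_def\<close>)
next
  case False
  interpret normal_set_ring "LL t" using LL t by simp
  show ?thesis
  proof
    show "fscale.subspace (supported (underS r t))" by (rule subspace_supported)
    fix x y :: "'t \<times> nat \<Rightarrow> 'k" and c :: 'k
    assume x: "x \<in> supported (underS r t)"
    have *: "limit_val x \<in> LL t \<and> (0 < c \<longrightarrow> limit_val (fscale c x) = limit_val x) \<and> limit_val x \<inter> limit_val (- x) = {}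
      \<and> limit_val (x + y) \<subseteq> limit_val x \<union> limit_val y" if y: "y \<in> supported (underS r t)" for y
    proof -
      obtain s where s: "s \<in> underS r t" "x \<in> supported (under r s)" "y \<in> supported (under r s)"
        using common_stage[OF x y False] by blast
      interpret S: complete_valued_space fscale "LL s" "supported (under r s)" "P s" using P_complete s(1) .
      note [simp] = limit_val_eq[OF s(1)]
      have st: "(s, t) \<in> r" using s by (simp add: underS_def)
      have "\<Phi> s t (P s (x + y)) \<subseteq> \<Phi> s t (P s x \<union> P s y)"
        using S.p_add[OF s(2,3)] map_Un[OF st, of "P s (x + y)" "P s x \<union> P s y"] s
        by (simp add: Un_absorb1) blast
      moreover have "\<Phi> s t (P s x) \<inter> \<Phi> s t (P s (- x)) = {}"
        using map_Int[OF st, of "P s x" "P s (- x)"] map_empty[OF st] S.p_disjoint[OF s(2)] s by simp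
      ultimately show ?thesis using map_mem[OF st] map_Un[OF st] s S.p_scale by simp
    qed
    show "limit_val x \<in> LL t" "limit_val x \<inter> limit_val (- x) = {}" using *[OF x] by simp_all
    show "limit_val (fscale c x) = limit_val x" if "0 < c" using *[OF x] that by simp
    show "limit_val (x + y) \<subseteq> limit_val x \<union> limit_val y" if "y \<in> supported (underS r t)" using *[OF that] by simp
  qed
qed

text \<open>A closed \<open>\<Phi> s t\<close> replaces \<open>x\<close> by some \<open>u\<close> at
  a stage \<open>s\<close> containing both vectors, where closedness of \<open>P s\<close> supplies
  \<open>n\<close>. Even for \<open>x = {}\<close> only the image of \<open>u\<close> is empty, not
  \<open>u\<close> itself.\<close>

lemma limit_closed: "valued_space.closed_val fscale (LL t) (supported (underS r t)) limit_val"
  unfolding valued_space.closed_val_def[OF limit_valued_space]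
proof (intro ballI impI)
  fix a b :: "'t \<times> nat \<Rightarrow> 'k" and x
  assume ab: "a \<in> supported (underS r t)" "b \<in> supported (underS r t)" and x: "x \<in> LL t"
    and le: "limit_val a \<subseteq> limit_val b \<union> x"
  show "\<exists>n>0. limit_val a \<inter> limit_val (a - fscale n b) \<subseteq> x"
  proof (cases "underS r t = {}")
    case True
    then show ?thesis using division_ring_zero_less_one[where 'k='k] by (auto simp: limit_val_def)
  next
    case False
    obtain s where s: "s \<in> underS r t" "a \<in> supported (under r s)" "b \<in> supported (under r s)"
      using common_stage[OF ab False] by blast
    interpret S: complete_valued_space fscale "LL s" "supported (under r s)" "P s" using P_complete s(1) .
    note [simp] = limit_val_eq[OF s(1)]
    have st: "(s, t) \<in> r" using s by (simp add: underS_def)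
    obtain u where u: "u \<in> LL s" "P s a \<subseteq> P s b \<union> u" "\<Phi> s t u \<subseteq> x"
      using map_closed[OF st, of "P s a" "P s b" x] le x s by auto
    obtain n where n: "n > 0" "P s a \<inter> P s (a - fscale n b) \<subseteq> u"
      using S.p_closed[OF s(2,3) u(1,2)] by blast
    have m: "P s a \<inter> P s (a - fscale n b) \<in> LL s" using s by simp
    have "\<Phi> s t (P s a \<inter> P s (a - fscale n b)) \<subseteq> \<Phi> s t u"
      using map_Un[OF st m u(1)] n(2) by (simp add: Un_absorb1) blast
    then have "limit_val a \<inter> limit_val (a - fscale n b) \<subseteq> x"
      using map_Int[OF st, of "P s a" "P s (a - fscale n b)"] s u(3) by simp
    then show ?thesis using n(1) by blast
  qed
qed

lemma good_extension: "\<exists>p. good P t p"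
proof -
  interpret B: valued_space fscale "LL t" "supported (underS r t)" limit_val by (rule limit_valued_space)
  \<comment> \<open>The unit vectors at \<open>(t, n)\<close>, new at \<open>t\<close>, are the
    supply consumed by \<open>extend_complete\<close>.\<close>
  define e :: "nat \<Rightarrow> 't \<times> nat \<Rightarrow> 'k" where "e n = (\<lambda>i. if i = (t, n) then 1 else 0)" for n
  let ?W = "supported (under r t) :: ('t \<times> nat \<Rightarrow> 'k) set"
  have un: "under r t = insert t (underS r t)" using order(2)[OF t] by (auto simp: under_def underS_def)
  have nS: "t \<notin> underS r t" by (simp add: underS_def)
  have eW: "e n \<in> ?W" for n using un by (auto simp: e_def supported_def)
  have sub: "x + y \<in> ?W" "fscale c x \<in> ?W" if "x \<in> ?W" "y \<in> ?W" for x y and c :: 'k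
    using subspace_supported[of "under r t"] that unfolding fscale.subspace_def by blast+
  \<comment> \<open>After \<open>n\<close> steps exactly the coordinates \<open>(t, m)\<close> with
    \<open>m < n\<close> are available besides the old ones. So \<open>e n\<close> is still new, and
    finiteness of supports makes the stages exhaust the space.\<close>
  have seq: "B.adjoin_seq e n = {f \<in> ?W. \<forall>m\<ge>n. f (t, m) = 0}" for n
  proof (induction n)
    case 0
    have "B.adjoin_seq e 0 = supported (underS r t)" by simp
    then show ?case using nS by (auto simp: supported_def un)
  next
    case (Suc n)
    show ?case
    proof (intro equalityI subsetI)
      fix f assume "f \<in> B.adjoin_seq e (Suc n)"
      then obtain v c where "f = v + fscale c (e n)" "v \<in> ?W" "\<forall>m\<ge>n. v (t, m) = 0"
        by (auto simp: fscale.adjoin_def Suc)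
      then show "f \<in> {f \<in> ?W. \<forall>m\<ge>Suc n. f (t, m) = 0}" using sub eW by (auto simp: fscale_def e_def)
    next
      fix f assume f: "f \<in> {f \<in> ?W. \<forall>m\<ge>Suc n. f (t, m) = 0}"
      define v where "v = f + fscale (- f (t, n)) (e n)"
      have "v (t, m) = 0" if "m \<ge> n" for m
        using f that by (cases "m = n") (auto simp: v_def fscale_def e_def)
      then have "v \<in> B.adjoin_seq e n" using f sub eW unfolding Suc v_def by auto
      moreover have "f = v + fscale (f (t, n)) (e n)" by (simp add: v_def fun_eq_iff fscale_def)
      ultimately show "f \<in> B.adjoin_seq e (Suc n)" by (auto intro: fscale.adjoinI)
    qed
  qed
  have W: "?W = (\<Union>n. B.adjoin_seq e n)"
  proof
    show "(\<Union>n. B.adjoin_seq e n) \<subseteq> ?W" by (auto simp: seq)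
    show "?W \<subseteq> (\<Union>n. B.adjoin_seq e n)"
    proof
      fix f assume f: "f \<in> ?W"
      then have "finite (snd ` {i. f i \<noteq> 0})" by (simp add: supported_def)
      then obtain n where n: "\<forall>m\<in>snd ` {i. f i \<noteq> 0}. m < n"
        unfolding finite_nat_set_iff_bounded by (elim exE) (rule that)
      have "f (t, m) = 0" if m: "m \<ge> n" for m
      proof (rule ccontr)
        assume "f (t, m) \<noteq> 0"
        then have "m \<in> snd ` {i. f i \<noteq> 0}" by (intro image_eqI[of _ _ "(t, m)"]) simp_all
        then have "m < n" using n by (rule bspec[rotated])
        then show False using m by simp
      qed
      then show "f \<in> (\<Union>n. B.adjoin_seq e n)" using f by (auto simp: seq)
    qed
  qed
  have e: "e n \<notin> B.adjoin_seq e n" for n by (auto simp: seq e_def)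
  obtain Q where Q: "valued_space fscale (LL t) ?W Q" "valued_space.closed_val fscale (LL t) ?W Q"
    "\<forall>v\<in>supported (underS r t). Q v = limit_val v" "\<forall>x\<in>LL t. B.attains ?W Q x" "\<forall>v\<in>?W. B.has_pos_part ?W Q v"
    using B.extend_complete[OF limit_closed countable_supported[OF countable_under(2)[OF t] K] LL(2)[OF t] K e W]
    by (elim exE conjE) (rule that)
  have "complete_valued_space fscale (LL t) ?W Q"
    using Q(2,4,5) countable_supported[OF countable_under(1)[OF t] K]
    unfolding valued_space.closed_val_def[OF Q(1)] B.attains_def B.has_pos_part_def
    by (intro complete_valued_space.intro Q(1) complete_valued_space_axioms.intro) auto
  moreover have "Q v = \<Phi> s t (P s v)" if s: "s \<in> underS r t" and v: "v \<in> supported (under r s)" for s v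
  proof -
    have "under r s \<subseteq> underS r t"
    proof
      fix u assume u: "u \<in> under r s"
      then have "(u, t) \<in> r" using s order(3) by (auto simp: under_def underS_def dest: transD)
      moreover have "u \<noteq> t" using u s order(4) by (auto simp: under_def underS_def dest: antisymD)
      ultimately show "u \<in> underS r t" by (simp add: underS_def)
    qed
    then have "v \<in> supported (underS r t)" using v supported_mono by blast
    then show ?thesis using Q(3) limit_val_eq[OF s v] by simp
  qed
  ultimately have "good P t Q" by (simp add: good_def)
  then show ?thesis by blast
qed

end

text \<open>Well-founded recursion with choice: \<open>good_extension\<close> provides a map at
  \<open>t\<close> from any good maps below. Compatibility at \<open>s = t\<close> is
  \<open>map_id\<close>.\<close>

theorem complete_valuations:
  assumes K: "countable (UNIV :: 'k::{division_ring, linordered_ring_strict} set)"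
  shows "\<exists>P :: 't \<Rightarrow> ('t \<times> nat \<Rightarrow> 'k) \<Rightarrow> 'x set.
    (\<forall>t\<in>T. complete_valued_space fscale (LL t) (supported (under r t)) (P t))
    \<and> (\<forall>s t. (s, t) \<in> r \<longrightarrow> (\<forall>v\<in>supported (under r s). P t v = \<Phi> s t (P s v)))"
proof -
  have "\<exists>P :: 't \<Rightarrow> ('t \<times> nat \<Rightarrow> 'k) \<Rightarrow> 'x set. \<forall>t. good P t (P t)"
  proof (rule dependent_wf_choice[OF wf_strict])
    fix P P' :: "'t \<Rightarrow> ('t \<times> nat \<Rightarrow> 'k) \<Rightarrow> 'x set" and t p
    assume "\<And>s. (s, t) \<in> r - Id \<Longrightarrow> P s = P' s"
    then show "good P t p = good P' t p" by (simp add: good_def underS_def)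
  next
    fix t and P :: "'t \<Rightarrow> ('t \<times> nat \<Rightarrow> 'k) \<Rightarrow> 'x set"
    assume "\<And>s. (s, t) \<in> r - Id \<Longrightarrow> good P s (P s)"
    then show "\<exists>p. good P t p"
      using good_extension[OF K, of t P] by (cases "t \<in> T") (auto simp: underS_def good_def)
  qed
  then obtain P :: "'t \<Rightarrow> ('t \<times> nat \<Rightarrow> 'k) \<Rightarrow> 'x set" where P: "\<And>t. good P t (P t)" by blast
  have 1: "complete_valued_space fscale (LL t) (supported (under r t)) (P t)" if "t \<in> T" for t
    using P[of t] that by (simp add: good_def)
  have "P t v = \<Phi> s t (P s v)" if st: "(s, t) \<in> r" and v: "v \<in> supported (under r s)" for s t v
  proof (cases "s = t")
    case True
    then interpret complete_valued_space fscale "LL t" "supported (under r t)" "P t" using 1 st order(1) by auto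
    show ?thesis using map_id[of t "P t v"] True v st order(1) by auto
  next
    case False
    then show ?thesis using P[of t] st v order(1) by (auto simp: good_def underS_def)
  qed
  then show ?thesis using 1 by blast
qed

end

section \<open>From rings of sets back to diagrams of lattices\<close>

theorem theorem8p4:
  fixes T :: "'t set" and r :: "'t rel"
    and L :: "'t \<Rightarrow> 'l gorder" and \<phi> :: "'t \<Rightarrow> 't \<Rightarrow> 'l \<Rightarrow> 'l"
  assumes "countable (UNIV :: 'k::{division_ring, linordered_ring_strict} set)"
    and "forest T r"
    and "\<And>t. t \<in> T \<Longrightarrow> countable_height r t"
    and "commutative_diagram T r countable_cn_lattice closed_zero_lattice_hom L \<phi>"
  shows "\<exists>(E :: 't \<Rightarrow> ('k, nat) ordered_module) f \<chi>.
      commutative_diagram T r vector_lattice vector_lattice_hom E f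
    \<and> (\<forall>t\<in>T. lattice_iso (Idc (E t)) (L t) (\<chi> t))
    \<and> (\<forall>s t. (s, t) \<in> r \<longrightarrow>
        (\<forall>I\<in>carrier (Idc (E s)).
          \<chi> t (Idc_map (E s) (E t) (f s t) I) = \<phi> s t (\<chi> s I)))"
proof -
  let ?st = "\<lambda>t. distributive_zero_lattice.stone (L t)"
  let ?inv = "\<lambda>t. inv_into (carrier (L t)) (?st t)"
  define LL where "LL t = ?st t ` carrier (L t)" for t
  \<comment> \<open>Only members of the rings are ever mapped, so \<open>\<phi>\<close> is
    conjugated with the Stone embeddings directly instead of being dualized to prime
    filters.\<close>
  define \<Phi> where "\<Phi> s t a = ?st t (\<phi> s t (?inv s a))" for s t a
  have rT: "r \<subseteq> T \<times> T" using assms(2) by (simp add: forest_def partial_order_on_def preorder_on_def)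
  have L: "distributive_zero_lattice (L t)" "completely_normal (L t)" "countable (carrier (L t))" if "t \<in> T" for t
    using assms(4) that by (auto simp: commutative_diagram_def countable_cn_lattice_def)
  note stone_inj = distributive_zero_lattice.stone_inj[OF L(1)]
    and stone_iff = distributive_zero_lattice.stone_subset_iff[OF L(1)]
    and stone_join = distributive_zero_lattice.stone_join[OF L(1)]
    and stone_meet = distributive_zero_lattice.stone_meet[OF L(1)]
    and stone_bottom = distributive_zero_lattice.stone_bottom[OF L(1)]
  have inv: "?inv t (?st t a) = a" if "t \<in> T" "a \<in> carrier (L t)" for t a
    using inv_into_f_f[OF stone_inj] that by simp
  have inv': "?inv t x \<in> carrier (L t)" "?st t (?inv t x) = x" if "x \<in> LL t" for t x
    using that unfolding LL_def by (auto intro: inv_into_into simp: f_inv_into_f)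
  have \<phi>: "\<phi> s t \<in> carrier (L s) \<rightarrow> carrier (L t)" "join_pres (L s) (L t) (\<phi> s t)" "meet_pres (L s) (L t) (\<phi> s t)"
    "\<phi> s t \<bottom>\<^bsub>L s\<^esub> = \<bottom>\<^bsub>L t\<^esub>" "closed_map (L s) (L t) (\<phi> s t)" if "(s, t) \<in> r" for s t
    using assms(4) that
    by (auto simp: commutative_diagram_def closed_zero_lattice_hom_def zero_lattice_hom_def lattice_hom_def)
  have \<Phi>: "\<Phi> s t (?st s a) = ?st t (\<phi> s t a)" if "s \<in> T" "a \<in> carrier (L s)" for s t a
    using inv[OF that] by (simp add: \<Phi>_def)
  interpret D: set_diagram T r LL \<Phi>
  proof (rule set_diagram.intro)
    show "forest T r" by (rule assms(2))
    show "countable_height r t" "normal_set_ring (LL t)" "countable (LL t)" if "t \<in> T" for t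
      using assms(3) that distributive_zero_lattice.normal_set_ring_stone[OF L(1,2)] L(3)[OF that] by (simp_all add: LL_def)
    fix s t assume st: "(s, t) \<in> r"
    then have T: "s \<in> T" "t \<in> T" using rT by auto
    interpret Ls: distributive_zero_lattice "L s" by (rule L(1)[OF T(1)])
    interpret Lt: distributive_zero_lattice "L t" by (rule L(1)[OF T(2)])
    have \<phi>c: "\<phi> s t a \<in> carrier (L t)" if "a \<in> carrier (L s)" for a using \<phi>(1)[OF st] that by auto
    show "\<Phi> s t {} = {}" using \<Phi>[OF T(1), of "\<bottom>\<^bsub>L s\<^esub>" t] \<phi>(4)[OF st] Ls.stone_bottom Lt.stone_bottom Ls.bottom_closed by simp
    fix a assume "a \<in> LL s"
    then obtain x where x: "x \<in> carrier (L s)" "a = ?st s x" by (auto simp: LL_def)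
    show "\<Phi> s t a \<in> LL t" using x \<Phi>[OF T(1)] \<phi>c by (simp add: LL_def)
    show "\<Phi> s u a = \<Phi> t u (\<Phi> s t a)" if "(t, u) \<in> r" for u
      using assms(4) st that x \<Phi>[OF T(1)] \<Phi>[OF T(2)] \<phi>c by (auto simp: commutative_diagram_def)
    fix b assume "b \<in> LL s"
    then obtain y where y: "y \<in> carrier (L s)" "b = ?st s y" by (auto simp: LL_def)
    have "a \<union> b = ?st s (x \<squnion>\<^bsub>L s\<^esub> y)" "a \<inter> b = ?st s (x \<sqinter>\<^bsub>L s\<^esub> y)"
      using Ls.stone_join Ls.stone_meet x y by simp_all
    then show "\<Phi> s t (a \<union> b) = \<Phi> s t a \<union> \<Phi> s t b" "\<Phi> s t (a \<inter> b) = \<Phi> s t a \<inter> \<Phi> s t b"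
      using x y \<Phi>[OF T(1)] \<phi>(2,3)[OF st] \<phi>c Lt.stone_join Lt.stone_meet
      by (simp_all add: join_pres_def meet_pres_def)
    fix z assume "z \<in> LL t"
    then obtain w where w: "w \<in> carrier (L t)" "z = ?st t w" by (auto simp: LL_def)
    assume "\<Phi> s t a \<subseteq> \<Phi> s t b \<union> z"
    then have "?st t (\<phi> s t x) \<subseteq> ?st t (\<phi> s t y \<squnion>\<^bsub>L t\<^esub> w)"
      using x y w \<Phi>[OF T(1)] \<phi>c Lt.stone_join by simp
    then have "\<phi> s t x \<sqsubseteq>\<^bsub>L t\<^esub> \<phi> s t y \<squnion>\<^bsub>L t\<^esub> w"
      using Lt.stone_subset_iff x y w \<phi>c by simp
    then obtain u where u: "u \<in> carrier (L s)" "x \<sqsubseteq>\<^bsub>L s\<^esub> y \<squnion>\<^bsub>L s\<^esub> u" "\<phi> s t u \<sqsubseteq>\<^bsub>L t\<^esub> w"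
      using \<phi>(5)[OF st] x y w unfolding closed_map_def by blast
    have "a \<subseteq> b \<union> ?st s u"
      using u(2) unfolding x(2) y(2) Ls.stone_join[OF y(1) u(1), symmetric]
      using Ls.stone_subset_iff[OF x(1) Ls.join_closed[OF y(1) u(1)]] by simp
    moreover have "\<Phi> s t (?st s u) \<subseteq> z" using u w \<Phi>[OF T(1)] Lt.stone_subset_iff \<phi>c by simp
    ultimately show "\<exists>u\<in>LL s. a \<subseteq> b \<union> u \<and> \<Phi> s t u \<subseteq> z" using u(1) by (auto simp: LL_def)
  next
    fix t a assume t: "t \<in> T" and "a \<in> LL t"
    then obtain x where x: "x \<in> carrier (L t)" "a = ?st t x" by (auto simp: LL_def)
    then show "\<Phi> t t a = a" using \<Phi>[OF t] assms(4) t by (simp add: commutative_diagram_def)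
  qed
  let ?V = "\<lambda>t. supported (under r t) :: ('t \<times> nat \<Rightarrow> 'k) set"
  obtain P where P: "\<And>t. t \<in> T \<Longrightarrow> complete_valued_space fscale (LL t) (?V t) (P t)"
    and nat: "\<And>s t v. (s, t) \<in> r \<Longrightarrow> v \<in> ?V s \<Longrightarrow> P t v = \<Phi> s t (P s v)"
    using D.complete_valuations[OF assms(1)] by blast
  define E where "E t = complete_valued_space.quot fscale (?V t) (P t)" for t
  define f where "f s t = valued_space_map.induced (?V s) (P s) (?V t) (P t)" for s t
  define \<chi> where "\<chi> t = ?inv t \<circ> complete_valued_space.idc_val fscale (?V t) (P t)" for t
  have map: "valued_space_map fscale (LL s) (LL t) (?V s) (P s) (?V t) (P t)" if st: "(s, t) \<in> r" for s t
  proof -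
    have T: "s \<in> T" "t \<in> T" using rT st by auto
    interpret S: complete_valued_space fscale "LL s" "?V s" "P s" by (rule P[OF T(1)])
    have "under r s \<subseteq> under r t" using st D.order(3) by (auto simp: under_def dest: transD)
    \<comment> \<open>\<open>\<Phi> s t\<close> preserves intersections and the empty set, hence
      disjointness.\<close>
    moreover have "P t x \<inter> P t y = {}" if "x \<in> ?V s" "y \<in> ?V s" "P s x \<inter> P s y = {}" for x y
      using nat[OF st] that D.map_Int[OF st, of "P s x" "P s y"] D.map_empty[OF st] by simp
    ultimately show ?thesis
      using P T supported_mono by (intro valued_space_map.intro valued_space_map_axioms.intro) blast+
  qed
  have "commutative_diagram T r vector_lattice vector_lattice_hom E f"
    unfolding commutative_diagram_def
  proof (intro conjI ballI allI impI)
    fix t assume t: "t \<in> T"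
    interpret S: complete_valued_space fscale "LL t" "?V t" "P t" by (rule P[OF t])
    interpret M: valued_space_map fscale "LL t" "LL t" "?V t" "P t" "?V t" "P t" by (rule map[OF D.order(2)[OF t]])
    show "vector_lattice (E t)" unfolding E_def by (rule S.quot.vector_lattice_axioms)
    show "f t t x = x" if "x \<in> carrier (E t)" for x using that by (auto simp: E_def f_def)
  next
    fix s t assume st: "(s, t) \<in> r"
    interpret M: valued_space_map fscale "LL s" "LL t" "?V s" "P s" "?V t" "P t" by (rule map[OF st])
    show "vector_lattice_hom (E s) (E t) (f s t)" unfolding E_def f_def by (rule M.induced_hom)
    fix u x assume tu: "(t, u) \<in> r" and x: "x \<in> carrier (E s)"
    have su: "(s, u) \<in> r" using st tu D.order(3) by (rule transD[rotated])
    interpret N: valued_space_map fscale "LL t" "LL u" "?V t" "P t" "?V u" "P u" by (rule map[OF tu])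
    interpret O: valued_space_map fscale "LL s" "LL u" "?V s" "P s" "?V u" "P u" by (rule map[OF su])
    show "f s u x = f t u (f s t x)" using x M.sub by (auto simp: E_def f_def)
  qed
  moreover have "lattice_iso (Idc (E t)) (L t) (\<chi> t)" if t: "t \<in> T" for t
  proof -
    interpret S: complete_valued_space fscale "LL t" "?V t" "P t" by (rule P[OF t])
    interpret Lt: distributive_zero_lattice "L t" by (rule L(1)[OF t])
    show ?thesis
      unfolding E_def
    proof (rule partial_order.lattice_of_order_iso(2)[OF S.partial_order_Idc])
      show "lattice (L t)" by (rule Lt.lattice_axioms)
      have "bij_betw (?inv t) (LL t) (carrier (L t))"
        unfolding LL_def by (rule bij_betw_inv_into) (simp add: bij_betw_def stone_inj t)
      then show "bij_betw (\<chi> t) (carrier (Idc S.quot)) (carrier (L t))"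
        unfolding \<chi>_def by (rule bij_betw_trans[OF S.idc_val_bij])
      fix I J assume I: "I \<in> carrier (Idc S.quot)" and J: "J \<in> carrier (Idc S.quot)"
      have "S.idc_val I \<in> LL t" "S.idc_val J \<in> LL t" using I J S.idc_val_bij by (auto simp: bij_betw_def)
      then show "I \<sqsubseteq>\<^bsub>Idc S.quot\<^esub> J \<longleftrightarrow> \<chi> t I \<sqsubseteq>\<^bsub>L t\<^esub> \<chi> t J"
        using S.idc_val_le[OF I J] stone_iff[OF t, of "\<chi> t I" "\<chi> t J"] inv' by (simp add: \<chi>_def)
    qed
  qed
  moreover have "\<chi> t (Idc_map (E s) (E t) (f s t) I) = \<phi> s t (\<chi> s I)"
    if st: "(s, t) \<in> r" and I: "I \<in> carrier (Idc (E s))" for s t I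
  proof -
    have T: "s \<in> T" "t \<in> T" using rT st by auto
    interpret M: valued_space_map fscale "LL s" "LL t" "?V s" "P s" "?V t" "P t" by (rule map[OF st])
    obtain a where a: "a \<in> ?V s" "P s (- a) = {}" "I = principal_ideal M.S.quot (M.S.cls a)"
      using I unfolding E_def M.S.carrier_Idc by blast
    \<comment> \<open>The same vector \<open>a\<close> generates the image ideal, so commutativity
      of the square reduces to \<open>P t a = \<Phi> s t (P s a)\<close>.\<close>
    have "a \<in> ?V t" "P t (- a) = {}" using a M.sub M.empty_map[of "- a"] by auto
    then have "\<chi> t (Idc_map (E s) (E t) (f s t) I) = ?inv t (P t a)"
      unfolding E_def f_def a(3) M.Idc_map_induced[OF a(1,2)] \<chi>_def by (simp add: M.T.idc_val)
    also have "\<dots> = \<phi> s t (?inv s (P s a))"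
      using nat[OF st a(1)] inv[OF T(2)] \<phi>(1)[OF st] inv'(1)[of "P s a" s] a(1) by (auto simp: \<Phi>_def)
    also have "\<dots> = \<phi> s t (\<chi> s I)"
      unfolding a(3) \<chi>_def using a by (simp add: M.S.idc_val)
    finally show ?thesis .
  qed
  ultimately show ?thesis by blast
qed

end
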